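(* Any two quasidiscs $U,V\subset\mathbb{C}$ are Schwartz equivalent.
   Context: Identify $\mathbb{C}$ with $\mathbb{R}^2$. $\mathcal{S}(\mathbb{R}^n)$ is the usual Fréchet space of real-valued Schwartz functions on $\mathbb{R}^n$ (smooth $f$ with $\sup_x|x^l f^{(k)}(x)|<\infty$ for all multi-indices $k,l$, these suprema being the defining semi-norms). For an open $U\subset\mathbb{R}^n$, $\mathcal{S}(U)$ is the closed subspace of those $f\in\mathcal{S}(\mathbb{R}^n)$ such that $f$ and all its partial derivatives vanish at every point of $\mathbb{R}^n\setminus U$, with the induced Fréchet topology; its elements are regarded (by restriction) as smooth functions on $U$. Two open subsets $U,V\subset\mathbb{R}^n$ are called Schwartz equivalent if there exists a $C^\infty$-diffeomorphism $\phi\colon U\to V$ such that $s\mapsto s\circ\phi$ is an isomorphism of Fréchet spaces $\mathcal{S}(V)\to\mathcal{S}(U)$. A closed subset $J^0\subset\mathbb{C}$ is a quasicircle if its closure in the Riemann sphere $\widehat{\mathbb{C}}$ is a Jordan curve and there is $C>0$ such that for all distinct $x,y\in J^0$ the smallest diameter of a connected component of $J^0\setminus\{x,y\}$ is at most $C|x-y|$. A quasidisc is a simply-connected open subset of $\mathbb{C}$ whose boundary (in $\mathbb{C}$) is a quasicircle; it may be bounded or unbounded. *)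

theory Defs
  imports "HOL-Analysis.Analysis"
begin

(* A multi-index of differentiation is encoded as a list of basis vectors, the head being
   differentiated last; every iterated partial derivative has this form.  At a point where the
   derivatives involved do not exist the value is meaningless, so uses are guarded by smooth_on. *)
primrec iter_partial :: "'a list \<Rightarrow> ('a::euclidean_space \<Rightarrow> 'b::real_normed_vector) \<Rightarrow> 'a \<Rightarrow> 'b" where
  "iter_partial [] f = f"
| "iter_partial (b # k) f = (\<lambda>x. frechet_derivative (iter_partial k f) (at x) b)"

(* Intended for open U, where it says that f is C-infinity on U (differentiability of all partial
   derivatives gives their continuity); values of f outside U are then irrelevant. *)
definition smooth_on :: "'a::euclidean_space set \<Rightarrow> ('a \<Rightarrow> 'b::real_normed_vector) \<Rightarrow> bool" where
  "smooth_on U f \<longleftrightarrow> (\<forall>k\<in>lists Basis. \<forall>x\<in>U. iter_partial k f differentiable (at x))"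

definition monomial :: "('a::euclidean_space \<Rightarrow> nat) \<Rightarrow> 'a \<Rightarrow> real" where
  "monomial l x = (\<Prod>b\<in>Basis. (x \<bullet> b) ^ l b)"

definition schwartz_space :: "('a::euclidean_space \<Rightarrow> real) set" where
  "schwartz_space = {f. smooth_on UNIV f \<and>
     (\<forall>l. \<forall>k\<in>lists Basis. bdd_above (range (\<lambda>x. \<bar>monomial l x * iter_partial k f x\<bar>)))}"

definition schwartz_seminorm ::
    "('a::euclidean_space \<Rightarrow> nat) \<Rightarrow> 'a list \<Rightarrow> ('a \<Rightarrow> real) \<Rightarrow> real" where
  "schwartz_seminorm l k f = (SUP x. \<bar>monomial l x * iter_partial k f x\<bar>)"

(* The locally convex topology defined by the semi-norms: open semi-norm balls form a subbasis. *)
definition schwartz_topology :: "('a::euclidean_space \<Rightarrow> real) topology" where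
  "schwartz_topology = topology_generated_by
     {{g \<in> schwartz_space. schwartz_seminorm l k (\<lambda>x. g x - f x) < e} | l k f e.
        k \<in> lists Basis \<and> f \<in> schwartz_space \<and> e > 0}"

definition schwartz_space_on :: "'a::euclidean_space set \<Rightarrow> ('a \<Rightarrow> real) set" where
  "schwartz_space_on U =
     {f \<in> schwartz_space. \<forall>k\<in>lists Basis. \<forall>x\<in>-U. iter_partial k f x = 0}"

definition schwartz_topology_on :: "'a::euclidean_space set \<Rightarrow> ('a \<Rightarrow> real) topology" where
  "schwartz_topology_on U = subtopology schwartz_topology (schwartz_space_on U)"

definition frechet_isomorphism ::
    "'a::euclidean_space set \<Rightarrow> 'b::euclidean_space set \<Rightarrow> (('a \<Rightarrow> real) \<Rightarrow> ('b \<Rightarrow> real)) \<Rightarrow> bool" where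
  "frechet_isomorphism V U T \<longleftrightarrow>
     (\<forall>s\<in>schwartz_space_on V. \<forall>t\<in>schwartz_space_on V. \<forall>a b.
        T (\<lambda>x. a * s x + b * t x) = (\<lambda>x. a * T s x + b * T t x)) \<and>
     homeomorphic_map (schwartz_topology_on V) (schwartz_topology_on U) T"

definition diffeomorphism_between ::
    "'a::euclidean_space set \<Rightarrow> 'a set \<Rightarrow> ('a \<Rightarrow> 'a) \<Rightarrow> bool" where
  "diffeomorphism_between U V \<phi> \<longleftrightarrow>
     bij_betw \<phi> U V \<and> smooth_on U \<phi> \<and> smooth_on V (inv_into U \<phi>)"

(* Elements of schwartz_space_on U are functions on the whole space vanishing off U, so the function
   s o phi on U corresponds to its extension by zero. *)
definition schwartz_pullback ::
    "'a::euclidean_space set \<Rightarrow> ('a \<Rightarrow> 'a) \<Rightarrow> ('a \<Rightarrow> real) \<Rightarrow> ('a \<Rightarrow> real)" where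
  "schwartz_pullback U \<phi> s = (\<lambda>x. if x \<in> U then s (\<phi> x) else 0)"

definition schwartz_equivalent :: "'a::euclidean_space set \<Rightarrow> 'a set \<Rightarrow> bool" where
  "schwartz_equivalent U V \<longleftrightarrow> open U \<and> open V \<and>
     (\<exists>\<phi>. diffeomorphism_between U V \<phi> \<and> frechet_isomorphism V U (schwartz_pullback U \<phi>))"

definition riemann_sphere :: "complex option topology" where
  "riemann_sphere = Alexandroff_compactification euclidean"

definition jordan_curve_in :: "'a topology \<Rightarrow> 'a set \<Rightarrow> bool" where
  "jordan_curve_in X K \<longleftrightarrow> K \<subseteq> topspace X \<and>
     subtopology X K homeomorphic_space top_of_set (sphere (0::complex) 1)"

(* J - {x, y} has finitely many components; the smallest of their diameters is at most r iff some
   component has diameter at most r.  Boundedness is required explicitly because the library's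
   real-valued diameter is only meaningful for bounded sets (unbounded ones have infinite
   diameter). *)
definition quasicircle :: "complex set \<Rightarrow> bool" where
  "quasicircle J \<longleftrightarrow> closed J \<and>
     jordan_curve_in riemann_sphere (riemann_sphere closure_of (Some ` J)) \<and>
     (\<exists>C>0. \<forall>x\<in>J. \<forall>y\<in>J. x \<noteq> y \<longrightarrow>
        (\<exists>K\<in>components (J - {x, y}). bounded K \<and> diameter K \<le> C * dist x y))"

definition quasidisc :: "complex set \<Rightarrow> bool" where
  "quasidisc U \<longleftrightarrow> open U \<and> simply_connected U \<and> quasicircle (frontier U)"

end

theory Submission
  imports Defs "HOL-Complex_Analysis.Complex_Analysis"
begin

text \<open>
  Both quasidiscs are mapped to the unit disc by Riemann maps.  Call \<open>\<delta> z\<close> the smaller of the distance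
  from \<open>z\<close> to the complement of \<open>U\<close> and \<open>1 / (1 + norm z)\<close>.  By Taylor's formula, the functions in
  \<open>schwartz_space_on U\<close> are those all of whose derivatives are bounded by every power of \<open>\<delta>\<close>, and by Cauchy's
  inequality the derivatives of a holomorphic map between two such domains are bounded by negative
  powers of \<open>\<delta>\<close>, provided that the weights correspond polynomially.  So it suffices to show that
  \<open>\<delta> z\<close> and \<open>1 - norm (f z)\<close> bound powers of each other for a Riemann map \<open>f\<close>.

  One bound holds for every simply connected domain, as a consequence of Bloch's theorem applied to a
  logarithm of \<open>g - a\<close>, where \<open>g\<close> is the inverse of \<open>f\<close> and \<open>a\<close> is not in \<open>U\<close>.  For the other one, an inversion centred at a
  point of \<open>U\<close> turns the boundary into a compact curve \<open>\<Gamma>\<close> that still satisfies the bounded turning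
  condition.  A branch of \<open>log (p - z)\<close> on \<open>\<Gamma>\<close> extends to the union of the discs around \<open>x\<close> in \<open>\<Gamma>\<close> of
  radius proportional to \<open>dist x z\<close>, because points of \<open>\<Gamma>\<close> in overlapping discs are joined by a small
  piece of \<open>\<Gamma>\<close>.  By Borsuk's separation criterion that thickened curve does not separate \<open>z\<close> from
  infinity, so \<open>z\<close> can be joined to infinity at a distance from \<open>\<Gamma>\<close> proportional to the distance
  from \<open>z\<close>.  Logarithmically many discs cover that path, and Schwarz's lemma loses a constant factor
  in each of them.
\<close>

section \<open>Bounded turning keeps points joined to infinity\<close>

text \<open>Inverting at a point \<open>c\<close> of \<open>U\<close> does three jobs: bounded and
  unbounded quasidiscs become one case, the curve becomes compact as Borsuk's criterion demands, and
  reaching infinity means reaching \<open>c\<close>, near which \<open>1 - norm (f z)\<close> is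
  bounded below. The price is that the chord condition has to be carried through the inversion, also
  near 0, the image of infinity. Borsuk's criterion yields only a connected set that reaches
  infinity, so the chains of discs run over connected sets instead of curves. Losing a power in a
  comparison of weights is harmless, since functions in \<open>schwartz_space_on U\<close> decay
  faster than every power of the weight; hence no constant is optimised.\<close>

text \<open>Distances are measured from the endpoint \<open>x\<close> alone, which changes the
  diameter of \<open>K\<close> by a factor of at most 2. As \<open>K\<close> may be any connected
  subset, no choice between two arcs is built in.\<close>

definition bounded_turning :: "real \<Rightarrow> complex set \<Rightarrow> bool" where
  "bounded_turning C J \<longleftrightarrow> (\<forall>x\<in>J. \<forall>y\<in>J. \<exists>K\<subseteq>J. connected K \<and> x \<in> K \<and> y \<in> K \<and>
     (\<forall>p\<in>K. dist p x \<le> C * dist x y))"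

text \<open>The difference of two logarithms takes values in the multiples of
  \<open>2 * pi * \<i>\<close>, a discrete set, so it is constant on a connected set.\<close>

lemma continuous_logarithm_unique:
  fixes g h :: "'a::topological_space \<Rightarrow> complex"
  assumes S: "connected S" and g: "continuous_on S g" and h: "continuous_on S h"
    and e: "\<And>p. p \<in> S \<Longrightarrow> exp (g p) = exp (h p)"
    and a: "a \<in> S" "g a = h a" and p: "p \<in> S"
  shows "g p = h p"
proof -
  have "(\<lambda>p. g p - h p) constant_on S"
  proof (rule continuous_discrete_range_constant[OF S])
    show "continuous_on S (\<lambda>p. g p - h p)" using g h by (intro continuous_intros)
    fix x assume x: "x \<in> S"
    show "\<exists>e>0. \<forall>y. y \<in> S \<and> g y - h y \<noteq> g x - h x \<longrightarrow> e \<le> norm (g y - h y - (g x - h x))"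
    proof (intro exI[of _ "2 * pi"] conjI allI impI)
      fix y assume y: "y \<in> S \<and> g y - h y \<noteq> g x - h x"
      have "exp (g y - h y) = exp (g x - h x)" using e x y by (simp add: exp_diff)
      then obtain n :: int where n: "g y - h y = g x - h x + of_int (2 * n) * of_real pi * \<i>"
        by (auto simp: exp_eq)
      with y have "n \<noteq> 0" by auto
      then have "1 \<le> \<bar>real_of_int n\<bar>" by linarith
      then have "2 * pi \<le> \<bar>real_of_int n\<bar> * (2 * pi)" by simp
      then show "2 * pi \<le> norm (g y - h y - (g x - h x))"
        using n by (simp add: norm_mult algebra_simps)
    qed simp
  qed
  then show ?thesis using a p unfolding constant_on_def by (metis eq_iff_diff_eq_0)
qed

text \<open>On this ball the quotient differs from 1 by less than 1, so it stays in the right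
  half-plane, where the principal branch is continuous.\<close>

lemma continuous_on_Ln_quotient_ball:
  assumes "x \<noteq> z"
  shows "continuous_on (ball x (dist x z)) (\<lambda>q. Ln ((q - z) / (x - z)))"
    and "\<And>q. q \<in> ball x (dist x z) \<Longrightarrow> exp (Ln ((q - z) / (x - z))) = (q - z) / (x - z)"
proof -
  have Re: "0 < Re ((q - z) / (x - z))" if "q \<in> ball x (dist x z)" for q
  proof -
    have "(q - z) / (x - z) = 1 + (q - x) / (x - z)" using assms by (simp add: field_simps)
    moreover have "norm ((q - x) / (x - z)) < 1"
      using that assms by (simp add: norm_divide dist_norm norm_minus_commute)
    ultimately show ?thesis
      by (smt (verit, best) abs_Re_le_cmod one_complex.simps(1) plus_complex.simps(1))
  qed
  then have "(q - z) / (x - z) \<notin> \<real>\<^sub>\<le>\<^sub>0" if "q \<in> ball x (dist x z)" for q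
    using that by (meson complex_nonpos_Reals_iff not_le)
  then show "continuous_on (ball x (dist x z)) (\<lambda>q. Ln ((q - z) / (x - z)))"
    using assms by (intro continuous_intros) auto
  show "\<And>q. q \<in> ball x (dist x z) \<Longrightarrow> exp (Ln ((q - z) / (x - z))) = (q - z) / (x - z)"
    using Re by (metis exp_Ln less_irrefl zero_complex.simps(1))
qed

text \<open>On the disc around \<open>x\<close> the candidate is \<open>L x\<close>, the value
  \<open>g x\<close> continued by the principal branch. If the discs of \<open>x\<close> and
  \<open>y\<close> overlap, bounded turning joins \<open>x\<close> to \<open>y\<close> inside
  \<open>J\<close> without leaving \<open>ball x (dist x z)\<close>. Along that set both
  \<open>g\<close> and \<open>L x\<close> are logarithms, so \<open>L x\<close> takes the value
  \<open>g y\<close> at \<open>y\<close> and agrees with \<open>L y\<close> on the disc of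
  \<open>y\<close>.\<close>

lemma logarithm_extends_to_neighbourhood:
  fixes z :: complex
  assumes z: "z \<notin> J" and C: "1 \<le> C" and bt: "bounded_turning C J"
    and g: "continuous_on J g" and eg: "\<And>x. x \<in> J \<Longrightarrow> exp (g x) = x - z"
    and e: "\<epsilon> = 1 / (6 * C)"
  obtains G where "continuous_on (\<Union>x\<in>J. ball x (\<epsilon> * dist x z)) G"
    and "\<And>p. p \<in> (\<Union>x\<in>J. ball x (\<epsilon> * dist x z)) \<Longrightarrow> exp (G p) = p - z"
proof -
  \<comment> \<open>An overlap gives \<open>dist x y \<le> 3 * \<epsilon> * dist x z\<close>, so the
    connecting set stays within half of \<open>dist x z\<close>; this fixes the value of
    \<open>\<epsilon>\<close>.\<close>
  have e0: "0 < \<epsilon>" "\<epsilon> \<le> 1/6" "3 * C * \<epsilon> = 1/2" using C by (auto simp: e field_simps)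
  define L where "L = (\<lambda>x q. g x + Ln ((q - z) / (x - z)))"
  have Lc: "continuous_on (ball x (dist x z)) (L x)" if "x \<in> J" for x
    unfolding L_def using that z by (intro continuous_intros continuous_on_Ln_quotient_ball) auto
  have Le: "exp (L x q) = q - z" if "x \<in> J" "q \<in> ball x (dist x z)" for x q
  proof -
    have "x \<noteq> z" using that z by auto
    with continuous_on_Ln_quotient_ball(2)[OF this that(2)] show ?thesis
      using that by (simp add: L_def exp_add eg)
  qed
  have Lx: "L x x = g x" if "x \<in> J" for x using that z by (auto simp: L_def)
  have well: "L x p = L y p"
    if x: "x \<in> J" and y: "y \<in> J" and px: "p \<in> ball x (\<epsilon> * dist x z)" and py: "p \<in> ball y (\<epsilon> * dist y z)"
    for x y p
  proof -
    have d0: "0 < dist x z" using x z by auto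
    have 1: "dist x y \<le> \<epsilon> * dist x z + \<epsilon> * dist y z"
      using px py dist_triangle2[of x y p] by simp
    have "\<epsilon> * dist y z \<le> \<epsilon> * (dist x z + dist x y)"
      using e0 dist_triangle[of y z x] by (intro mult_left_mono) (auto simp: dist_commute)
    moreover have "\<epsilon> * dist x y \<le> 1/6 * dist x y" using e0 by (intro mult_right_mono) auto
    moreover have "\<epsilon> * (dist x z + dist x y) = \<epsilon> * dist x z + \<epsilon> * dist x y" by (simp add: algebra_simps)
    moreover have "0 \<le> \<epsilon> * dist x z" using e0 by simp
    moreover have "3 * \<epsilon> * dist x z = 3 * (\<epsilon> * dist x z)" by simp
    ultimately have 2: "dist x y \<le> 3 * \<epsilon> * dist x z" using 1 by linarith
    obtain K where K: "K \<subseteq> J" "connected K" "x \<in> K" "y \<in> K" "\<And>q. q \<in> K \<Longrightarrow> dist q x \<le> C * dist x y"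
      using bt x y unfolding bounded_turning_def by metis
    have "C * dist x y \<le> C * (3 * \<epsilon> * dist x z)" using 2 C by (intro mult_left_mono) auto
    also have "\<dots> = (3 * C * \<epsilon>) * dist x z" by simp
    finally have Cd: "C * dist x y \<le> dist x z / 2" unfolding e0(3) by simp
    have Kb: "K \<subseteq> ball x (dist x z)"
    proof
      fix q assume "q \<in> K"
      from K(5)[OF this] show "q \<in> ball x (dist x z)" unfolding mem_ball dist_commute[of x q] using Cd d0 by linarith
    qed
    have gy: "g y = L x y"
    proof (rule continuous_logarithm_unique[OF K(2), of g "L x" x])
      show "continuous_on K g" using g K(1) continuous_on_subset by blast
      show "continuous_on K (L x)" using Lc[OF x] Kb continuous_on_subset by blast
      show "exp (g p) = exp (L x p)" if "p \<in> K" for p using eg[OF subsetD[OF K(1) that]] Le[OF x subsetD[OF Kb that]] by simp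
    qed (use K Lx x in auto)
    have sub: "ball y (\<epsilon> * dist y z) \<subseteq> ball x (dist x z)"
    proof
      fix q assume q: "q \<in> ball y (\<epsilon> * dist y z)"
      have dxy: "dist x y \<le> dist x z / 2" using Cd C
        mult_right_mono[of 1 C "dist x y"] by simp
      have "\<epsilon> * dist y z \<le> 1/6 * dist y z" using e0 by (intro mult_right_mono) auto
      also have "\<dots> \<le> 1/6 * (dist x z + dist x y)"
        using dist_triangle[of y z x] by (auto simp: dist_commute)
      finally have "dist y q < dist x z / 4" using q dxy by auto
      then show "q \<in> ball x (dist x z)"
        unfolding mem_ball using dxy d0 dist_triangle[of x q y] by linarith
    qed
    have sub2: "ball y (\<epsilon> * dist y z) \<subseteq> ball y (dist y z)"
      using e0 by (intro subset_ball) (simp add: mult_left_le_one_le)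
    show ?thesis
    proof (rule continuous_logarithm_unique[of "ball y (\<epsilon> * dist y z)" "L x" "L y" y])
      show "continuous_on (ball y (\<epsilon> * dist y z)) (L x)" using Lc[OF x] sub continuous_on_subset by blast
      show "continuous_on (ball y (\<epsilon> * dist y z)) (L y)" using Lc[OF y] sub2 continuous_on_subset by blast
      show "exp (L x p) = exp (L y p)" if "p \<in> ball y (\<epsilon> * dist y z)" for p
        using Le[OF x subsetD[OF sub that]] Le[OF y subsetD[OF sub2 that]] by simp
      have "y \<noteq> z" using y z by auto
      then show "y \<in> ball y (\<epsilon> * dist y z)" using e0 by simp
    qed (use gy Lx y py in auto)
  qed
  \<comment> \<open>Any centre will do: by \<open>well\<close> the value \<open>L x p\<close> does
    not depend on it.\<close>
  define c where "c = (\<lambda>p. SOME x. x \<in> J \<and> p \<in> ball x (\<epsilon> * dist x z))"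
  define G where "G = (\<lambda>p. L (c p) p)"
  have G: "G p = L x p" if "x \<in> J" "p \<in> ball x (\<epsilon> * dist x z)" for x p
  proof -
    have "c p \<in> J \<and> p \<in> ball (c p) (\<epsilon> * dist (c p) z)" unfolding c_def by (rule someI[of _ x]) (use that in auto)
    then show ?thesis unfolding G_def using well that by blast
  qed
  have sub2: "ball y (\<epsilon> * dist y z) \<subseteq> ball y (dist y z)" for y
      using e0 by (intro subset_ball) (simp add: mult_left_le_one_le)
  show thesis
  proof
    show "continuous_on (\<Union>x\<in>J. ball x (\<epsilon> * dist x z)) G"
    proof (rule continuous_on_open_UN)
      fix x assume x: "x \<in> J"
      show "continuous_on (ball x (\<epsilon> * dist x z)) G"
        by (rule continuous_on_eq[OF continuous_on_subset[OF Lc[OF x] sub2]]) (simp only: G[OF x])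
    qed auto
    show "exp (G p) = p - z" if p: "p \<in> (\<Union>x\<in>J. ball x (\<epsilon> * dist x z))" for p
    proof -
      obtain x where "x \<in> J" "p \<in> ball x (\<epsilon> * dist x z)" using p by blast
      then show ?thesis using Le[of x p] G[of x p] sub2[of x] by auto
    qed
  qed
qed

text \<open>By Borsuk, \<open>z\<close> lies in the unbounded component iff the direction of
  \<open>x - z\<close> is an inessential map to the circle, that is, has a continuous real argument.
  Adding \<open>ln (norm (x - z))\<close> makes a logarithm of it, and the imaginary part leads
  back.\<close>

lemma unbounded_complement_component_iff_logarithm:
  fixes z :: complex
  assumes "compact S" "z \<notin> S"
  shows "\<not> bounded (connected_component_set (- S) z) \<longleftrightarrow>
    (\<exists>g. continuous_on S g \<and> (\<forall>x\<in>S. exp (g x) = x - z))" (is "?L \<longleftrightarrow> ?R")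
proof -
  let ?f = "\<lambda>x. inverse (norm (x - z)) *\<^sub>R (x - z)"
  have "?L \<longleftrightarrow> (\<exists>g. continuous_on S g \<and> (\<forall>x\<in>S. ?f x = exp (\<i> * of_real (g x))))"
    unfolding Borsuk_map_essential_bounded_component[OF assms] not_not
    by (rule inessential_eq_continuous_logarithm_circle)
  also have "\<dots> \<longleftrightarrow> ?R"
  proof
    assume "\<exists>g. continuous_on S g \<and> (\<forall>x\<in>S. ?f x = exp (\<i> * of_real (g x)))"
    then obtain g where g: "continuous_on S g" "\<And>x. x \<in> S \<Longrightarrow> ?f x = exp (\<i> * of_real (g x))" by blast
    show ?R
    proof (intro exI[of _ "\<lambda>x. of_real (ln (norm (x - z))) + \<i> * of_real (g x)"] conjI ballI)
      show "continuous_on S (\<lambda>x. of_real (ln (norm (x - z))) + \<i> * of_real (g x))"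
        using g(1) assms(2) by (intro continuous_intros) auto
      fix x assume x: "x \<in> S"
      then have "x \<noteq> z" using assms by auto
      then have "exp (of_real (ln (norm (x - z)))) = (of_real (norm (x - z)) :: complex)"
        by (simp add: exp_of_real)
      then show "exp (of_real (ln (norm (x - z))) + \<i> * of_real (g x)) = x - z"
        using g(2)[OF x] \<open>x \<noteq> z\<close> by (simp add: exp_add scaleR_conv_of_real field_simps flip: g(2)[OF x])
    qed
  next
    assume ?R
    then obtain g where g: "continuous_on S g" "\<And>x. x \<in> S \<Longrightarrow> exp (g x) = x - z" by blast
    show "\<exists>g. continuous_on S g \<and> (\<forall>x\<in>S. ?f x = exp (\<i> * of_real (g x)))"
    proof (intro exI[of _ "\<lambda>x. Im (g x)"] conjI ballI)
      show "continuous_on S (\<lambda>x. Im (g x))" using g(1) by (intro continuous_intros)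
      fix x assume x: "x \<in> S"
      have "norm (x - z) = exp (Re (g x))" using g(2)[OF x] by (metis norm_exp_eq_Re)
      moreover have "x - z = of_real (exp (Re (g x))) * exp (\<i> * of_real (Im (g x)))"
        using g(2)[OF x] by (metis complex_eq exp_add exp_of_real)
      ultimately show "?f x = exp (\<i> * of_real (Im (g x)))"
        by (simp add: scaleR_conv_of_real)
    qed
  qed
  finally show ?thesis .
qed

text \<open>Thicken \<open>J\<close> to \<open>F\<close> by discs whose radius is proportional to
  the distance of their centre from \<open>z\<close>. The logarithm of \<open>x - z\<close> survives
  on \<open>F\<close>, so \<open>F\<close> does not separate \<open>z\<close> from infinity and
  \<open>P\<close> can be the component of \<open>z\<close> in its complement. Points of
  \<open>P\<close> avoid the discs, so the room around them widens linearly, like a carrot with tip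
  \<open>z\<close>.\<close>

lemma carrot:
  fixes z :: complex
  assumes J: "compact J" and z: "z \<notin> J" and unb: "\<not> bounded (connected_component_set (- J) z)"
    and C: "1 \<le> C" and bt: "bounded_turning C J"
  obtains P where "connected P" "z \<in> P" "\<not> bounded P" "P \<inter> J = {}"
    "\<And>p x. p \<in> P \<Longrightarrow> x \<in> J \<Longrightarrow> dist p z \<le> 13 * C * dist p x"
proof -
  define \<epsilon> where "\<epsilon> = 1 / (6 * C)"
  have e0: "0 < \<epsilon>" "\<epsilon> \<le> 1/6" using C by (auto simp: \<epsilon>_def field_simps)
  \<comment> \<open>Closed discs of half the radius, so that \<open>F\<close> is compact and still
    inside the open set on which the logarithm is defined.\<close>
  define F where "F = (\<lambda>y. fst y + of_real (\<epsilon>/2 * dist (fst y) z) * snd y) ` (J \<times> cball 0 1)"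
  have F: "p \<in> F" if "x \<in> J" "dist p x \<le> \<epsilon>/2 * dist x z" for x p
  proof -
    have "x \<noteq> z" using that z by auto
    then have d: "0 < \<epsilon>/2 * dist x z" using e0 by simp
    define s where "s = \<epsilon>/2 * dist x z"
    have s: "0 < s" "dist p x \<le> s" using d that by (auto simp: s_def)
    have "norm ((p - x) / of_real s) \<le> 1" using s by (simp add: norm_divide dist_norm)
    moreover have "p = x + of_real s * ((p - x) / of_real s)" using s by simp
    ultimately show ?thesis unfolding F_def s_def
      by (intro rev_image_eqI[of "(x, (p - x) / of_real (\<epsilon>/2 * dist x z))"]) (use that in auto)
  qed
  have F': "\<exists>x\<in>J. dist p x \<le> \<epsilon>/2 * dist x z" if pF: "p \<in> F" for p
  proof -
    obtain y where y: "y \<in> J \<times> cball 0 1" "p = fst y + of_real (\<epsilon>/2 * dist (fst y) z) * snd y"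
      using pF unfolding F_def by (rule imageE)
    define x v where "x = fst y" and "v = snd y"
    have xv: "x \<in> J" "norm v \<le> 1" "p = x + of_real (\<epsilon>/2 * dist x z) * v"
      using y by (auto simp only: x_def v_def mem_Times_iff mem_cball_0)
    have "dist p x = \<epsilon>/2 * dist x z * norm v" 
      unfolding dist_norm xv(3) add_diff_cancel_left' norm_mult norm_of_real using e0 by (simp add: dist_norm)
    also have "\<dots> \<le> \<epsilon>/2 * dist x z * 1" using e0 xv by (intro mult_left_mono) auto
    finally show ?thesis using xv by auto
  qed
  have comp: "compact F" unfolding F_def
    by (intro compact_continuous_image compact_Times J compact_cball)
      (intro continuous_intros)
  have zF: "z \<notin> F"
  proof
    assume "z \<in> F"
    then obtain x where x: "x \<in> J" "dist z x \<le> \<epsilon>/2 * dist x z" using F' by blast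
    have "\<epsilon>/2 * dist x z \<le> 1/12 * dist x z" using e0 by (intro mult_right_mono) auto
    moreover have "0 < dist x z" using x z by (metis zero_less_dist_iff)
    ultimately show False using x(2) unfolding dist_commute[of z x] by linarith
  qed
  have JF: "J \<subseteq> F" using e0 by (auto intro!: F mult_nonneg_nonneg)
  obtain g where g: "continuous_on J g" "\<And>x. x \<in> J \<Longrightarrow> exp (g x) = x - z"
    using unb unfolding unbounded_complement_component_iff_logarithm[OF J z] by blast
  obtain G where G: "continuous_on (\<Union>x\<in>J. ball x (\<epsilon> * dist x z)) G"
    "\<And>p. p \<in> (\<Union>x\<in>J. ball x (\<epsilon> * dist x z)) \<Longrightarrow> exp (G p) = p - z"
    using logarithm_extends_to_neighbourhood[OF z C bt g \<epsilon>_def] by blast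
  have sub: "F \<subseteq> (\<Union>x\<in>J. ball x (\<epsilon> * dist x z))"
  proof
    fix p assume "p \<in> F"
    then obtain x where x: "x \<in> J" "dist p x \<le> \<epsilon>/2 * dist x z" using F' by blast
    moreover have "0 < \<epsilon> * dist x z" using x z e0 by (metis mult_pos_pos zero_less_dist_iff)
    ultimately show "p \<in> (\<Union>x\<in>J. ball x (\<epsilon> * dist x z))" by (auto simp: dist_commute intro!: bexI[of _ x])
  qed
  define P where "P = connected_component_set (- F) z"
  have "\<not> bounded P" unfolding P_def unbounded_complement_component_iff_logarithm[OF comp zF]
    by (intro exI[of _ G] conjI continuous_on_subset[OF G(1) sub] ballI G(2) subsetD[OF sub])
  moreover have PF: "P \<subseteq> - F" unfolding P_def by (rule connected_component_subset)
  moreover have "dist p z \<le> 13 * C * dist p x" if "p \<in> P" "x \<in> J" for p x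
  proof -
    have "p \<notin> F" using that(1) PF by blast
    then have "\<epsilon>/2 * dist x z < dist p x" using F[OF that(2), of p] by linarith
    \<comment> \<open>\<open>\<epsilon>/2\<close> is \<open>1 / (12 * C)\<close>; the triangle
      inequality adds one more \<open>dist p x\<close>, which makes 13.\<close>
    then have "dist x z \<le> 12 * C * dist p x" using C by (simp add: \<epsilon>_def field_simps)
    then have "dist p z \<le> dist p x + 12 * C * dist p x" by (smt (verit) dist_triangle)
    also have "\<dots> \<le> 13 * C * dist p x" using C by (simp add: algebra_simps mult_right_mono mult_le_cancel_right1)
    finally show ?thesis .
  qed
  moreover have "connected P" "z \<in> P" using zF by (simp_all add: P_def)
  moreover have "P \<inter> J = {}" using PF JF by blast
  ultimately show thesis using that[of P] by blast
qed

section \<open>Growth of bounded holomorphic functions along chains of discs\<close>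

text \<open>The hypothesis says that the pseudohyperbolic distance of \<open>v\<close> and
  \<open>w\<close> is at most 1/2. By the identity \<open>id\<close>, the right-hand side there is
  then at least \<open>3/4 * D\<^sup>2\<close>, and \<open>D\<close> is at least
  \<open>1 - norm w\<close>. One factor \<open>1 - norm w\<close> cancels, and 4/3 times 4 is
  rounded up to 6.\<close>

lemma one_minus_norm_le_of_pseudohyperbolic:
  fixes v w :: complex
  assumes v: "norm v < 1" and w: "norm w < 1" and le: "norm (v - w) \<le> norm (1 - cnj w * v) / 2"
  shows "1 - norm w \<le> 6 * (1 - norm v)"
proof -
  define D where "D = norm (1 - cnj w * v)"
  have id: "D\<^sup>2 - (norm (v - w))\<^sup>2 = (1 - (norm w)\<^sup>2) * (1 - (norm v)\<^sup>2)"
    unfolding D_def cmod_power2 by (simp add: power2_eq_square algebra_simps)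
  have "norm w * norm v \<le> norm w" using v by (simp add: mult_left_le)
  then have D: "1 - norm w \<le> D"
    unfolding D_def using norm_triangle_ineq2[of 1 "cnj w * v"] by (simp add: norm_mult)
  have "(norm (v - w))\<^sup>2 \<le> (D / 2)\<^sup>2" using le unfolding D_def by (intro power_mono) auto
  then have "3/4 * D\<^sup>2 \<le> (1 - (norm w)\<^sup>2) * (1 - (norm v)\<^sup>2)" using id by (simp add: power_divide)
  moreover have "(1 - norm w)\<^sup>2 \<le> D\<^sup>2" using D w by (intro power_mono) auto
  ultimately have "3/4 * (1 - norm w)\<^sup>2 \<le> (1 - (norm w)\<^sup>2) * (1 - (norm v)\<^sup>2)" by linarith
  moreover have "(1 - (norm w)\<^sup>2) * (1 - (norm v)\<^sup>2) = (1 - norm w) * ((1 + norm w) * (1 + norm v) * (1 - norm v))"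
    "3/4 * (1 - norm w)\<^sup>2 = (1 - norm w) * (3/4 * (1 - norm w))"
    by (simp_all add: power2_eq_square algebra_simps)
  ultimately have "(1 - norm w) * (3/4 * (1 - norm w)) \<le> (1 - norm w) * ((1 + norm w) * (1 + norm v) * (1 - norm v))"
    by metis
  then have "3/4 * (1 - norm w) \<le> (1 + norm w) * (1 + norm v) * (1 - norm v)"
    by (rule mult_left_le_imp_le) (use w in simp)
  also have "\<dots> \<le> (2 * 2) * (1 - norm v)"
    using v w by (intro mult_right_mono mult_mono) auto
  finally show ?thesis using v by simp
qed

text \<open>Schwarz's lemma after a Moebius map that sends \<open>f p\<close> to 0: a point within
  half the radius has its image within pseudohyperbolic distance 1/2 of \<open>f p\<close>. That
  distance is symmetric, hence both inequalities.\<close>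

lemma harnack_disc:
  assumes f: "f holomorphic_on ball p r" and im: "f ` ball p r \<subseteq> ball 0 1" and r: "0 < r"
    and q: "dist p q \<le> r / 2"
  shows "1 - norm (f p) \<le> 6 * (1 - norm (f q))" and "1 - norm (f q) \<le> 6 * (1 - norm (f p))"
proof -
  define F where "F = (\<lambda>\<xi>. f (p + of_real r * \<xi>))"
  define w where "w = f p"
  have mem: "p + of_real r * \<xi> \<in> ball p r" if "norm \<xi> < 1" for \<xi>
    using that r by (simp add: dist_norm norm_mult)
  have w: "norm w < 1" using im r by (auto simp: w_def image_subset_iff)
  have Fd: "norm (F \<xi>) < 1" if "norm \<xi> < 1" for \<xi>
    using im mem[OF that] by (auto simp: F_def image_subset_iff)
  have holF: "F holomorphic_on ball 0 1"
    unfolding F_def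
    by (rule holomorphic_on_compose_gen[OF _ f, unfolded o_def]) (auto intro!: holomorphic_intros mem)
  define M where "M = (\<lambda>\<xi>. Moebius_function 0 w (F \<xi>))"
  have holM: "M holomorphic_on ball 0 1"
    unfolding M_def
    by (rule holomorphic_on_compose_gen[OF holF Moebius_function_holomorphic[OF w], unfolded o_def])
      (use Fd in auto)
  have M0: "M 0 = 0" by (simp add: M_def F_def w_def Moebius_function_eq_zero)
  have Mlt: "norm (M \<xi>) < 1" if "norm \<xi> < 1" for \<xi>
    unfolding M_def by (intro Moebius_function_norm_lt_1 w Fd that)
  define \<xi> where "\<xi> = (q - p) / of_real r"
  have x: "norm \<xi> \<le> 1/2" using q r by (simp add: \<xi>_def norm_divide dist_norm norm_minus_commute)
  then have x1: "norm \<xi> < 1" by simp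
  have Fq: "F \<xi> = f q" using r by (simp add: F_def \<xi>_def)
  have v: "norm (f q) < 1" using Fd[OF x1] Fq by simp
  have "norm (M \<xi>) \<le> 1/2" using Schwarz_Lemma(1)[OF holM M0 Mlt x1] x by linarith
  then have "norm (f q - w) / norm (1 - cnj w * f q) \<le> 1/2"
    by (simp add: M_def Fq Moebius_function_simple norm_divide)
  moreover have "1 - cnj w * f q \<noteq> 0"
  proof
    assume "1 - cnj w * f q = 0"
    then have "norm w * norm (f q) = 1" by (metis complex_mod_cnj norm_mult norm_one right_minus_eq)
    moreover have "norm w * norm (f q) \<le> norm w" using v by (simp add: mult_left_le)
    ultimately show False using w by linarith
  qed
  ultimately have le: "norm (f q - w) \<le> norm (1 - cnj w * f q) / 2" by (simp add: divide_simps)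
  have "norm (1 - cnj w * f q) = norm (cnj (1 - cnj w * f q))" by (simp only: complex_mod_cnj)
  then have sym: "norm (1 - cnj w * f q) = norm (1 - cnj (f q) * w)" by (simp add: mult.commute)
  show "1 - norm (f p) \<le> 6 * (1 - norm (f q))"
    using one_minus_norm_le_of_pseudohyperbolic[OF v w le] by (simp add: w_def)
  show "1 - norm (f q) \<le> 6 * (1 - norm (f p))"
    using one_minus_norm_le_of_pseudohyperbolic[OF w v] le sym by (simp add: w_def norm_minus_commute)
qed

text \<open>A subfamily containing \<open>q\<close> is grown one set at a time. While it misses part
  of \<open>A\<close>, connectedness provides a further set that meets it inside \<open>A\<close>,
  at the cost of one factor \<open>k\<close>; so the exponent need not exceed the number of
  sets.\<close>

lemma connected_cover_chain:
  fixes u :: "'a::topological_space \<Rightarrow> real"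
  assumes A: "connected A" and fin: "finite \<B>" and cov: "A \<subseteq> \<Union>\<B>" and op: "\<And>B. B \<in> \<B> \<Longrightarrow> open B"
    and u: "\<And>B p q. B \<in> \<B> \<Longrightarrow> p \<in> A \<inter> B \<Longrightarrow> q \<in> A \<inter> B \<Longrightarrow> u p \<le> k * u q"
    and k: "1 \<le> k" and pos: "\<And>p. p \<in> A \<Longrightarrow> 0 \<le> u p" and p: "p \<in> A" and q: "q \<in> A"
  shows "u p \<le> k ^ card \<B> * u q"
proof -
  have step: "\<exists>\<C>\<subseteq>\<B>. q \<in> \<Union>\<C> \<and> (\<forall>p\<in>A \<inter> \<Union>\<C>. u p \<le> k ^ Suc n * u q) \<and> (A \<subseteq> \<Union>\<C> \<or> Suc n \<le> card \<C>)" for n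
  proof (induction n)
    case 0
    obtain B where B: "B \<in> \<B>" "q \<in> B" using cov q by blast
    then show ?case using u q by (intro exI[of _ "{B}"]) auto
  next
    case (Suc n)
    then obtain \<C> where C: "\<C> \<subseteq> \<B>" "q \<in> \<Union>\<C>" "\<And>p. p\<in>A \<inter> \<Union>\<C> \<Longrightarrow> u p \<le> k ^ Suc n * u q"
      "A \<subseteq> \<Union>\<C> \<or> Suc n \<le> card \<C>" by blast
    have mono: "k ^ Suc n * u q \<le> k ^ Suc (Suc n) * u q"
      using k pos[OF q] by (intro mult_right_mono power_increasing) auto
    show ?case
    proof (cases "A \<subseteq> \<Union>\<C>")
      case True
      show ?thesis
      proof (intro exI[of _ \<C>] conjI ballI disjI1)
        show "u p \<le> k ^ Suc (Suc n) * u q" if "p \<in> A \<inter> \<Union>\<C>" for p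
          using C(3)[OF that] mono by linarith
      qed (fact C True)+
    next
      case False
      have "\<exists>B\<in>\<B> - \<C>. A \<inter> B \<inter> \<Union>\<C> \<noteq> {}"
      proof (rule ccontr)
        assume n: "\<not> ?thesis"
        have "open (\<Union>\<C>)" "open (\<Union>(\<B> - \<C>))" using op C(1) by (auto intro!: open_Union)
        moreover have "\<Union>\<C> \<inter> \<Union>(\<B> - \<C>) \<inter> A = {}" using n by blast
        moreover have "A \<subseteq> \<Union>\<C> \<union> \<Union>(\<B> - \<C>)" using cov by blast
        ultimately have "\<Union>\<C> \<inter> A = {} \<or> \<Union>(\<B> - \<C>) \<inter> A = {}"
          by (rule connectedD[OF A])
        then show False using C(2) q False cov by blast
      qed
      then obtain B r where B: "B \<in> \<B>" "B \<notin> \<C>" and r: "r \<in> A" "r \<in> B" "r \<in> \<Union>\<C>" by blast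
      have "u p \<le> k ^ Suc (Suc n) * u q" if "p \<in> A \<inter> \<Union>(insert B \<C>)" for p
      proof (cases "p \<in> \<Union>\<C>")
        case True
        then have "p \<in> A \<inter> \<Union>\<C>" using that by blast
        from C(3)[OF this] show ?thesis using mono by linarith
      next
        case False
        then have "p \<in> A \<inter> B" using that by blast
        then have "u p \<le> k * u r" using B(1) r(1,2) by (intro u[of B]) auto
        also have "\<dots> \<le> k * (k ^ Suc n * u q)" using k r by (intro mult_left_mono C(3)) auto
        finally show ?thesis by (simp add: mult.assoc)
      qed
      moreover have "card (insert B \<C>) = Suc (card \<C>)"
        using B finite_subset[OF C(1) fin] by simp
      moreover have "Suc n \<le> card \<C>" using C(4) False by blast
      ultimately show ?thesis using C(1,2) B(1)
        by (intro exI[of _ "insert B \<C>"] conjI ballI disjI2) auto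
    qed
  qed
  have "card \<B> \<noteq> 0" using fin cov q by auto
  then obtain n where n: "card \<B> = Suc n" by (cases "card \<B>") auto
  from step[of n] obtain \<C> where C: "\<C> \<subseteq> \<B>" "\<forall>p\<in>A \<inter> \<Union>\<C>. u p \<le> k ^ Suc n * u q"
    "A \<subseteq> \<Union>\<C> \<or> Suc n \<le> card \<C>" by (elim exE conjE)
  have "A \<subseteq> \<Union>\<C>"
    using C(3)
  proof
    assume "Suc n \<le> card \<C>"
    then have "\<C> = \<B>" using C(1) n fin by (intro card_seteq) auto
    then show ?thesis using cov by simp
  qed
  then have "p \<in> A \<inter> \<Union>\<C>" using p by blast
  then show ?thesis using C(2) n by metis
qed

lemma dyadic_bracket:
  fixes x :: real
  assumes "1 \<le> x"
  obtains n where "2 ^ n \<le> x" "x < 2 ^ Suc n"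
proof -
  obtain m where m: "x < 2 ^ m" using real_arch_pow[of 2 x] by auto
  define k where "k = (LEAST m. x < 2 ^ m)"
  have k: "x < 2 ^ k" unfolding k_def using m by (rule LeastI)
  have "k \<noteq> 0" using k assms by (cases k) auto
  then obtain n where n: "k = Suc n" by (cases k) auto
  have "\<not> x < 2 ^ n" using not_less_Least[of n "\<lambda>m. x < 2 ^ m"] n by (auto simp: k_def)
  then show thesis using that[of n] k n by simp
qed

lemma ball_subset_if_avoids_frontier:
  assumes "p \<in> W" "0 < r" "ball p r \<inter> J = {}" "frontier W \<subseteq> J"
  shows "ball (p::'a::real_normed_vector) r \<subseteq> W"
proof (rule ccontr)
  assume "\<not> ball p r \<subseteq> W"
  then have "ball p r \<inter> frontier W \<noteq> {}"
    using assms(1,2) centre_in_ball[of p r] by (intro connected_Int_frontier connected_ball) blast+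
  then show False using assms(3,4) by blast
qed

text \<open>Infinity is the good end: beyond \<open>R\<close> the map stays away from the unit
  circle by \<open>u0\<close>. The carrot from \<open>z\<close> is covered by a disc around
  \<open>z\<close>, the outside of radius \<open>R\<close>, and for every dyadic scale in between a
  scaled copy of one fixed finite cover of an annulus. The number of scales is logarithmic in
  \<open>R / d\<close>, so a constant raised to the number of discs is a power of
  \<open>R / d\<close>.\<close>

lemma one_minus_norm_ge_power_dist:
  fixes \<Phi> :: "complex \<Rightarrow> complex"
  assumes W: "connected W" "frontier W \<subseteq> J" "W \<inter> J = {}"
    and far: "{q. R < norm q} \<subseteq> W" and R: "0 < R"
    and \<Phi>: "\<Phi> holomorphic_on W" "\<Phi> ` W \<subseteq> ball 0 1"
    and u0: "0 < u0" "\<And>q. R < norm q \<Longrightarrow> u0 \<le> 1 - norm (\<Phi> q)"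
    and J: "compact J" "J \<noteq> {}" and C: "1 \<le> C" and bt: "bounded_turning C J"
  obtains M K where "0 < K"
    "\<And>z d. z \<in> W \<Longrightarrow> norm z \<le> R \<Longrightarrow> 0 < d \<Longrightarrow> ball z d \<inter> J = {} \<Longrightarrow> d ^ M \<le> K * (1 - norm (\<Phi> z))"
proof -
  define u where "u = (\<lambda>p. 1 - norm (\<Phi> p))"
  have upos: "0 < u p" if "p \<in> W" for p using \<Phi>(2) that by (auto simp: u_def image_subset_iff)
  define c where "c = 1 / (13 * C)"
  have c: "0 < c" "c \<le> 1/13" using C by (auto simp: c_def field_simps)
  \<comment> \<open>Two points of one covering disc are within
    \<open>2 * s * \<eta> = c * s / 4\<close>, half the radius \<open>c * s / 2\<close> of the disc
    around \<open>p\<close> that misses \<open>J\<close>, as \<open>harnack_disc\<close>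
    requires.\<close>
  define \<eta> where "\<eta> = c / 8"
  have \<eta>: "0 < \<eta>" "\<eta> \<le> 1/2" using c by (auto simp: \<eta>_def)
  define A where "A = cball (0::complex) 2 - ball 0 1"
  have "compact A" unfolding A_def by (simp add: compact_diff)
  then obtain X where X: "X \<subseteq> A" "finite X" "A \<subseteq> (\<Union>x\<in>X. ball x \<eta>)"
    by (rule compactE_image[of A A "\<lambda>x. ball x \<eta>"]) (use \<eta> in auto)
  \<comment> \<open>36 is two Harnack steps through the centre \<open>z\<close>;
    \<open>1 / u0\<close> serves the outside region, where \<open>u\<close> lies between
    \<open>u0\<close> and 1.\<close>
  define \<kappa> where "\<kappa> = 36 + 1 / u0"
  have \<kappa>: "1 \<le> \<kappa>" "36 \<le> \<kappa>" "1 / u0 \<le> \<kappa>" using u0 by (auto simp: \<kappa>_def)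
  \<comment> \<open>One scale costs at most \<open>2 ^ M\<close>, so \<open>Suc N\<close> scales
    cost \<open>(2 ^ Suc N) ^ M\<close>, which is a power of \<open>R / d\<close> up to a
    constant.\<close>
  obtain M where M: "\<kappa> ^ card X \<le> 2 ^ M" using real_arch_pow[of 2 "\<kappa> ^ card X"] by (auto intro: less_imp_le)
  define K where "K = \<kappa>\<^sup>2 * (32 * R) ^ M / u0"
  have "0 < \<kappa>" using \<kappa> by linarith
  then have "0 < K" using u0 R by (simp add: K_def)
  moreover have "d ^ M \<le> K * (1 - norm (\<Phi> z))"
    if z: "z \<in> W" "norm z \<le> R" and d: "0 < d" "ball z d \<inter> J = {}" for z d
  proof -
    have "z \<notin> J" using z W by blast
    have JR: "norm x \<le> R" if "x \<in> J" for x using that far W(3) by force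
    have "W \<subseteq> connected_component_set (- J) z"
      using W z by (intro connected_component_maximal) auto
    moreover have "\<not> bounded W"
    proof
      assume "bounded W"
      then obtain B where B: "\<And>p. p \<in> W \<Longrightarrow> norm p \<le> B" unfolding bounded_iff by blast
      have "of_real (max R B + 1) \<in> W" using far R by (intro subsetD[OF far]) (simp del: of_real_add)
      from B[OF this] show False using R by (simp del: of_real_add)
    qed
    ultimately have "\<not> bounded (connected_component_set (- J) z)" by (metis bounded_subset)
    from carrot[OF J(1) \<open>z \<notin> J\<close> this C bt] obtain P where P: "connected P" "z \<in> P" "\<not> bounded P" "P \<inter> J = {}"
      "\<And>p x. p \<in> P \<Longrightarrow> x \<in> J \<Longrightarrow> dist p z \<le> 13 * C * dist p x" by metis
    have Pd: "c * dist p z \<le> dist p x" if "p \<in> P" "x \<in> J" for p x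
      using P(5)[OF that] C by (simp add: c_def field_simps)
    have PW: "P \<subseteq> W"
    proof (rule ccontr)
      assume "\<not> P \<subseteq> W"
      then have "P \<inter> frontier W \<noteq> {}" using P(1,2) z(1) by (intro connected_Int_frontier) auto
      then show False using P(4) W(2) by blast
    qed
    obtain q1 where q1: "q1 \<in> P" "R < norm q1" using P(3) unfolding bounded_iff by (metis not_le)
    obtain x0 where x0: "x0 \<in> J" using J by blast
    have "d \<le> dist z x0" using x0 d by (meson disjoint_iff linorder_not_le mem_ball)
    also have "\<dots> \<le> R + R" using z JR[OF x0] by (metis add_mono dist_norm norm_triangle_ineq4 order_trans)
    finally have dR: "d \<le> 2 * R" by simp
    have "1 \<le> 8 * R / d" using dR d R by (simp add: field_simps)
    then obtain N where N: "2 ^ N \<le> 8 * R / d" "8 * R / d < 2 ^ Suc N" by (rule dyadic_bracket)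
    define bl where "bl = (\<lambda>(n, x). ball (z + of_real (2 ^ n * d / 4) * x) (2 ^ n * d / 4 * \<eta>))"
    define \<B> where "\<B> = {ball z (d/2), {q. R < norm q}} \<union> bl ` ({..<Suc N} \<times> X)"
    have fin: "finite \<B>" using X by (simp add: \<B>_def)
    have "card \<B> \<le> card {ball z (d/2), {q. R < norm q}} + card (bl ` ({..<Suc N} \<times> X))"
      unfolding \<B>_def by (rule card_Un_le)
    also have "\<dots> \<le> 2 + card ({..<Suc N} \<times> X)"
      by (intro add_mono card_image_le) (use X in \<open>auto simp: card_insert_if\<close>)
    also have "\<dots> = 2 + card X * Suc N" by (simp add: card_cartesian_product mult.commute)
    finally have card: "card \<B> \<le> 2 + card X * Suc N" .
    have cov: "P \<subseteq> \<Union>\<B>"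
    proof
      fix p assume p: "p \<in> P"
      show "p \<in> \<Union>\<B>"
      proof (cases "dist z p < d / 2 \<or> R < norm p")
        case True then show ?thesis by (auto simp: \<B>_def)
      next
        case False
        then have p2: "d / 2 \<le> dist z p" "norm p \<le> R" by auto
        have "1 \<le> 4 * dist z p / d" using p2 d by (simp add: field_simps)
        then obtain n where n: "2 ^ n \<le> 4 * dist z p / d" "4 * dist z p / d < 2 ^ Suc n" by (rule dyadic_bracket)
        define s where "s = 2 ^ n * d / 4"
        have s: "0 < s" "s \<le> dist z p" "dist z p < 2 * s" using n d by (auto simp: s_def field_simps)
        have "dist z p \<le> R + R" using z p2 by (metis add_mono dist_norm norm_triangle_ineq4 order_trans)
        then have "4 * dist z p / d \<le> 8 * R / d" using d by (simp add: divide_right_mono)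
        then have "(2::real) ^ n < 2 ^ Suc N" using n N by linarith
        then have nN: "n < Suc N" by (meson one_less_numeral_iff power_less_imp_less_exp semiring_norm(76))
        have "(p - z) / of_real s \<in> A" using s
          by (auto simp: A_def norm_divide dist_norm norm_minus_commute divide_simps)
        then obtain x where x: "x \<in> X" "dist x ((p - z) / of_real s) < \<eta>" using X(3) by auto
        have "complex_of_real s \<noteq> 0" using s(1) by simp
        then have "p - (z + of_real s * x) = of_real s * ((p - z) / of_real s - x)"
          by (simp add: right_diff_distrib diff_divide_distrib)
        then have "dist (z + of_real s * x) p = s * dist x ((p - z) / of_real s)"
          using s by (metis abs_of_pos dist_commute dist_norm norm_mult norm_of_real)
        also have "\<dots> < s * \<eta>" using x s by (intro mult_strict_left_mono)
        finally have "p \<in> bl (n, x)" by (simp add: bl_def s_def)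
        then show ?thesis using nN x by (auto simp: \<B>_def)
      qed
    qed
    have op: "open B" if "B \<in> \<B>" for B
      using that by (auto simp: \<B>_def bl_def intro!: open_Collect_less continuous_intros)
    have har: "u p \<le> 6 * u q \<and> u q \<le> 6 * u p" if "p \<in> W" "0 < r" "ball p r \<inter> J = {}" "dist p q \<le> r / 2" for p q r
    proof -
      have sub: "ball p r \<subseteq> W" by (rule ball_subset_if_avoids_frontier) (use that W in auto)
      then have "\<Phi> holomorphic_on ball p r" "\<Phi> ` ball p r \<subseteq> ball 0 1"
        using \<Phi> holomorphic_on_subset by (blast, blast)
      then show ?thesis using harnack_disc[of \<Phi> p r q] that by (auto simp: u_def)
    qed
    have uB: "u p \<le> \<kappa> * u q" if B: "B \<in> \<B>" and p: "p \<in> P \<inter> B" and q: "q \<in> P \<inter> B" for B p q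
    proof -
      have pos: "0 < u p" "0 < u q" using p q PW upos by blast+
      consider "B = ball z (d/2)" | "B = {q. R < norm q}" | n x where "x \<in> X" "B = bl (n, x)"
        using B by (auto simp: \<B>_def)
      then show ?thesis
      proof cases
        case 1
        then have "u p \<le> 6 * u z" "u z \<le> 6 * u q"
          using har[of z d p] har[of z d q] p q z d by (auto simp: dist_commute)
        then have "u p \<le> 36 * u q" by simp
        also have "\<dots> \<le> \<kappa> * u q" using \<kappa> pos by (intro mult_right_mono) auto
        finally show ?thesis .
      next
        case 2
        then have "u0 \<le> u q" using u0(2) q by (auto simp: u_def)
        then have "1 \<le> 1 / u0 * u q" using u0 by (simp add: field_simps)
        also have "\<dots> \<le> \<kappa> * u q" using \<kappa> pos by (intro mult_right_mono) auto
        finally show ?thesis by (smt (verit) norm_ge_zero u_def)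
      next
        case 3
        define s where "s = 2 ^ n * d / 4"
        have s: "0 < s" using d by (simp add: s_def)
        have pb: "dist (z + of_real s * x) p < s * \<eta>" and qb: "dist (z + of_real s * x) q < s * \<eta>"
          using p q 3 by (auto simp: bl_def s_def)
        have "1 \<le> norm x" using 3 X by (auto simp: A_def)
        then have "s \<le> dist (z + of_real s * x) z" using s by (simp add: dist_norm norm_mult)
        also have "\<dots> \<le> s * \<eta> + dist p z"
          using pb dist_triangle[of "z + of_real s * x" z p] by linarith
        also have "s * \<eta> \<le> s * (1/2)" using s \<eta> by (intro mult_left_mono) auto
        finally have pz: "s / 2 \<le> dist p z" by simp
        have av: "ball p (c * s / 2) \<inter> J = {}"
        proof -
          have "c * s / 2 \<le> dist p x" if "x \<in> J" for x
          proof -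
            have "c * (s / 2) \<le> c * dist p z" using pz c by (intro mult_left_mono) auto
            then show ?thesis using Pd[of p x] p that by auto
          qed
          then show ?thesis by force
        qed
        have "dist p q \<le> s * \<eta> + s * \<eta>"
          using pb qb dist_triangle3[of p q "z + of_real s * x"] by linarith
        then have "dist p q \<le> (c * s / 2) / 2" by (simp add: \<eta>_def algebra_simps)
        then have "u p \<le> 6 * u q" using har[of p "c * s / 2" q] av p PW c s by auto
        also have "\<dots> \<le> \<kappa> * u q" using \<kappa> pos by (intro mult_right_mono) auto
        finally show ?thesis .
      qed
    qed
    have "u q1 \<le> \<kappa> ^ card \<B> * u z"
      by (rule connected_cover_chain[OF P(1) fin cov op uB \<kappa>(1) _ q1(1) P(2)])
        (use upos PW in \<open>auto intro: less_imp_le\<close>)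
    also have "\<dots> \<le> \<kappa> ^ (2 + card X * Suc N) * u z"
      using upos[OF z(1)] \<kappa> card by (intro mult_right_mono power_increasing) auto
    also have "\<dots> = \<kappa>\<^sup>2 * (\<kappa> ^ card X) ^ Suc N * u z" by (simp add: power_add power_mult power2_eq_square)
    also have "\<dots> \<le> \<kappa>\<^sup>2 * (2 ^ M) ^ Suc N * u z"
      using upos[OF z(1)] \<kappa> M by (intro mult_right_mono mult_left_mono power_mono) auto
    also have "(2 ^ M) ^ Suc N = ((2::real) ^ Suc N) ^ M" by (metis mult.commute power_mult)
    also have "\<kappa>\<^sup>2 * (2 ^ Suc N) ^ M * u z \<le> \<kappa>\<^sup>2 * (32 * R / d) ^ M * u z"
      using upos[OF z(1)] \<kappa> N R d by (intro mult_right_mono mult_left_mono power_mono) auto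
    finally have "u0 \<le> \<kappa>\<^sup>2 * (32 * R / d) ^ M * u z" using u0(2)[OF q1(2)] by (simp add: u_def)
    then show ?thesis using d u0 by (simp add: K_def u_def field_simps power_divide)
  qed
  ultimately show thesis using that by blast
qed

section \<open>Jordan curves and inversion of quasicircles\<close>

text \<open>The endpoints form an unordered pair and the parameter interval is free, so both halves
  of one closed parametrisation qualify without reversing or rescaling.\<close>

definition arc_between :: "complex \<Rightarrow> complex \<Rightarrow> complex set \<Rightarrow> bool" where
  "arc_between x y B \<longleftrightarrow> (\<exists>\<gamma> a b. a < (b::real) \<and> continuous_on {a..b} \<gamma> \<and> inj_on \<gamma> {a..b} \<and>
     B = \<gamma> ` {a..b} \<and> {x, y} = {\<gamma> a, \<gamma> b})"

lemma arc_between_endpoints_in: "arc_between x y B \<Longrightarrow> x \<in> B" "arc_between x y B \<Longrightarrow> y \<in> B"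
proof -
  assume "arc_between x y B"
  then obtain \<gamma> and a b :: real where "a < b" "B = \<gamma> ` {a..b}" "{x, y} = {\<gamma> a, \<gamma> b}"
    unfolding arc_between_def by blast
  then have "{x, y} \<subseteq> B" by auto
  then show "x \<in> B" "y \<in> B" by auto
qed

text \<open>In the last claim \<open>T\<close> is the image of the half-open interval between the
  parameters of \<open>v\<close> and \<open>u\<close>: it runs up to \<open>u\<close> without
  containing it.\<close>

lemma
  assumes "arc_between x y B"
  shows arc_between_compact: "compact B" and arc_between_connected: "connected B"
    and arc_between_connected_interior: "connected (B - {x, y})"
    and arc_between_subset_closure: "B \<subseteq> closure (B - {x, y})"
    and arc_between_subarc: "\<And>u v. u \<in> B - {x, y} \<Longrightarrow> v \<in> B - {x, y} \<Longrightarrow> u \<noteq> v \<Longrightarrow>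
      \<exists>T\<subseteq>B - {x, y, u}. connected T \<and> v \<in> T \<and> u \<in> closure T"
proof -
  obtain \<gamma> and a b :: real where ab: "a < b" and c: "continuous_on {a..b} \<gamma>" and i: "inj_on \<gamma> {a..b}"
    and B: "B = \<gamma> ` {a..b}" and xy: "{x, y} = {\<gamma> a, \<gamma> b}" using assms unfolding arc_between_def by blast
  have int: "B - {x, y} = \<gamma> ` {a<..<b}"
  proof -
    have "{a<..<b} = {a..b} - {a, b}" by auto
    moreover have "\<gamma> ` ({a..b} - {a, b}) = \<gamma> ` {a..b} - \<gamma> ` {a, b}"
      by (rule inj_on_image_set_diff[OF i]) (use ab in auto)
    ultimately show ?thesis using B xy by simp
  qed
  have cl: "\<gamma> ` closure S \<subseteq> closure (\<gamma> ` S)" if "closure S \<subseteq> {a..b}" for S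
    by (rule image_closure_subset[OF continuous_on_subset[OF c that]]) (auto simp: closure_subset)
  show "compact B" unfolding B by (rule compact_continuous_image[OF c]) simp
  show "connected B" unfolding B by (rule connected_continuous_image[OF c]) simp
  show "connected (B - {x, y})" unfolding int
    by (rule connected_continuous_image[OF continuous_on_subset[OF c]]) auto
  show "B \<subseteq> closure (B - {x, y})" unfolding int using cl[of "{a<..<b}"] ab B by simp
  fix u v assume uv: "u \<in> B - {x, y}" "v \<in> B - {x, y}" "u \<noteq> v"
  obtain s t where st: "s \<in> {a<..<b}" "t \<in> {a<..<b}" "u = \<gamma> s" "v = \<gamma> t" using uv(1,2) unfolding int by blast
  have notin: "u \<notin> \<gamma> ` R" if "R \<subseteq> {a<..<b}" "s \<notin> R" for R
  proof
    assume "u \<in> \<gamma> ` R"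
    then obtain r where r: "r \<in> R" "\<gamma> s = \<gamma> r" using st(3) by auto
    have "s \<in> {a..b}" "r \<in> {a..b}" using r(1) that(1) st(1) by auto
    with r have "s = r" using inj_onD[OF i] by blast
    then show False using r that by blast
  qed
  have main: "\<exists>T\<subseteq>B - {x, y, u}. connected T \<and> v \<in> T \<and> u \<in> closure T"
    if R: "R \<subseteq> {a<..<b}" "s \<notin> R" "t \<in> R" "s \<in> closure R" "connected R" "closure R \<subseteq> {a..b}" for R
  proof (intro exI[of _ "\<gamma> ` R"] conjI)
    have "\<gamma> ` R \<subseteq> B - {x, y}" unfolding int using R by blast
    then show "\<gamma> ` R \<subseteq> B - {x, y, u}" using notin[of R] R by blast
    have "R \<subseteq> {a..b}" using R(1) by auto
    then show "connected (\<gamma> ` R)" by (intro connected_continuous_image[OF continuous_on_subset[OF c]] R)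
    show "v \<in> \<gamma> ` R" using R st by blast
    show "u \<in> closure (\<gamma> ` R)" using cl[OF R(6)] R(4) st by blast
  qed
  show "\<exists>T\<subseteq>B - {x, y, u}. connected T \<and> v \<in> T \<and> u \<in> closure T"
  proof (cases "s < t")
    case True
    show ?thesis by (rule main[of "{s<..t}"]) (use True st in auto)
  next
    case False
    then have "t < s" using st uv by force
    then show ?thesis by (intro main[of "{t..<s}"]) (use st in auto)
  qed
qed

definition is_circle :: "complex set \<Rightarrow> bool" where
  "is_circle \<Gamma> \<longleftrightarrow> \<Gamma> homeomorphic sphere (0::complex) 1"

text \<open>Parametrise with period 1 starting from \<open>x\<close>, so that equal values mean
  parameters differing by an integer, and cut the period at a parameter of \<open>y\<close>.\<close>

lemma circle_arcs:
  assumes "is_circle \<Gamma>" and xy: "x \<in> \<Gamma>" "y \<in> \<Gamma>" "x \<noteq> y"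
  obtains B1 B2 where "arc_between x y B1" "arc_between x y B2" "B1 \<union> B2 = \<Gamma>" "B1 \<inter> B2 = {x, y}"
proof -
  obtain k h where hk: "homeomorphism \<Gamma> (sphere (0::complex) 1) k h"
    using assms(1) unfolding is_circle_def homeomorphic_def by blast
  have h: "continuous_on (sphere 0 1) h" "h ` sphere 0 1 = \<Gamma>" and inj: "inj_on h (sphere 0 1)"
    using hk unfolding homeomorphism_def by (auto intro: inj_on_inverseI)
  define e where "e = k x"
  have e: "norm e = 1" "h e = x" using hk xy(1) unfolding homeomorphism_def e_def by auto
  define w where "w = (\<lambda>t::real. e * exp (\<i> * of_real (2 * pi * t)))"
  have wS: "w t \<in> sphere 0 1" for t using e by (simp add: w_def norm_mult)
  have wc: "continuous_on T w" for T unfolding w_def by (intro continuous_intros)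
  have winj: "\<exists>n::int. s = t + of_int n" if "w s = w t" for s t
  proof -
    have "e \<noteq> 0" using e by auto
    then have "exp (\<i> * of_real (2 * pi * s)) = exp (\<i> * of_real (2 * pi * t))" using that by (simp add: w_def)
    then obtain n :: int where "\<i> * of_real (2 * pi * s) = \<i> * of_real (2 * pi * t) + of_int (2 * n) * of_real pi * \<i>"
      by (auto simp: exp_eq)
    then have "Im (\<i> * of_real (2 * pi * s)) = Im (\<i> * of_real (2 * pi * t) + of_int (2 * n) * of_real pi * \<i>)" by simp
    then have "2 * pi * s = 2 * pi * (t + of_int n)" by (simp add: algebra_simps)
    then show ?thesis by auto
  qed
  have wsurj: "\<exists>t\<in>{0..<1}. w t = q" if "q \<in> sphere 0 1" for q
  proof -
    have e0: "e \<noteq> 0" using e by auto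
    have nq: "norm (q / e) = 1" using that e by (simp add: norm_divide)
    have "exp (\<i> * of_real (Arg2pi (q / e))) = q / e"
      using Arg2pi_eq[of "q / e"] nq by simp
    then have "w (Arg2pi (q / e) / (2 * pi)) = q" using e0 by (simp add: w_def)
    moreover have "Arg2pi (q / e) / (2 * pi) \<in> {0..<1}" using Arg2pi_ge_0[of "q/e"] Arg2pi_lt_2pi[of "q/e"] by (simp add: divide_simps)
    ultimately show ?thesis by blast
  qed
  define \<gamma> where "\<gamma> = (\<lambda>t. h (w t))"
  have \<gamma>c: "continuous_on T \<gamma>" for T
    unfolding \<gamma>_def by (rule continuous_on_compose2[OF h(1) wc]) (use wS in auto)
  have \<gamma>inj: "\<exists>n::int. s = t + of_int n" if "\<gamma> s = \<gamma> t" for s t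
    using winj inj_onD[OF inj that[unfolded \<gamma>_def] wS wS] by blast
  have \<gamma>0: "\<gamma> 0 = x" "\<gamma> 1 = x"
    using e by (simp_all add: \<gamma>_def w_def) (metis exp_two_pi_i' mult.commute mult.right_neutral mult.left_commute)+
  have surj: "\<exists>t\<in>{0..<1}. \<gamma> t = q" if "q \<in> \<Gamma>" for q
    using wsurj h(2) that unfolding \<gamma>_def by (metis imageE)
  have im: "\<gamma> t \<in> \<Gamma>" for t using h(2) wS by (auto simp: \<gamma>_def)
  obtain s where s: "s \<in> {0..<1}" "\<gamma> s = y" using surj xy by blast
  have s0: "0 < s" "s < 1" using s xy(3) \<gamma>0 by (cases "s = 0"; auto)+
  have inj': "inj_on \<gamma> {a..b}" if "b - a < 1" for a b
  proof (rule inj_onI)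
    fix u v assume uv: "u \<in> {a..b}" "v \<in> {a..b}" "\<gamma> u = \<gamma> v"
    obtain n :: int where n: "u = v + of_int n" using \<gamma>inj uv by blast
    then have "\<bar>real_of_int n\<bar> < 1" using uv that by auto
    then have "n = 0" by linarith
    then show "u = v" using n by simp
  qed
  show thesis
  proof
    show "arc_between x y (\<gamma> ` {0..s})" unfolding arc_between_def
      by (intro exI[of _ \<gamma>] exI[of _ 0] exI[of _ s] conjI) (use s0 s \<gamma>0 \<gamma>c inj' in auto)
    show "arc_between x y (\<gamma> ` {s..1})" unfolding arc_between_def
      by (intro exI[of _ \<gamma>] exI[of _ s] exI[of _ 1] conjI) (use s0 s \<gamma>0 \<gamma>c inj' in auto)
    show "\<gamma> ` {0..s} \<union> \<gamma> ` {s..1} = \<Gamma>"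
    proof
      show "\<Gamma> \<subseteq> \<gamma> ` {0..s} \<union> \<gamma> ` {s..1}"
      proof
        fix q assume "q \<in> \<Gamma>"
        then obtain t where "t \<in> {0..<1}" "\<gamma> t = q" using surj by blast
        then show "q \<in> \<gamma> ` {0..s} \<union> \<gamma> ` {s..1}" by (cases "t \<le> s") auto
      qed
    qed (use im in auto)
    show "\<gamma> ` {0..s} \<inter> \<gamma> ` {s..1} = {x, y}"
    proof
      show "{x, y} \<subseteq> \<gamma> ` {0..s} \<inter> \<gamma> ` {s..1}"
        using \<gamma>0 s(2) s0 imageI[of 0 "{0..s}" \<gamma>] imageI[of 1 "{s..1}" \<gamma>]
          imageI[of s "{0..s}" \<gamma>] imageI[of s "{s..1}" \<gamma>] by simp
      show "\<gamma> ` {0..s} \<inter> \<gamma> ` {s..1} \<subseteq> {x, y}"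
      proof
        fix q assume "q \<in> \<gamma> ` {0..s} \<inter> \<gamma> ` {s..1}"
        then obtain u v where uv: "u \<in> {0..s}" "v \<in> {s..1}" "q = \<gamma> u" "q = \<gamma> v" by blast
        then obtain n :: int where n: "v = u + of_int n" using \<gamma>inj by metis
        have "0 \<le> real_of_int n" "real_of_int n \<le> 1" using uv n by auto
        then have "n = 0 \<or> n = 1" by linarith
        then show "q \<in> {x, y}"
        proof
          assume "n = 0" then have "u = s" using uv n by auto
          then show ?thesis using uv s by auto
        next
          assume "n = 1" then have "v = 1" using uv n by auto
          then show ?thesis using uv \<gamma>0 by auto
        qed
      qed
    qed
  qed
qed

text \<open>The arcs are closed and share only \<open>x\<close> and \<open>y\<close>, so a connected
  part of the curve that avoids these two points cannot meet both arcs.\<close>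

lemma connected_meets_endpoints:
  assumes B: "arc_between x y B1" "arc_between x y B2" "B1 \<union> B2 = \<Gamma>" "B1 \<inter> B2 = {x, y}"
    and p: "p \<in> B1 - {x, y}" and w: "w \<in> B2 - {x, y}"
    and S: "connected S" "S \<subseteq> \<Gamma>" "p \<in> S" "w \<in> S"
  shows "x \<in> S \<or> y \<in> S"
proof (rule ccontr)
  assume n: "\<not> ?thesis"
  have cl: "closed B1" "closed B2" using arc_between_compact B compact_imp_closed by blast+
  have "- B2 \<inter> S = {} \<or> - B1 \<inter> S = {}"
    by (rule connectedD[OF S(1)]) (use cl n B S(2) in auto)
  moreover have "p \<in> - B2 \<inter> S" "w \<in> - B1 \<inter> S" using p w S B by auto
  ultimately show False by blast
qed

text \<open>The pairs \<open>x\<close>, \<open>y\<close> and \<open>p\<close>, \<open>w\<close>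
  interlace: each of the two arcs between \<open>p\<close> and \<open>w\<close> must contain
  \<open>x\<close> or \<open>y\<close>, so these lie on different arcs, and
  \<open>connected_meets_endpoints\<close> applies with the pairs exchanged.\<close>

lemma connected_crosses_arcs:
  assumes \<Gamma>: "is_circle \<Gamma>" and B: "arc_between x y B1" "arc_between x y B2" "B1 \<union> B2 = \<Gamma>" "B1 \<inter> B2 = {x, y}"
    and p: "p \<in> B1 - {x, y}" and w: "w \<in> B2 - {x, y}"
    and S: "connected S" "S \<subseteq> \<Gamma>" "x \<in> S" "y \<in> S"
  shows "p \<in> S \<or> w \<in> S"
proof -
  have pw: "p \<in> \<Gamma>" "w \<in> \<Gamma>" "p \<noteq> w" using p w B by auto
  from \<Gamma> pw obtain E1 E2 where E: "arc_between p w E1" "arc_between p w E2" "E1 \<union> E2 = \<Gamma>" "E1 \<inter> E2 = {p, w}"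
    by (rule circle_arcs)
  have 1: "x \<in> E1 \<or> y \<in> E1" "x \<in> E2 \<or> y \<in> E2"
    by (rule connected_meets_endpoints[OF B p w arc_between_connected]; use E arc_between_endpoints_in in blast)+
  have xy: "x \<notin> {p, w}" "y \<notin> {p, w}" using p w by auto
  consider "x \<in> E1 - {p, w}" "y \<in> E2 - {p, w}" | "y \<in> E1 - {p, w}" "x \<in> E2 - {p, w}"
    using 1 xy E(4) by blast
  then show ?thesis
    by cases (use connected_meets_endpoints[OF E] S in blast)+
qed

text \<open>Suppose that both arcs between \<open>x\<close> and \<open>y\<close> leave the disc of
  radius \<open>D * \<delta>\<close> around \<open>x\<close>, at \<open>p\<close> and
  \<open>w\<close>, and use \<open>Q\<close> twice. A set joining \<open>x\<close> to
  \<open>y\<close> passes \<open>p\<close> or \<open>w\<close>, which forces \<open>x\<close> to lie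
  within a multiple of \<open>\<delta>\<close> of 0 (trivial if \<open>x\<close> or \<open>y\<close>
  is 0). A set joining the distant points \<open>p\<close> and \<open>w\<close> then passes
  \<open>x\<close> or \<open>y\<close>, where reciprocals are too large for the bound.\<close>

lemma bounded_turning_of_inverse:
  fixes \<Gamma> :: "complex set"
  assumes \<Gamma>: "is_circle \<Gamma>" and C: "1 \<le> C"
    and Q: "\<And>x y. x \<in> \<Gamma> - {0} \<Longrightarrow> y \<in> \<Gamma> - {0} \<Longrightarrow> x \<noteq> y \<Longrightarrow> \<exists>B\<subseteq>\<Gamma> - {0}. connected B \<and> x \<in> B \<and> y \<in> B \<and>
      (\<forall>q\<in>B. \<forall>r\<in>B. norm (1/q - 1/r) \<le> C * norm (1/x - 1/y))"
  shows "bounded_turning (16 * C * (2 * C + 3)) \<Gamma>"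
proof -
  \<comment> \<open>The second use of \<open>Q\<close> yields \<open>a * b \<le> 4 * C * (2 * C + 3)
    * (a * \<delta> + b * \<delta>)\<close>, while \<open>a\<close> and \<open>b\<close> exceed
    \<open>D * \<delta>\<close>; the factor 16 turns this into
    \<open>4 * (a * b) < 2 * (a * b)\<close>.\<close>
  define D where "D = 16 * C * (2 * C + 3)"
  have "16 * 1 * (2 * 1 + 3) \<le> 16 * C * (2 * C + 3)" using C by (intro mult_mono) auto
  then have D1: "1 \<le> D" by (simp add: D_def)
  have conv: "norm (q - r) * (norm x * norm y) \<le> C * norm (x - y) * (norm q * norm r)"
    if "norm (1/q - 1/r) \<le> C * norm (1/x - 1/y)" "q \<noteq> 0" "r \<noteq> 0" "x \<noteq> 0" "y \<noteq> 0" for q r x y :: complex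
  proof -
    have "norm (1/a - 1/b) = norm (a - b) / (norm a * norm b)" if "a \<noteq> 0" "b \<noteq> 0" for a b :: complex
    proof -
      have "1/a - 1/b = (b - a) / (a * b)" using that by (simp add: field_simps)
      then show ?thesis by (simp add: norm_divide norm_mult norm_minus_commute)
    qed
    then have "norm (q - r) / (norm q * norm r) \<le> C * norm (x - y) / (norm x * norm y)" using that by simp
    then show ?thesis using that by (simp add: field_simps)
  qed
  have arc: "\<exists>K\<subseteq>\<Gamma>. connected K \<and> x \<in> K \<and> y \<in> K \<and> (\<forall>p\<in>K. dist p x \<le> D * dist x y)"
    if x: "x \<in> \<Gamma>" and y: "y \<in> \<Gamma>" and xy: "x \<noteq> y" for x y
  proof (rule ccontr)
    assume n: "\<not> ?thesis"
    from \<Gamma> x y xy obtain B1 B2 where B: "arc_between x y B1" "arc_between x y B2" "B1 \<union> B2 = \<Gamma>" "B1 \<inter> B2 = {x, y}"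
      by (rule circle_arcs)
    have far: "\<exists>p\<in>B. D * dist x y < dist p x" if "arc_between x y B" "B \<subseteq> \<Gamma>" for B
      using n that arc_between_connected[OF that(1)] arc_between_endpoints_in[OF that(1)] not_le by metis
    obtain p where p: "p \<in> B1" "D * dist x y < dist p x" using far[OF B(1)] B(3) by blast
    obtain w where w: "w \<in> B2" "D * dist x y < dist w x" using far[OF B(2)] B(3) by blast
    define \<delta> where "\<delta> = norm (x - y)"
    define a where "a = norm (p - x)"
    define b where "b = norm (w - x)"
    have \<delta>: "0 < \<delta>" using xy by (simp add: \<delta>_def)
    have a: "D * \<delta> < a" and b: "D * \<delta> < b" using p w by (auto simp: \<delta>_def a_def b_def dist_norm)
    have "1 * \<delta> \<le> D * \<delta>" using D1 \<delta> by (intro mult_right_mono) auto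
    then have a\<delta>: "\<delta> < a" "\<delta> < b" using a b by auto
    have pw: "p \<in> B1 - {x, y}" "w \<in> B2 - {x, y}"
      using p w a\<delta> \<delta> by (auto simp: a_def b_def \<delta>_def norm_minus_commute)
    have "C * 1 \<le> C * C" using C by (intro mult_left_mono) auto
    then have D2: "4 * (C + 1) \<le> D" "2 * C \<le> D" "8 * C * (C + 1) \<le> D"
      using C unfolding D_def ring_distribs mult.assoc by linarith+
    have x0: "norm x \<le> 2 * (C + 1) * \<delta>"
    proof (cases "x = 0 \<or> y = 0")
      case True
      then have "norm x \<le> 1 * \<delta>" by (auto simp: \<delta>_def)
      also have "\<dots> \<le> 2 * (C + 1) * \<delta>" using C \<delta> by (intro mult_right_mono) auto
      finally show ?thesis .
    next
      case False
      then have xy0: "x \<in> \<Gamma> - {0}" "y \<in> \<Gamma> - {0}" using x y by auto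
      obtain B where BB: "B \<subseteq> \<Gamma> - {0}" "connected B" "x \<in> B" "y \<in> B"
        "\<forall>q\<in>B. \<forall>r\<in>B. norm (1/q - 1/r) \<le> C * norm (1/x - 1/y)" using Q[OF xy0 xy] by blast
      have "p \<in> B \<or> w \<in> B" by (rule connected_crosses_arcs[OF \<Gamma> B pw]) (use BB in auto)
      then obtain q where q: "q \<in> B" "q = p \<or> q = w" by blast
      define t where "t = norm (q - x)"
      have t: "D * \<delta> < t" using q a b by (auto simp: t_def a_def b_def)
      have "t = a \<or> t = b" using q by (auto simp: t_def a_def b_def)
      then have t0: "0 < t" using a\<delta> \<delta> by linarith
      have "q \<noteq> 0" using q BB by auto
      have "norm (1/q - 1/x) \<le> C * norm (1/x - 1/y)" using BB q by blast
      from conv[OF this] have "t * (norm x * norm y) \<le> C * \<delta> * (norm q * norm x)"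
        using False \<open>q \<noteq> 0\<close> by (simp add: t_def \<delta>_def)
      then have "norm x * (t * norm y) \<le> norm x * (C * \<delta> * norm q)" by (simp add: algebra_simps)
      then have 1: "t * norm y \<le> C * \<delta> * norm q" using False by (simp add: mult_le_cancel_left_pos)
      have "norm q \<le> t + norm x" unfolding t_def using norm_triangle_ineq[of "q - x" x] by simp
      then have "C * \<delta> * norm q \<le> C * \<delta> * (t + norm x)" using C \<delta> by (intro mult_left_mono) auto
      moreover have "t * (norm x - \<delta>) \<le> t * norm y"
        using t0 norm_triangle_ineq2[of x y] by (intro mult_left_mono) (auto simp: \<delta>_def)
      ultimately have 2: "t * norm x \<le> t * ((C + 1) * \<delta>) + C * \<delta> * norm x" using 1 by (simp add: algebra_simps)
      have "2 * C * \<delta> \<le> D * \<delta>" using D2 \<delta> by (intro mult_right_mono) auto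
      then have "C * \<delta> \<le> t / 2" using t by simp
      then have "C * \<delta> * norm x \<le> t / 2 * norm x" by (intro mult_right_mono) auto
      then have "t * norm x \<le> t * (2 * (C + 1) * \<delta>)" using 2 by (simp add: algebra_simps)
      then show ?thesis using t0 by simp
    qed
    have y0: "norm y \<le> (2 * C + 3) * \<delta>"
      using x0 norm_triangle_ineq2[of y x] by (simp add: \<delta>_def norm_minus_commute algebra_simps)
    have small: "2 * (C + 1) * \<delta> \<le> b / 2" "2 * (C + 1) * \<delta> \<le> a / 2"
      using mult_right_mono[OF D2(1), of \<delta>] \<delta> a b by (simp_all add: algebra_simps)
    have np: "a / 2 \<le> norm p" "b / 2 \<le> norm w"
      using norm_triangle_ineq4[of p x] norm_triangle_ineq4[of w x] small x0 by (auto simp: a_def b_def)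
    have ab0: "0 < a" "0 < b" using a\<delta> \<delta> by auto
    have pw0: "p \<in> \<Gamma> - {0}" "w \<in> \<Gamma> - {0}" "p \<noteq> w"
    proof -
      have "0 < norm p" "0 < norm w" using np ab0 by linarith+
      then show "p \<in> \<Gamma> - {0}" "w \<in> \<Gamma> - {0}" using pw B(3) by auto
      show "p \<noteq> w" using pw B(4) by blast
    qed
    obtain B where BB: "B \<subseteq> \<Gamma> - {0}" "connected B" "p \<in> B" "w \<in> B"
        "\<forall>q\<in>B. \<forall>r\<in>B. norm (1/q - 1/r) \<le> C * norm (1/p - 1/w)" using Q[OF pw0] by blast
    have "x \<in> B \<or> y \<in> B" by (rule connected_meets_endpoints[OF B pw]) (use BB in auto)
    then obtain q where q: "q \<in> B" "q = x \<or> q = y" by blast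
    have q0: "q \<noteq> 0" using q BB by auto
    have qn: "norm q \<le> (2 * C + 3) * \<delta>" 
    proof -
      have "2 * (C + 1) * \<delta> \<le> (2 * C + 3) * \<delta>" using \<delta> by (intro mult_right_mono) auto
      then show ?thesis using q x0 y0 by auto
    qed
    have pq: "a / 2 \<le> norm (p - q)"
    proof -
      have "norm (x - q) \<le> \<delta>" using q \<delta> by (auto simp: \<delta>_def)
      moreover have "2 * \<delta> \<le> 2 * (C + 1) * \<delta>" using C \<delta> by (intro mult_right_mono) auto
      moreover have "a \<le> norm (p - q) + norm (x - q)"
        unfolding a_def using norm_triangle_ineq[of "p - q" "q - x"] by (simp add: norm_minus_commute)
      ultimately show ?thesis using small ab0 by linarith
    qed
    have "norm (1/p - 1/q) \<le> C * norm (1/p - 1/w)" using BB q by blast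
    from conv[OF this] have "norm (p - q) * (norm p * norm w) \<le> C * norm (p - w) * (norm p * norm q)"
      using pw0 q0 by simp
    then have "norm p * (norm (p - q) * norm w) \<le> norm p * (C * norm (p - w) * norm q)" by (simp add: algebra_simps)
    then have "norm (p - q) * norm w \<le> C * norm (p - w) * norm q" using pw0 by (simp add: mult_le_cancel_left_pos)
    moreover have "(a / 2) * (b / 2) \<le> norm (p - q) * norm w" using pq np ab0 by (intro mult_mono) auto
    moreover have "norm (p - w) \<le> a + b" unfolding a_def b_def
      using norm_triangle_ineq4[of "p - x" "w - x"] by simp
    then have "C * norm (p - w) * norm q \<le> C * (a + b) * ((2 * C + 3) * \<delta>)"
      using C qn ab0 by (intro mult_mono mult_nonneg_nonneg) auto
    ultimately have 3: "a * b \<le> 4 * C * (2 * C + 3) * (a * \<delta> + b * \<delta>)" by (simp add: algebra_simps)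
    have "D * (a * \<delta> + b * \<delta>) = a * (D * \<delta>) + b * (D * \<delta>)" by (simp add: algebra_simps)
    also have "\<dots> < a * b + b * a" using a b ab0 by (intro add_strict_mono mult_strict_left_mono) auto
    finally have "4 * (4 * C * (2 * C + 3) * (a * \<delta> + b * \<delta>)) < 2 * (a * b)" by (simp add: D_def algebra_simps)
    then have "4 * (a * b) < 2 * (a * b)" using 3 by linarith
    then show False using ab0 by (simp add: mult_pos_pos)
  qed
  show ?thesis unfolding bounded_turning_def D_def[symmetric]
  proof (intro ballI)
    fix x y assume xy: "x \<in> \<Gamma>" "y \<in> \<Gamma>"
    show "\<exists>K\<subseteq>\<Gamma>. connected K \<and> x \<in> K \<and> y \<in> K \<and> (\<forall>p\<in>K. dist p x \<le> D * dist x y)"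
    proof (cases "x = y")
      case True
      then show ?thesis using xy by (intro exI[of _ "{x}"]) auto
    qed (use arc xy in blast)
  qed
qed

section \<open>Inversion of the Riemann sphere\<close>

text \<open>Division by zero gives the value 0 at \<open>Some c\<close> as well as at infinity; the
  map is only used on sets that miss \<open>Some c\<close>.\<close>

definition sphere_inversion :: "complex \<Rightarrow> complex option \<Rightarrow> complex" where
  "sphere_inversion c p = (case p of None \<Rightarrow> 0 | Some q \<Rightarrow> 1 / (q - c))"

text \<open>The point 0 is the image of infinity, which lies in the spherical closure of a closed
  \<open>J\<close> exactly when \<open>J\<close> is unbounded.\<close>

definition inverted_curve :: "complex \<Rightarrow> complex set \<Rightarrow> complex set" where
  "inverted_curve c J = (\<lambda>p. 1 / (p - c)) ` J \<union> (if bounded J then {} else {0})"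

lemma riemann_sphere_closure:
  assumes "closed J"
  shows "riemann_sphere closure_of (Some ` J) = Some ` J \<union> (if bounded J then {} else {None})"
proof (cases "bounded J")
  case True
  then have "closedin riemann_sphere (Some ` J)"
    using assms by (simp add: riemann_sphere_def compact_eq_bounded_closed)
  then show ?thesis using True by (simp add: closure_of_closedin)
next
  case False
  have top: "topspace riemann_sphere = UNIV"
    by (simp add: riemann_sphere_def UNIV_option_conv)
  have "openin riemann_sphere (Some ` (- J))"
    using assms by (simp add: riemann_sphere_def open_Compl)
  moreover have "topspace riemann_sphere - insert None (Some ` J) = Some ` (- J)"
    unfolding top UNIV_option_conv by auto
  ultimately have cl: "closedin riemann_sphere (insert None (Some ` J))"
    unfolding closedin_def by (simp add: top)
  have "None \<in> riemann_sphere closure_of (Some ` J)"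
    unfolding in_closure_of
  proof (intro conjI allI impI)
    fix T assume T: "None \<in> T \<and> openin riemann_sphere T"
    then obtain C where C: "compact C" "T = insert None (Some ` (UNIV - C))"
      unfolding riemann_sphere_def openin_Alexandroff_compactification by auto
    have "\<not> J \<subseteq> C" using False C(1) compact_imp_bounded bounded_subset by blast
    then show "\<exists>y. y \<in> Some ` J \<and> y \<in> T" using C(2) by blast
  qed (simp add: top)
  moreover have "Some ` J \<subseteq> riemann_sphere closure_of (Some ` J)"
    by (rule closure_of_subset) (simp add: top)
  moreover have "riemann_sphere closure_of (Some ` J) \<subseteq> insert None (Some ` J)"
    by (rule closure_of_minimal[OF _ cl]) auto
  ultimately show ?thesis using False by auto
qed

text \<open>Infinity is the delicate point: if \<open>W\<close> contains the disc of radius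
  \<open>e\<close> around 0, every \<open>q\<close> farther than \<open>1 / e\<close> from
  \<open>c\<close> is sent into \<open>W\<close>, so the complement of the finite part of the
  preimage is compact.\<close>

lemma continuous_map_sphere_inversion:
  assumes "Some c \<notin> S"
  shows "continuous_map (subtopology riemann_sphere S) euclidean (sphere_inversion c)"
proof -
  have "openin (subtopology riemann_sphere S) {p \<in> topspace (subtopology riemann_sphere S). sphere_inversion c p \<in> W}"
    if W: "open W" for W
  proof -
    define E where "E = {q. q \<noteq> c \<and> 1 / (q - c) \<in> W}"
    have "E = (- {c}) \<inter> (\<lambda>q. 1 / (q - c)) -` W" by (auto simp: E_def)
    then have E: "open E"
      by (simp only:, intro continuous_open_preimage W) (auto intro!: continuous_intros)
    define T where "T = (if 0 \<in> W then insert None (Some ` E) else Some ` E)"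
    have "openin riemann_sphere T"
    proof (cases "0 \<in> W")
      case True
      then obtain e where e: "0 < e" "ball 0 e \<subseteq> W" using W by (meson openE)
      have "- E \<subseteq> cball c (1 / e)"
      proof
        fix q assume q: "q \<in> - E"
        show "q \<in> cball c (1 / e)"
        proof (cases "q = c")
          case False
          then have "1 / (q - c) \<notin> ball 0 e" using q e by (auto simp: E_def)
          then have "e \<le> 1 / norm (q - c)" by (simp add: norm_divide)
          then show ?thesis using e False by (simp add: dist_norm norm_minus_commute field_simps)
        qed (use e in auto)
      qed
      then have "bounded (- E)" by (rule bounded_subset[OF bounded_cball])
      then have "compact (- E)" using E by (simp add: compact_eq_bounded_closed closed_Compl)
      moreover have "T = insert None (Some ` (UNIV - (- E)))" using True by (simp add: T_def Compl_eq_Diff_UNIV double_diff)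
      ultimately show ?thesis unfolding riemann_sphere_def openin_Alexandroff_compactification
        by (metis compactin_euclidean_iff closedin_compact_eq closed_closedin compact_imp_closed topspace_euclidean)
    qed (use E in \<open>simp add: T_def riemann_sphere_def\<close>)
    moreover have "{p \<in> topspace (subtopology riemann_sphere S). sphere_inversion c p \<in> W} = T \<inter> S"
    proof -
      have "topspace riemann_sphere = UNIV" by (simp add: riemann_sphere_def UNIV_option_conv)
      moreover have "sphere_inversion c p \<in> W \<longleftrightarrow> p \<in> T" if "p \<in> S" for p
        using that assms by (cases p) (auto simp: T_def E_def sphere_inversion_def)
      ultimately show ?thesis by auto
    qed
    ultimately show ?thesis unfolding openin_subtopology by blast
  qed
  then show ?thesis by (simp add: continuous_map_def)
qed

lemma is_circle_inverted_curve:
  assumes J: "closed J" "jordan_curve_in riemann_sphere (riemann_sphere closure_of (Some ` J))"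
    and c: "c \<notin> J"
  shows "is_circle (inverted_curve c J)"
proof -
  define S where "S = riemann_sphere closure_of (Some ` J)"
  define X where "X = subtopology riemann_sphere S"
  have S: "S = Some ` J \<union> (if bounded J then {} else {None})"
    unfolding S_def by (rule riemann_sphere_closure[OF J(1)])
  have circ: "X homeomorphic_space top_of_set (sphere (0::complex) 1)"
    using J(2) unfolding jordan_curve_in_def X_def S_def by blast
  have "topspace riemann_sphere = UNIV" by (simp add: riemann_sphere_def UNIV_option_conv)
  then have topX: "topspace X = S" by (simp add: X_def)
  have im: "sphere_inversion c ` S = inverted_curve c J"
    unfolding S inverted_curve_def by (auto simp: sphere_inversion_def image_iff)
  have "homeomorphic_map X (top_of_set (inverted_curve c J)) (sphere_inversion c)"
  proof (rule continuous_imp_homeomorphic_map)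
    show "compact_space X"
      using homeomorphic_compact_space[OF circ] by (simp add: compact_space_subtopology)
    show "Hausdorff_space (top_of_set (inverted_curve c J))" by (simp add: Hausdorff_space_subtopology)
    have "continuous_map X euclidean (sphere_inversion c)"
      unfolding X_def by (rule continuous_map_sphere_inversion) (use c S in auto)
    then show "continuous_map X (top_of_set (inverted_curve c J)) (sphere_inversion c)"
      using im topX by (auto simp: continuous_map_in_subtopology)
    show "sphere_inversion c ` topspace X = topspace (top_of_set (inverted_curve c J))"
      using im topX by simp
    show "inj_on (sphere_inversion c) (topspace X)"
      unfolding topX S using c by (auto simp: inj_on_def sphere_inversion_def)
  qed
  then have "X homeomorphic_space top_of_set (inverted_curve c J)" by (rule homeomorphic_map_imp_homeomorphic_space)
  then have "top_of_set (inverted_curve c J) homeomorphic_space top_of_set (sphere (0::complex) 1)"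
    using circ homeomorphic_space_sym homeomorphic_space_trans by blast
  then obtain f g where fg: "homeomorphic_maps (top_of_set (inverted_curve c J)) (top_of_set (sphere (0::complex) 1)) f g"
    unfolding homeomorphic_space_def by blast
  have "homeomorphism (inverted_curve c J) (sphere 0 1) f g"
    using fg unfolding homeomorphic_maps_def
    by (intro homeomorphismI) (auto simp: continuous_map_subtopology_eu)
  then show ?thesis unfolding is_circle_def homeomorphic_def by blast
qed

text \<open>The small component \<open>K\<close> is replaced by an arc: choose a point of
  \<open>K\<close> and the arc \<open>B\<close> between \<open>x\<close> and \<open>y\<close>
  through its image \<open>q\<close>. If \<open>B\<close> passed through 0, the piece of it from
  \<open>q\<close> towards 0 would be carried by \<open>f\<close> into the bounded set
  \<open>K\<close>, although \<open>f\<close> tends to infinity at 0. Hence \<open>f\<close> maps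
  the open arc into \<open>K\<close>, and the closed arc into the closure of \<open>K\<close>, which
  has the same diameter.\<close>

lemma quasicircle_chord_condition:
  assumes J: "quasicircle J" and c: "c \<notin> J"
  obtains C where "1 \<le> C"
    "\<And>x y. x \<in> inverted_curve c J - {0} \<Longrightarrow> y \<in> inverted_curve c J - {0} \<Longrightarrow> x \<noteq> y \<Longrightarrow>
      \<exists>B\<subseteq>inverted_curve c J - {0}. connected B \<and> x \<in> B \<and> y \<in> B \<and>
      (\<forall>q\<in>B. \<forall>r\<in>B. norm (1/q - 1/r) \<le> C * norm (1/x - 1/y))"
proof -
  define \<Gamma> where "\<Gamma> = inverted_curve c J"
  define f where "f = (\<lambda>q. c + 1 / (q::complex))"
  obtain C0 where C0: "0 < C0" "\<forall>x\<in>J. \<forall>y\<in>J. x \<noteq> y \<longrightarrow>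
        (\<exists>K\<in>components (J - {x, y}). bounded K \<and> diameter K \<le> C0 * dist x y)"
    and clJ: "closed J" and jc: "jordan_curve_in riemann_sphere (riemann_sphere closure_of (Some ` J))"
    using J unfolding quasicircle_def by blast
  have circ: "is_circle \<Gamma>" unfolding \<Gamma>_def by (rule is_circle_inverted_curve[OF clJ jc c])
  have fJ: "f q \<in> J" if "q \<in> \<Gamma> - {0}" for q
    using that c unfolding \<Gamma>_def inverted_curve_def f_def by (auto split: if_splits)
  have finj: "f q = f r \<longleftrightarrow> q = r" for q r by (auto simp: f_def)
  have fcont: "continuous_on T f" if "0 \<notin> T" for T
    unfolding f_def using that by (intro continuous_intros) auto
  have fd: "norm (1/q - 1/r) = dist (f q) (f r)" for q r by (simp add: f_def dist_norm)
  have main: "\<exists>B\<subseteq>\<Gamma> - {0}. connected B \<and> x \<in> B \<and> y \<in> B \<and>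
      (\<forall>q\<in>B. \<forall>r\<in>B. norm (1/q - 1/r) \<le> (1 + C0) * norm (1/x - 1/y))"
    if x: "x \<in> \<Gamma> - {0}" and y: "y \<in> \<Gamma> - {0}" and xy: "x \<noteq> y" for x y
  proof -
    have "f x \<in> J" "f y \<in> J" "f x \<noteq> f y" using fJ x y xy finj by auto
    then obtain K where K: "K \<in> components (J - {f x, f y})" "bounded K" "diameter K \<le> C0 * dist (f x) (f y)"
      using C0(2) by blast
    have Kmax: "f ` T \<subseteq> K" if "connected T" "T \<subseteq> \<Gamma> - {0, x, y}" "q \<in> T" "f q \<in> K" for T q
    proof -
      have "connected (f ` T)" by (rule connected_continuous_image[OF fcont that(1)]) (use that in auto)
      moreover have "f ` T \<subseteq> J - {f x, f y}"
      proof (rule image_subsetI)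
        fix t assume "t \<in> T"
        then have "t \<in> \<Gamma> - {0}" "t \<noteq> x" "t \<noteq> y" using that(2) by auto
        then show "f t \<in> J - {f x, f y}" using fJ[of t] by (simp add: finj)
      qed
      moreover have "K \<inter> f ` T \<noteq> {}" using that(3,4) by blast
      ultimately show ?thesis by (intro components_maximal[OF K(1)])
    qed
    obtain b where b: "0 < b" "\<And>p. p \<in> K \<Longrightarrow> norm (p - c) \<le> b"
    proof -
      obtain b0 where b0: "0 < b0" "\<And>p. p \<in> K \<Longrightarrow> norm p \<le> b0" using K(2) by (meson bounded_pos)
      have "norm (p - c) \<le> b0 + norm c" if "p \<in> K" for p
        using norm_triangle_ineq4[of p c] b0(2)[OF that] by linarith
      then show thesis using that[of "b0 + norm c"] b0(1) by (smt (verit) norm_ge_zero)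
    qed
    have Kb: "1 / b \<le> norm q" if "f q \<in> K" "q \<noteq> 0" for q
      using b(2)[OF that(1)] that(2) b(1) by (simp add: f_def norm_divide field_simps)
    obtain B1 B2 where B: "arc_between x y B1" "arc_between x y B2" "B1 \<union> B2 = \<Gamma>" "B1 \<inter> B2 = {x, y}"
      using circle_arcs[OF circ, of x y] x y xy by blast
    obtain k where k: "k \<in> K" using in_components_nonempty[OF K(1)] by blast
    have kJ: "k \<in> J - {f x, f y}" using in_components_subset[OF K(1)] k by blast
    define q where "q = 1 / (k - c)"
    have "k \<noteq> c" using kJ c by auto
    then have q: "q \<in> \<Gamma>" "q \<noteq> 0" "f q = k"
      using kJ by (auto simp: q_def \<Gamma>_def inverted_curve_def f_def)
    have qxy: "q \<notin> {x, y}" using q kJ by auto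
    obtain B where BB: "arc_between x y B" "B \<subseteq> \<Gamma>" "q \<in> B" using q(1) B by blast
    have B0: "0 \<notin> B"
    proof
      assume "0 \<in> B"
      then have zin: "0 \<in> B - {x, y}" using x y by auto
      have q': "q \<in> B - {x, y}" using BB qxy by auto
      obtain T where T: "T \<subseteq> B - {x, y, 0}" "connected T" "q \<in> T" "0 \<in> closure T"
        using arc_between_subarc[OF BB(1) zin q'] q(2) by blast
      have "f ` T \<subseteq> K" by (rule Kmax[OF T(2) _ T(3)]) (use T BB q k in auto)
      then have "1 / b \<le> dist 0 t" if "t \<in> T" for t using that Kb[of t] T(1) by auto
      moreover obtain t where "t \<in> T" "dist t 0 < 1 / b" using T(4) b(1) unfolding closure_approachable
        by (metis zero_less_divide_1_iff)
      ultimately show False by (metis dist_commute not_le)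
    qed
    have "f ` (B - {x, y}) \<subseteq> K"
      by (rule Kmax[OF arc_between_connected_interior[OF BB(1)], of q]) (use BB B0 q k qxy in auto)
    moreover have "f ` closure (B - {x, y}) \<subseteq> closure (f ` (B - {x, y}))" 
    proof (rule image_closure_subset[of _ f])
      have "closure (B - {x, y}) \<subseteq> B"
        by (rule closure_minimal) (use arc_between_compact[OF BB(1)] compact_imp_closed in auto)
      then show "continuous_on (closure (B - {x, y})) f" using B0 by (intro fcont) auto
    qed (auto simp: closure_subset)
    ultimately have "f ` B \<subseteq> closure K"
      using arc_between_subset_closure[OF BB(1)] closure_mono by (meson image_mono order_trans)
    have "dist (f q) (f r) \<le> (1 + C0) * dist (f x) (f y)" if "q \<in> B" "r \<in> B" for q r
    proof -
      have "f q \<in> closure K" "f r \<in> closure K" using that \<open>f ` B \<subseteq> closure K\<close> by auto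
      then have "dist (f q) (f r) \<le> diameter (closure K)"
        by (intro diameter_bounded_bound) (use K(2) in auto)
      also have "\<dots> \<le> C0 * dist (f x) (f y)" using diameter_closure[OF K(2)] K(3) by simp
      also have "\<dots> \<le> (1 + C0) * dist (f x) (f y)" by (intro mult_right_mono) auto
      finally show ?thesis .
    qed
    then show ?thesis
      using BB B0 arc_between_connected[OF BB(1)] arc_between_endpoints_in[OF BB(1)]
      by (intro exI[of _ B]) (auto simp: fd)
  qed
  show thesis by (rule that[of "1 + C0"]) (use C0(1) main in \<open>auto simp: \<Gamma>_def\<close>)
qed

lemma inverted_quasicircle_bounded_turning:
  assumes J: "quasicircle J" and c: "c \<notin> J"
  obtains C where "1 \<le> C" "bounded_turning C (inverted_curve c J)"
    "compact (inverted_curve c J)" "inverted_curve c J \<noteq> {}"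
proof -
  have circ: "is_circle (inverted_curve c J)"
    using J c unfolding quasicircle_def by (blast intro: is_circle_inverted_curve)
  obtain C where C: "1 \<le> C"
    "\<And>x y. x \<in> inverted_curve c J - {0} \<Longrightarrow> y \<in> inverted_curve c J - {0} \<Longrightarrow> x \<noteq> y \<Longrightarrow>
      \<exists>B\<subseteq>inverted_curve c J - {0}. connected B \<and> x \<in> B \<and> y \<in> B \<and>
      (\<forall>q\<in>B. \<forall>r\<in>B. norm (1/q - 1/r) \<le> C * norm (1/x - 1/y))"
    using quasicircle_chord_condition[OF J c] by metis
  have "16 * 1 * (2 * 1 + 3) \<le> 16 * C * (2 * C + 3)" using C(1) by (intro mult_mono) auto
  then have 1: "1 \<le> 16 * C * (2 * C + 3)" by simp
  have "compact (sphere (0::complex) 1)" by simp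
  then have 2: "compact (inverted_curve c J)"
    using circ homeomorphic_compactness unfolding is_circle_def by blast
  have "sphere (0::complex) 1 \<noteq> {}" by simp
  then have 3: "inverted_curve c J \<noteq> {}"
    using circ unfolding is_circle_def by (metis homeomorphic_empty(2) homeomorphic_sym)
  show thesis by (rule that[OF 1 bounded_turning_of_inverse[OF circ C] 2 3])
qed

section \<open>Riemann maps of quasidiscs\<close>

text \<open>Integrate along the radius: \<open>K / (1 - r)\<close> has the primitive
  \<open>- K * ln (1 - r)\<close>. The function \<open>k\<close> expresses this as
  monotonicity.\<close>

lemma Re_growth_of_deriv_bound:
  assumes h: "h holomorphic_on ball 0 1" and K: "0 \<le> K"
    and d: "\<And>w. norm w < 1 \<Longrightarrow> norm (deriv h w) * (1 - norm w) \<le> K"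
    and w: "norm w < 1"
  shows "Re (h w) + K * ln (1 - norm w) \<le> Re (h 0)"
proof -
  define k where "k = (\<lambda>t::real. Re (h (of_real t * w)) + K * ln (1 - t * norm w))"
  have "k 0 \<ge> k 1"
  proof (rule DERIV_nonpos_imp_nonincreasing[where a = 0 and b = 1 and f = k])
    fix t :: real assume t: "0 \<le> t" "t \<le> 1"
    have "t * norm w \<le> norm w" using t by (simp add: mult_left_le_one_le)
    then have tw: "t * norm w < 1" using w by linarith
    then have in1: "norm (of_real t * w) < 1" using t by (simp add: norm_mult)
    then have "(h has_field_derivative deriv h (of_real t * w)) (at (of_real t * w))"
      by (intro holomorphic_derivI[OF h]) auto
    moreover have "((\<lambda>t::real. of_real t * w) has_vector_derivative w) (at t)"
      by (auto intro!: derivative_eq_intros simp: has_vector_derivative_def scaleR_conv_of_real)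
    ultimately have "((h \<circ> (\<lambda>t::real. of_real t * w)) has_vector_derivative w * deriv h (of_real t * w)) (at t)"
      by (rule field_vector_diff_chain_at[rotated])
    then have "((\<lambda>t. Re (h (of_real t * w))) has_vector_derivative Re (w * deriv h (of_real t * w))) (at t)"
      unfolding o_def by (rule bounded_linear.has_vector_derivative[OF bounded_linear_Re])
    then have 1: "((\<lambda>t. Re (h (of_real t * w))) has_real_derivative Re (w * deriv h (of_real t * w))) (at t)"
      by (simp add: has_real_derivative_iff_has_vector_derivative)
    have "((\<lambda>t. K * ln (1 - t * norm w)) has_real_derivative K * (- norm w / (1 - t * norm w))) (at t)"
      using tw by (auto intro!: derivative_eq_intros simp: divide_simps)
    with 1 have 2: "DERIV k t :> Re (w * deriv h (of_real t * w)) + K * (- norm w / (1 - t * norm w))"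
      unfolding k_def by (rule DERIV_add)
    have "Re (w * deriv h (of_real t * w)) \<le> norm w * norm (deriv h (of_real t * w))"
      using complex_Re_le_cmod[of "w * deriv h (of_real t * w)"] by (simp add: norm_mult)
    also have "norm (deriv h (of_real t * w)) \<le> K / (1 - t * norm w)"
      using d[OF in1] tw t by (simp add: norm_mult pos_le_divide_eq)
    then have "norm w * norm (deriv h (of_real t * w)) \<le> norm w * (K / (1 - t * norm w))"
      by (intro mult_left_mono) auto
    finally have "Re (w * deriv h (of_real t * w)) + K * (- norm w / (1 - t * norm w)) \<le> 0"
      by (simp add: mult.commute)
    with 2 show "\<exists>y. DERIV k t :> y \<and> y \<le> 0" by blast
  qed simp
  then show ?thesis by (simp add: k_def)
qed

text \<open>A logarithm of an injective function omits, with each of its values, all translates by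
  multiples of \<open>2 * pi * \<i>\<close>, so its image contains no disc of radius \<open>pi\<close>, and Bloch's theorem bounds
  its derivative.  This replaces the Koebe distortion theorem.\<close>

lemma injective_dist_omitted_value:
  assumes g: "g holomorphic_on ball 0 1" and inj: "inj_on g (ball 0 1)"
    and a: "a \<notin> g ` ball 0 1" and w: "norm w < 1"
  shows "norm (g 0 - a) * (1 - norm w) ^ 48 \<le> norm (g w - a)"
    and "norm (g w - a) * (1 - norm w) ^ 48 \<le> norm (g 0 - a)"
proof -
  obtain h where h: "h holomorphic_on ball 0 1" "\<And>x. x \<in> ball 0 1 \<Longrightarrow> exp (h x) = g x - a"
  proof (rule holomorphic_logarithm_exists[of "ball 0 1" "\<lambda>x. g x - a" 0])
    show "(\<lambda>x. g x - a) holomorphic_on ball 0 1" using g by (intro holomorphic_intros)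
  qed (use a in auto)
  \<comment> \<open>48 is 12 times 4: Bloch's theorem gives a disc of radius
    \<open>r * norm (deriv h v) / 12\<close> in the image of \<open>ball v r\<close>, and 4 exceeds
    \<open>pi\<close>.\<close>
  have d: "norm (deriv h v) * (1 - norm v) \<le> 48" if v: "norm v < 1" for v
  proof (rule ccontr)
    assume n: "\<not> ?thesis"
    have sub: "ball v (1 - norm v) \<subseteq> ball 0 1"
    proof
      fix q assume "q \<in> ball v (1 - norm v)"
      then show "q \<in> ball 0 1" using norm_triangle_ineq2[of q v] by (simp add: dist_norm norm_minus_commute)
    qed
    obtain b where b: "ball b 4 \<subseteq> h ` ball v (1 - norm v)"
      by (rule Bloch[OF holomorphic_on_subset[OF h(1) sub], of 4]) (use n v in \<open>auto simp: mult.commute\<close>)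
    \<comment> \<open>Values of \<open>h\<close> that differ by \<open>2 * pi * \<i>\<close> belong
      to the same value of \<open>g\<close>, contrary to injectivity.\<close>
    have "b + pi * \<i> \<in> ball b 4" "b - pi * \<i> \<in> ball b 4"
      using pi_less_4 by (auto simp: dist_norm norm_mult)
    then have "b + pi * \<i> \<in> h ` ball v (1 - norm v)" "b - pi * \<i> \<in> h ` ball v (1 - norm v)"
      using b by blast+
    then obtain p q where pq: "p \<in> ball v (1 - norm v)" "q \<in> ball v (1 - norm v)" "h p = b + pi * \<i>" "h q = b - pi * \<i>"
      unfolding image_iff by (elim bexE) metis
    have "exp (h p) = exp (h q)" unfolding exp_eq pq(3,4) by (intro exI[of _ 1]) simp
    moreover have mem: "p \<in> ball 0 1" "q \<in> ball 0 1" using pq sub by blast+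
    ultimately have "g p = g q" using h(2)[OF mem(1)] h(2)[OF mem(2)] by simp
    then have "p = q" using inj_onD[OF inj _ mem] by blast
    then have "b + pi * \<i> = b - pi * \<i>" using pq(3,4) by simp
    then have "Im (b + pi * \<i>) = Im (b - pi * \<i>)" by (rule arg_cong)
    then show False by simp
  qed
  \<comment> \<open>The growth estimate is one-sided; applied to \<open>- h\<close> it gives the
    lower bound for \<open>norm (g w - a)\<close>.\<close>
  have dm: "norm (deriv (\<lambda>x. - h x) v) * (1 - norm v) \<le> 48" if v: "norm v < 1" for v
  proof -
    have "h field_differentiable at v" using v by (intro holomorphic_on_imp_differentiable_at[OF h(1)]) auto
    then show ?thesis using d[OF v] by simp
  qed
  have n: "norm (g v - a) = exp (Re (h v))" if "norm v < 1" for v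
  proof -
    have "g v - a = exp (h v)" using h(2)[of v] that by simp
    then show ?thesis by (simp only: norm_exp_eq_Re)
  qed
  have pw: "(1 - norm w) ^ 48 = exp (48 * ln (1 - norm w))"
    using w exp_of_nat_mult[of 48 "ln (1 - norm w)"] by simp
  have "Re (h w) + 48 * ln (1 - norm w) \<le> Re (h 0)"
    by (rule Re_growth_of_deriv_bound[OF h(1) _ d w]) auto
  then show "norm (g w - a) * (1 - norm w) ^ 48 \<le> norm (g 0 - a)"
    using w by (simp add: n pw flip: exp_add)
  have "(\<lambda>x. - h x) holomorphic_on ball 0 1" using h(1) by (intro holomorphic_intros)
  then have "Re (- h w) + 48 * ln (1 - norm w) \<le> Re (- h 0)"
    by (rule Re_growth_of_deriv_bound[OF _ _ dm w]) auto
  then show "norm (g 0 - a) * (1 - norm w) ^ 48 \<le> norm (g w - a)"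
    using w by (simp add: n pw flip: exp_add)
qed

text \<open>Only meaningful for \<open>U \<noteq> UNIV\<close>, since \<^term>\<open>infdist z {}\<close> is \<open>0\<close>.\<close>

definition boundary_weight :: "complex set \<Rightarrow> complex \<Rightarrow> real" where
  "boundary_weight U z = min (infdist z (- U)) (1 / (1 + norm z))"

lemma boundary_weight_nonneg: "0 \<le> boundary_weight U z"
  by (simp add: boundary_weight_def infdist_nonneg)

lemma boundary_weight_le_1: "boundary_weight U z \<le> 1"
proof -
  have "1 / (1 + norm z) \<le> 1" by (simp add: add_pos_nonneg)
  then show ?thesis unfolding boundary_weight_def by (rule min.coboundedI2)
qed

lemma boundary_weight_pos:
  assumes "open U" "U \<noteq> UNIV" "z \<in> U"
  shows "0 < boundary_weight U z"
proof -
  have "- U \<noteq> {}" using assms(2) by auto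
  then have "infdist z (- U) \<noteq> 0" using assms in_closed_iff_infdist_zero[of "- U" z] by (simp add: closed_Compl)
  then have "0 < infdist z (- U)" using infdist_nonneg[of z "- U"] by linarith
  then show ?thesis by (simp add: boundary_weight_def add_pos_nonneg)
qed

lemma boundary_weight_le_dist: "x \<notin> U \<Longrightarrow> boundary_weight U z \<le> dist z x"
  unfolding boundary_weight_def by (meson ComplI infdist_le min.coboundedI1)

lemma boundary_weight_mult_norm_le: "boundary_weight U z * (1 + norm z) \<le> 1"
proof -
  have "boundary_weight U z * (1 + norm z) \<le> 1 / (1 + norm z) * (1 + norm z)"
    unfolding boundary_weight_def by (intro mult_right_mono) auto
  then show ?thesis by (simp add: add_nonneg_eq_0_iff)
qed

text \<open>An unbounded \<open>U\<close> would contain the outside of a disc that holds the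
  frontier, so its nonempty complement would be bounded; but the complement of a simply connected
  open set has only unbounded components.\<close>

lemma simply_connected_bounded_frontier:
  assumes "open U" "simply_connected U" "U \<noteq> UNIV" "bounded (frontier U)"
  shows "bounded (U :: complex set)"
proof (rule ccontr)
  assume nb: "\<not> bounded U"
  obtain b where "\<And>x. x \<in> frontier U \<Longrightarrow> norm x \<le> b" using assms(4) unfolding bounded_iff by blast
  then have b: "frontier U \<subseteq> cball 0 b" by auto
  have "- cball 0 b \<inter> U \<noteq> {}" using nb bounded_subset[OF bounded_cball, of U 0 b] by blast
  have con: "connected (- cball (0::complex) b)"
    by (rule connected_complement_bounded_convex) auto
  have "- cball 0 b \<subseteq> U"
  proof (rule ccontr)
    assume "\<not> ?thesis"
    then have "- cball 0 b \<inter> frontier U \<noteq> {}"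
      using \<open>- cball 0 b \<inter> U \<noteq> {}\<close> by (intro connected_Int_frontier[OF con]) auto
    then show False using b by blast
  qed
  then have bd: "bounded (- U)" by (intro bounded_subset[OF bounded_cball]) auto
  obtain x where "x \<in> - U" using assms(3) by auto
  then have "connected_component_set (- U) x \<in> components (- U)" by (rule componentsI)
  moreover have "bounded (connected_component_set (- U) x)"
    by (rule bounded_subset[OF bd connected_component_subset])
  ultimately show False
    using assms(1,2) simply_connected_eq_unbounded_complement_components by blast
qed

text \<open>The distance equals \<open>\<tau> / (\<rho> * norm (x - c))\<close>, and
  \<open>norm (x - c)\<close> is at most \<open>\<rho> + \<tau>\<close>. In the term
  \<open>\<rho> * \<rho>\<close> two powers of \<open>t\<close> turn both factors into
  \<open>A\<close> and a third is compared with \<open>\<tau>\<close>: hence the exponent 3.\<close>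

lemma inverted_dist_ge:
  fixes x p c :: complex
  assumes t: "0 < t" "t \<le> 1" and xp: "t \<le> dist p x" and \<rho>: "t * norm (p - c) \<le> A" and A: "1 \<le> A"
    and ne: "p \<noteq> c" "x \<noteq> c"
  shows "t ^ 3 / (2 * A\<^sup>2) \<le> dist (1 / (p - c)) (1 / (x - c))"
proof -
  define \<rho> \<tau> where "\<rho> = norm (p - c)" and "\<tau> = dist p x"
  have pos: "0 < \<rho>" "0 < \<tau>" "0 < norm (x - c)" using ne xp t by (auto simp: \<rho>_def \<tau>_def)
  have tr: "t * \<rho> \<le> A" using \<rho> by (simp add: \<rho>_def)
  have "1 / (p - c) - 1 / (x - c) = (x - p) / ((p - c) * (x - c))" using ne by (simp add: field_simps)
  then have eq: "dist (1 / (p - c)) (1 / (x - c)) = \<tau> / (\<rho> * norm (x - c))"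
    by (simp add: dist_norm norm_divide norm_mult \<rho>_def \<tau>_def norm_minus_commute)
  have "norm (x - c) \<le> \<rho> + \<tau>"
    unfolding \<rho>_def \<tau>_def dist_norm using norm_triangle_ineq[of "p - c" "x - p"] by (simp add: norm_minus_commute)
  then have "\<rho> * norm (x - c) \<le> \<rho> * (\<rho> + \<tau>)" using pos by (intro mult_left_mono) auto
  then have 1: "t ^ 3 * (\<rho> * norm (x - c)) \<le> t ^ 3 * (\<rho> * (\<rho> + \<tau>))"
    using t by (intro mult_left_mono[of "\<rho> * norm (x - c)"]) auto
  have AA: "A \<le> A\<^sup>2" using A by (simp add: power2_eq_square)
  have a: "t ^ 3 * (\<rho> * \<rho>) \<le> A\<^sup>2 * \<tau>"
  proof -
    have "(t * \<rho>) * (t * \<rho>) * t \<le> A * A * \<tau>" using tr t A pos xp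
      by (intro mult_mono) (auto simp: \<tau>_def)
    then show ?thesis by (simp add: power3_eq_cube power2_eq_square algebra_simps)
  qed
  have b: "t ^ 3 * (\<rho> * \<tau>) \<le> A\<^sup>2 * \<tau>"
  proof -
    have "t * t * (t * \<rho>) \<le> 1 * 1 * A" using tr t A pos by (intro mult_mono) auto
    also have "\<dots> \<le> A\<^sup>2" using AA by simp
    finally have "t * t * (t * \<rho>) * \<tau> \<le> A\<^sup>2 * \<tau>" using pos by (intro mult_right_mono) auto
    then show ?thesis by (simp add: power3_eq_cube algebra_simps)
  qed
  have "t ^ 3 * (\<rho> * norm (x - c)) \<le> 2 * A\<^sup>2 * \<tau>" using 1 a b by (simp add: distrib_left)
  then show ?thesis unfolding eq using pos A by (simp add: divide_le_eq le_divide_eq mult_ac)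
qed

text \<open>The inverted curve would be empty, yet it is a topological circle. This excludes
  \<open>{}\<close> and \<open>UNIV\<close> as quasidiscs.\<close>

lemma quasidisc_frontier_nonempty:
  assumes "quasidisc U"
  shows "frontier U \<noteq> {}"
proof
  assume e: "frontier U = {}"
  then have "quasicircle {}" using assms by (simp add: quasidisc_def)
  then show False
    by (rule inverted_quasicircle_bounded_turning[where c = 0]) (auto simp: inverted_curve_def)
qed

text \<open>Carries \<open>one_minus_norm_ge_power_dist\<close> back through the inversion at
  \<open>c\<close>: \<open>W\<close> is the image of \<open>U - {c}\<close> and contains a
  neighbourhood of infinity, since \<open>U\<close> contains a disc around \<open>c\<close>. For
  \<open>p\<close> away from \<open>c\<close> the image has distance at least
  \<open>k * t ^ 3\<close> from the inverted curve; near \<open>c\<close> compactness gives the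
  bound.\<close>

lemma quasidisc_riemann_map_lower:
  assumes U: "quasidisc U" and f: "f holomorphic_on U" "f ` U \<subseteq> ball 0 1" and c: "c \<in> U"
  obtains M K where "0 < K" "\<And>z. z \<in> U \<Longrightarrow> boundary_weight U z ^ M \<le> K * (1 - norm (f z))"
proof -
  have U1: "open U" "simply_connected U" "quasicircle (frontier U)" using U by (auto simp: quasidisc_def)
  have Une: "U \<noteq> UNIV" using quasidisc_frontier_nonempty[OF U] by auto
  define J where "J = frontier U"
  define \<Gamma> where "\<Gamma> = inverted_curve c J"
  have JU: "J \<inter> U = {}" unfolding J_def using U1(1) by (auto simp: frontier_def interior_open)
  then have cJ: "c \<notin> J" using c by auto
  obtain C where C: "1 \<le> C" "bounded_turning C \<Gamma>" "compact \<Gamma>" "\<Gamma> \<noteq> {}"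
    using inverted_quasicircle_bounded_turning[OF U1(3)[folded J_def] cJ] unfolding \<Gamma>_def by blast
  obtain d0 where d0: "0 < d0" "ball c d0 \<subseteq> U" using U1(1) c by (meson openE)
  have cb: "cball c (d0 / 2) \<subseteq> U" using d0 by (force simp: subset_iff)
  define R where "R = 2 / d0"
  have R: "0 < R" using d0 by (simp add: R_def)
  define W where "W = {q. q \<noteq> 0 \<and> c + 1 / q \<in> U}"
  have W_im: "W = (\<lambda>p. 1 / (p - c)) ` (U - {c})"
  proof
    show "W \<subseteq> (\<lambda>p. 1 / (p - c)) ` (U - {c})"
    proof
      fix q assume "q \<in> W"
      then show "q \<in> (\<lambda>p. 1 / (p - c)) ` (U - {c})"
        by (intro image_eqI[of _ _ "c + 1 / q"]) (auto simp: W_def)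
    qed
    show "(\<lambda>p. 1 / (p - c)) ` (U - {c}) \<subseteq> W" by (auto simp: W_def)
  qed
  have W_con: "connected W"
  proof -
    have "connected (U - {c})"
      by (rule connected_open_delete) (use U1 simply_connected_imp_connected in auto)
    then show ?thesis unfolding W_im
      by (intro connected_continuous_image) (auto intro!: continuous_intros)
  qed
  have W_op: "open W"
  proof -
    have "W = (- {0}) \<inter> (\<lambda>q. c + 1 / q) -` U" by (auto simp: W_def)
    then show ?thesis by (simp only:, intro continuous_open_preimage U1) (auto intro!: continuous_intros)
  qed
  have W_fr: "frontier W \<subseteq> \<Gamma>"
  proof
    fix q assume "q \<in> frontier W"
    then have q: "q \<in> closure W" "q \<notin> W" using W_op by (auto simp: frontier_def interior_open)
    obtain X where X: "\<And>n. X n \<in> W" "X \<longlonglongrightarrow> q" using q(1) unfolding closure_sequential by blast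
    show "q \<in> \<Gamma>"
    proof (cases "q = 0")
      case False
      have "(\<lambda>n. c + 1 / X n) \<longlonglongrightarrow> c + 1 / q" by (intro tendsto_intros X False)
      moreover have "c + 1 / X n \<in> U" for n using X(1)[of n] by (simp add: W_def)
      ultimately have "c + 1 / q \<in> closure U"
        unfolding closure_sequential by (intro exI[of _ "\<lambda>n. c + 1 / X n"]) simp
      moreover have "c + 1 / q \<notin> U" using q(2) False by (simp add: W_def)
      ultimately have "c + 1 / q \<in> J" by (simp add: J_def frontier_def interior_open U1)
      then show ?thesis unfolding \<Gamma>_def inverted_curve_def by (auto intro!: image_eqI[of _ _ "c + 1 / q"])
    next
      case True
      \<comment> \<open>0 can be a limit of points of \<open>W\<close> only if \<open>U\<close> is
        unbounded; then the frontier is unbounded too, and 0 belongs to the inverted curve by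
        construction.\<close>
      have "\<not> bounded U"
      proof
        assume "bounded U"
        then obtain b0 where b0: "\<And>p. p \<in> U \<Longrightarrow> norm p \<le> b0" unfolding bounded_iff by blast
        define b where "b = norm c + b0 + 1"
        have b: "0 < b" unfolding b_def using b0[OF c] norm_ge_zero[of c] by linarith
        have b': "dist c p \<le> b" if "p \<in> U" for p
          using b0[OF that] norm_triangle_ineq4[of c p] unfolding b_def dist_norm by linarith
        have "1 / b \<le> norm (X n)" for n
        proof -
          have x: "X n \<noteq> 0" "c + 1 / X n \<in> U" using X(1)[of n] by (auto simp: W_def)
          have "1 / norm (X n) \<le> b" using b'[OF x(2)] by (simp add: dist_norm norm_divide)
          then show ?thesis using x(1) b by (simp add: divide_le_eq mult.commute)
        qed
        then have "1 / b \<le> norm q" by (intro LIMSEQ_le_const[OF tendsto_norm[OF X(2)]]) auto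
        then show False using True b by simp
      qed
      then have "\<not> bounded J" unfolding J_def using simply_connected_bounded_frontier U1 Une by blast
      then show ?thesis using True by (simp add: \<Gamma>_def inverted_curve_def)
    qed
  qed
  have W_disj: "W \<inter> \<Gamma> = {}"
    using JU cJ by (auto simp: W_def \<Gamma>_def inverted_curve_def split: if_splits)
  have near: "c + 1 / q \<in> cball c (d0 / 2)" if "R < norm q" for q
  proof -
    have "0 < norm q" using that R by linarith
    then show ?thesis using that d0 by (simp add: R_def dist_norm norm_divide field_simps)
  qed
  have far: "{q. R < norm q} \<subseteq> W" using near cb R by (auto simp: W_def subset_iff)
  define \<Phi> where "\<Phi> = (\<lambda>q. f (c + 1 / q))"
  have \<Phi>h: "\<Phi> holomorphic_on W" unfolding \<Phi>_def
    by (rule holomorphic_on_compose_gen[OF _ f(1), unfolded o_def])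
      (auto simp: W_def intro!: holomorphic_intros)
  have \<Phi>i: "\<Phi> ` W \<subseteq> ball 0 1" using f(2) by (auto simp: \<Phi>_def W_def)
  obtain u0 where u0: "0 < u0" "u0 \<le> 1" "\<And>p. p \<in> cball c (d0 / 2) \<Longrightarrow> u0 \<le> 1 - norm (f p)"
  proof -
    have "continuous_on (cball c (d0 / 2)) (\<lambda>p. 1 - norm (f p))"
      by (intro continuous_intros continuous_on_subset[OF holomorphic_on_imp_continuous_on[OF f(1)] cb])
    then obtain p0 where p0: "p0 \<in> cball c (d0 / 2)" "\<And>p. p \<in> cball c (d0 / 2) \<Longrightarrow> 1 - norm (f p0) \<le> 1 - norm (f p)"
      using continuous_attains_inf[of "cball c (d0 / 2)" "\<lambda>p. 1 - norm (f p)"] d0 by auto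
    have "f p0 \<in> ball 0 1" using p0(1) cb f(2) by blast
    then show thesis using that[of "1 - norm (f p0)"] p0(2) by auto
  qed
  have u0': "u0 \<le> 1 - norm (\<Phi> q)" if "R < norm q" for q using u0(3)[OF near[OF that]] by (simp add: \<Phi>_def)
  obtain K M where MK: "0 < K" "\<And>z d. z \<in> W \<Longrightarrow> norm z \<le> R \<Longrightarrow> 0 < d \<Longrightarrow> ball z d \<inter> \<Gamma> = {} \<Longrightarrow>
      d ^ M \<le> K * (1 - norm (\<Phi> z))"
    by (rule one_minus_norm_ge_power_dist[OF W_con W_fr W_disj far R \<Phi>h \<Phi>i u0(1) u0' C(3,4,1,2)])
      (assumption | rule that)+
  define A where "A = 1 + norm c"
  have A: "1 \<le> A" by (simp add: A_def)
  define k where "k = 1 / (2 * A\<^sup>2)"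
  have k: "0 < k" using A by (simp add: k_def)
  define K' where "K' = 1 / u0 + K / k ^ M"
  show thesis
  proof
    show K': "0 < K'" using u0 MK k by (simp add: K'_def add_pos_pos)
    fix p assume p: "p \<in> U"
    have fp: "0 < 1 - norm (f p)" using f(2) p by (auto simp: image_subset_iff)
    define t where "t = boundary_weight U p"
    have t: "0 < t" "t \<le> 1" unfolding t_def
      using boundary_weight_pos[OF U1(1) Une p] boundary_weight_le_1 by auto
    show "t ^ (3 * M) \<le> K' * (1 - norm (f p))"
    proof (cases "dist c p \<le> d0 / 2")
      case True
      have "t ^ (3 * M) \<le> 1" using t by (simp add: power_le_one)
      also have "1 \<le> 1 / u0 * (1 - norm (f p))" using u0(3)[of p] u0(1) True by (simp add: field_simps)
      also have "\<dots> \<le> K' * (1 - norm (f p))" using fp MK k by (intro mult_right_mono) (auto simp: K'_def)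
      finally show ?thesis .
    next
      case False
      define z where "z = 1 / (p - c)"
      have pc: "p \<noteq> c" using False d0 by auto
      have zW: "z \<in> W" unfolding W_im z_def using p pc by blast
      have zR: "norm z \<le> R" 
      proof -
        have "d0 \<le> 2 * norm (p - c)" using False by (simp add: dist_norm norm_minus_commute)
        then have "1 / norm (p - c) \<le> 2 / d0" using d0 pc by (simp add: frac_le divide_le_eq pos_le_divide_eq)
        then show ?thesis by (simp add: z_def R_def norm_divide)
      qed
      have "t * norm (p - c) \<le> t * ((1 + norm p) * A)"
      proof (intro mult_left_mono)
        have "norm (p - c) \<le> norm p + norm c" by (rule norm_triangle_ineq4)
        also have "\<dots> \<le> (1 + norm p) * A" by (simp add: A_def algebra_simps)
        finally show "norm (p - c) \<le> (1 + norm p) * A" .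
      qed (use t in auto)
      also have "\<dots> = (t * (1 + norm p)) * A" by simp
      also have "\<dots> \<le> 1 * A" using boundary_weight_mult_norm_le A unfolding t_def by (intro mult_right_mono) auto
      finally have tA: "t * norm (p - c) \<le> A" by simp
      have k3: "0 < k * t ^ 3" using k t by simp
      have "k * t ^ 3 \<le> dist z y" if y: "y \<in> \<Gamma>" for y
      proof -
        consider x where "x \<in> J" "y = 1 / (x - c)" | "y = 0"
          using y by (auto simp: \<Gamma>_def inverted_curve_def split: if_splits)
        then show ?thesis
        proof cases
          case 1
          have "t \<le> dist p x" unfolding t_def by (rule boundary_weight_le_dist) (use 1 JU in auto)
          then show ?thesis using inverted_dist_ge[OF t _ tA A pc, of x] 1 cJ by (auto simp: z_def k_def)
        next
          case 2
          have "t ^ 3 * norm (p - c) \<le> t\<^sup>2 * A"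
            using mult_left_mono[OF tA, of "t\<^sup>2"] by (simp add: power3_eq_cube power2_eq_square algebra_simps)
          also have "\<dots> \<le> 1 * A" using t A by (intro mult_right_mono) (auto simp: power_le_one)
          also have "\<dots> \<le> 2 * A\<^sup>2" using mult_left_mono[of 1 A A] A by (simp add: power2_eq_square)
          finally have "k * t ^ 3 \<le> 1 / norm (p - c)" using pc A by (simp add: k_def field_simps)
          then show ?thesis using 2 by (simp add: z_def norm_divide)
        qed
      qed
      then have "ball z (k * t ^ 3) \<inter> \<Gamma> = {}" by force
      from MK(2)[OF zW zR k3 this] have "(k * t ^ 3) ^ M \<le> K * (1 - norm (f p))"
        using pc by (simp add: \<Phi>_def z_def)
      then have "t ^ (3 * M) * k ^ M \<le> K * (1 - norm (f p))"
        by (simp add: power_mult_distrib mult.commute flip: power_mult)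
      then have "t ^ (3 * M) \<le> K * (1 - norm (f p)) / k ^ M"
        using k by (simp add: pos_le_divide_eq)
      also have "\<dots> = K / k ^ M * (1 - norm (f p))" by simp
      finally have "t ^ (3 * M) \<le> K / k ^ M * (1 - norm (f p))" .
      also have "\<dots> \<le> K' * (1 - norm (f p))" using fp u0 by (intro mult_right_mono) (auto simp: K'_def)
      finally show ?thesis .
    qed
  qed
qed

text \<open>The weight is a minimum, and each inequality of
  \<open>injective_dist_omitted_value\<close> handles one entry: the lower bound, for every
  \<open>a\<close> outside \<open>U\<close>, keeps \<open>g w\<close> off the complement; the upper
  bound, for a single \<open>a0\<close>, limits \<open>norm (g w)\<close>.\<close>

lemma injective_boundary_weight_lower:
  assumes U: "U \<noteq> UNIV" "open U" and g: "g holomorphic_on ball 0 1" "inj_on g (ball 0 1)" "g ` ball 0 1 \<subseteq> U"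
  obtains K where "0 < K" "\<And>w. norm w < 1 \<Longrightarrow> (1 - norm w) ^ 48 \<le> K * boundary_weight U (g w)"
proof -
  obtain a0 where a0: "a0 \<notin> U" using U by auto
  have "g 0 \<in> U" using g(3) by auto
  then obtain d0 where d0: "0 < d0" "ball (g 0) d0 \<subseteq> U" using U(2) by (meson openE)
  define A where "A = 1 + norm a0 + norm (g 0 - a0)"
  have A: "0 < A" by (simp add: A_def add_pos_nonneg)
  define K where "K = 1 / d0 + A"
  show thesis
  proof
    show K0: "0 < K" using d0 A by (simp add: K_def add_pos_pos)
    fix w :: complex assume w: "norm w < 1"
    define s where "s = (1 - norm w) ^ 48"
    have s: "0 < s" "s \<le> 1" using w by (auto simp: s_def power_le_one)
    have b: "norm (g 0 - a) * s \<le> norm (g w - a)" "norm (g w - a) * s \<le> norm (g 0 - a)" if "a \<notin> U" for a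
      using injective_dist_omitted_value[OF g(1,2) _ w, of a] that g(3) by (auto simp: s_def)
    have "d0 * s \<le> infdist (g w) (- U)"
    proof -
      have "d0 * s \<le> dist (g w) a" if "a \<in> - U" for a
      proof -
        have "d0 \<le> norm (g 0 - a)" using that d0 by (force simp: dist_norm)
        then have "d0 * s \<le> norm (g 0 - a) * s" using s by (intro mult_right_mono) auto
        then show ?thesis using b[of a] that by (simp add: dist_norm)
      qed
      then show ?thesis using a0 unfolding infdist_def by (auto intro!: cINF_greatest)
    qed
    then have "s \<le> 1 / d0 * infdist (g w) (- U)" using d0 by (simp add: field_simps)
    also have "\<dots> \<le> K * infdist (g w) (- U)" using A by (intro mult_right_mono) (auto simp: K_def infdist_nonneg)
    finally have 1: "s \<le> K * infdist (g w) (- U)" .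
    have "norm (g w) \<le> norm a0 + norm (g w - a0)" using norm_triangle_ineq[of a0 "g w - a0"] by simp
    then have "s * (1 + norm (g w)) \<le> s * (1 + norm a0 + norm (g w - a0))" using s by (intro mult_left_mono) auto
    also have "\<dots> = s * (1 + norm a0) + norm (g w - a0) * s" by (simp add: algebra_simps)
    also have "\<dots> \<le> 1 * (1 + norm a0) + norm (g 0 - a0)" using s b(2)[OF a0] by (intro add_mono mult_right_mono) auto
    also have "\<dots> \<le> K" using d0 by (simp add: K_def A_def)
    finally have "s \<le> K * (1 / (1 + norm (g w)))" by (simp add: pos_le_divide_eq add_pos_nonneg)
    then show "(1 - norm w) ^ 48 \<le> K * boundary_weight U (g w)"
      using 1 by (auto simp: s_def boundary_weight_def min_def)
  qed
qed

lemma quasidisc_riemann_map: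
  assumes U: "quasidisc U"
  obtains f g M K where "f holomorphic_on U" "g holomorphic_on ball 0 1"
    "\<And>z. z \<in> U \<Longrightarrow> f z \<in> ball 0 1 \<and> g (f z) = z" "\<And>w. w \<in> ball 0 1 \<Longrightarrow> g w \<in> U \<and> f (g w) = w"
    "0 < K" "\<And>z. z \<in> U \<Longrightarrow> boundary_weight U z ^ M \<le> K * (1 - norm (f z))"
    "\<And>w. w \<in> ball 0 1 \<Longrightarrow> (1 - norm w) ^ M \<le> K * boundary_weight U (g w)"
proof -
  have U1: "open U" "simply_connected U" using U by (auto simp: quasidisc_def)
  have ne: "U \<noteq> UNIV" "U \<noteq> {}" using quasidisc_frontier_nonempty[OF U] by auto
  then obtain f g where fg: "f holomorphic_on U" "g holomorphic_on ball 0 1"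
    "\<And>z. z \<in> U \<Longrightarrow> f z \<in> ball 0 1 \<and> g (f z) = z" "\<And>w. w \<in> ball 0 1 \<Longrightarrow> g w \<in> U \<and> f (g w) = w"
    using Riemann_mapping_theorem[of U] U1 by metis
  have "f ` U \<subseteq> ball 0 1" "g 0 \<in> U" using fg(3) fg(4)[of 0] by auto
  from quasidisc_riemann_map_lower[OF U fg(1) this] obtain M1 K1 where
    1: "0 < K1" "\<And>z. z \<in> U \<Longrightarrow> boundary_weight U z ^ M1 \<le> K1 * (1 - norm (f z))" by metis
  have "inj_on g (ball 0 1)" using fg(4) by (metis inj_on_inverseI)
  moreover have "g ` ball 0 1 \<subseteq> U" using fg(4) by auto
  ultimately obtain K2 where 2: "0 < K2" "\<And>w. norm w < 1 \<Longrightarrow> (1 - norm w) ^ 48 \<le> K2 * boundary_weight U (g w)"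
    using injective_boundary_weight_lower[OF ne(1) U1(1) fg(2)] by metis
  show thesis
  \<comment> \<open>Raising both exponents to a common value is harmless because the bases are at
    most 1.\<close>
  proof (rule that[OF fg, of "K1 + K2" "M1 + 48"])
    show "0 < K1 + K2" using 1 2 by simp
    show "boundary_weight U z ^ (M1 + 48) \<le> (K1 + K2) * (1 - norm (f z))" if z: "z \<in> U" for z
    proof -
      have "boundary_weight U z ^ (M1 + 48) \<le> boundary_weight U z ^ M1"
        by (intro power_decreasing boundary_weight_nonneg boundary_weight_le_1) auto
      also have "\<dots> \<le> K1 * (1 - norm (f z))" by (rule 1(2)[OF z])
      also have "\<dots> \<le> (K1 + K2) * (1 - norm (f z))" using fg(3)[OF z] 2(1) by (intro mult_right_mono) auto
      finally show ?thesis .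
    qed
    show "(1 - norm w) ^ (M1 + 48) \<le> (K1 + K2) * boundary_weight U (g w)" if w: "w \<in> ball 0 1" for w
    proof -
      have "(1 - norm w) ^ (M1 + 48) \<le> (1 - norm w) ^ 48" using w by (intro power_decreasing) auto
      also have "\<dots> \<le> K2 * boundary_weight U (g w)" using 2(2) w by simp
      also have "\<dots> \<le> (K1 + K2) * boundary_weight U (g w)"
        using boundary_weight_nonneg 1(1) by (intro mult_right_mono) auto
      finally show ?thesis .
    qed
  qed
qed

section \<open>Schwartz spaces\<close>

lemma frechet_derivative_cong_open:
  assumes "open U" "x \<in> U" "\<And>y. y \<in> U \<Longrightarrow> f y = g y"
  shows "frechet_derivative f (at x) = frechet_derivative g (at x)"
proof -
  have "(f has_derivative D) (at x) \<longleftrightarrow> (g has_derivative D) (at x)" for D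
    using has_derivative_transform_within_open[OF _ assms(1,2)] assms(3) by metis
  then show ?thesis unfolding frechet_derivative_def by simp
qed

lemma iter_partial_cong_open:
  assumes "open U" "\<And>y. y \<in> U \<Longrightarrow> f y = g y"
  shows "x \<in> U \<Longrightarrow> iter_partial k f x = iter_partial k g x"
proof (induction k arbitrary: x)
  case (Cons b k)
  then show ?case using frechet_derivative_cong_open[OF assms(1) Cons.prems, of "iter_partial k f" "iter_partial k g"]
    by simp
qed (use assms in simp)

lemma smooth_on_cong_open:
  fixes f g :: "'a::euclidean_space \<Rightarrow> 'b::real_normed_vector"
  assumes "open U" "\<And>y. y \<in> U \<Longrightarrow> f y = g y" "smooth_on U f"
  shows "smooth_on U g"
  unfolding smooth_on_def
proof (intro ballI)
  fix k :: "'a list" and x :: 'a assume k: "k \<in> lists Basis" and x: "x \<in> U"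
  then obtain D where "(iter_partial k f has_derivative D) (at x)"
    using assms(3) unfolding smooth_on_def differentiable_def by blast
  then have "(iter_partial k g has_derivative D) (at x)"
    by (rule has_derivative_transform_within_open[OF _ assms(1) x]) (rule iter_partial_cong_open[OF assms(1,2)])
  then show "iter_partial k g differentiable at x" unfolding differentiable_def by blast
qed

lemma smooth_onD: "smooth_on U f \<Longrightarrow> k \<in> lists Basis \<Longrightarrow> x \<in> U \<Longrightarrow> iter_partial k f differentiable at x"
  by (simp add: smooth_on_def)

lemma iter_partial_lincomb:
  fixes f g :: "'a::euclidean_space \<Rightarrow> real"
  assumes f: "smooth_on UNIV f" and g: "smooth_on UNIV g"
  shows "k \<in> lists Basis \<Longrightarrow>
    iter_partial k (\<lambda>x. a * f x + b * g x) = (\<lambda>x. a * iter_partial k f x + b * iter_partial k g x)"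
proof (induction k)
  case (Cons c k)
  then have k: "k \<in> lists Basis" by simp
  have "frechet_derivative (\<lambda>x. a * iter_partial k f x + b * iter_partial k g x) (at x) =
    (\<lambda>h. a * frechet_derivative (iter_partial k f) (at x) h + b * frechet_derivative (iter_partial k g) (at x) h)" for x
  proof (rule frechet_derivative_at[symmetric])
    have "(iter_partial k f has_derivative frechet_derivative (iter_partial k f) (at x)) (at x)"
      "(iter_partial k g has_derivative frechet_derivative (iter_partial k g) (at x)) (at x)"
      using smooth_onD[OF f k] smooth_onD[OF g k] by (simp_all add: frechet_derivative_works)
    then show "((\<lambda>x. a * iter_partial k f x + b * iter_partial k g x) has_derivative
      (\<lambda>h. a * frechet_derivative (iter_partial k f) (at x) h + b * frechet_derivative (iter_partial k g) (at x) h)) (at x)"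
      by (intro has_derivative_add has_derivative_mult_right)
  qed
  then show ?case using Cons.IH[OF k] by simp
qed simp

lemma schwartz_space_bdd:
  "f \<in> schwartz_space \<Longrightarrow> k \<in> lists Basis \<Longrightarrow> bdd_above (range (\<lambda>x. \<bar>monomial l x * iter_partial k f x\<bar>))"
  by (simp add: schwartz_space_def)

lemma schwartz_seminorm_upper:
  "f \<in> schwartz_space \<Longrightarrow> k \<in> lists Basis \<Longrightarrow> \<bar>monomial l x * iter_partial k f x\<bar> \<le> schwartz_seminorm l k f"
  unfolding schwartz_seminorm_def by (rule cSUP_upper[OF UNIV_I schwartz_space_bdd])

lemma schwartz_seminorm_nonneg: "f \<in> schwartz_space \<Longrightarrow> k \<in> lists Basis \<Longrightarrow> 0 \<le> schwartz_seminorm l k f"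
  using schwartz_seminorm_upper[of f k l undefined] by linarith

lemma schwartz_seminorm_least:
  "(\<And>x. \<bar>monomial l x * iter_partial k f x\<bar> \<le> B) \<Longrightarrow> schwartz_seminorm l k f \<le> B"
  unfolding schwartz_seminorm_def by (rule cSUP_least) auto

lemma schwartz_seminorm_lincomb:
  assumes f: "f \<in> schwartz_space" and g: "g \<in> schwartz_space" and k: "k \<in> lists Basis"
  shows "\<bar>monomial l x * iter_partial k (\<lambda>x. a * f x + b * g x) x\<bar>
    \<le> \<bar>a\<bar> * schwartz_seminorm l k f + \<bar>b\<bar> * schwartz_seminorm l k g"
proof -
  have s: "smooth_on UNIV f" "smooth_on UNIV g" using f g by (auto simp: schwartz_space_def)
  have "monomial l x * iter_partial k (\<lambda>x. a * f x + b * g x) x =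
    a * (monomial l x * iter_partial k f x) + b * (monomial l x * iter_partial k g x)"
    by (simp add: iter_partial_lincomb[OF s k] algebra_simps)
  also have "\<bar>\<dots>\<bar> \<le> \<bar>a\<bar> * \<bar>monomial l x * iter_partial k f x\<bar> + \<bar>b\<bar> * \<bar>monomial l x * iter_partial k g x\<bar>"
    by (metis abs_mult abs_triangle_ineq)
  also have "\<dots> \<le> \<bar>a\<bar> * schwartz_seminorm l k f + \<bar>b\<bar> * schwartz_seminorm l k g"
    using schwartz_seminorm_upper[OF f k] schwartz_seminorm_upper[OF g k] by (intro add_mono mult_left_mono) auto
  finally show ?thesis .
qed

lemma schwartz_space_lincomb:
  assumes f: "f \<in> schwartz_space" and g: "g \<in> schwartz_space"
  shows "(\<lambda>x. a * f x + b * g x) \<in> schwartz_space"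
proof -
  have s: "smooth_on UNIV f" "smooth_on UNIV g" using f g by (auto simp: schwartz_space_def)
  have "smooth_on UNIV (\<lambda>x. a * f x + b * g x)"
    unfolding smooth_on_def using smooth_onD[OF s(1)] smooth_onD[OF s(2)]
    by (auto simp: iter_partial_lincomb[OF s] intro!: differentiable_add differentiable_mult)
  moreover have "bdd_above (range (\<lambda>x. \<bar>monomial l x * iter_partial k (\<lambda>x. a * f x + b * g x) x\<bar>))"
    if "k \<in> lists Basis" for l k
    by (rule bdd_aboveI2[OF schwartz_seminorm_lincomb[OF f g that]])
  ultimately show ?thesis unfolding schwartz_space_def by (intro CollectI conjI allI ballI)
qed

lemma schwartz_seminorm_triangle:
  assumes f: "f \<in> schwartz_space" and g: "g \<in> schwartz_space" and h: "h \<in> schwartz_space" and k: "k \<in> lists Basis"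
  shows "schwartz_seminorm l k (\<lambda>x. f x - h x) \<le> schwartz_seminorm l k (\<lambda>x. f x - g x) + schwartz_seminorm l k (\<lambda>x. g x - h x)"
proof -
  have fg: "(\<lambda>x. f x - g x) \<in> schwartz_space" using schwartz_space_lincomb[OF f g, of 1 "-1"] by simp
  have gh: "(\<lambda>x. g x - h x) \<in> schwartz_space" using schwartz_space_lincomb[OF g h, of 1 "-1"] by simp
  have "schwartz_seminorm l k (\<lambda>x. f x - h x) = schwartz_seminorm l k (\<lambda>x. 1 * (f x - g x) + 1 * (g x - h x))" by simp
  also have "\<dots> \<le> schwartz_seminorm l k (\<lambda>x. f x - g x) + schwartz_seminorm l k (\<lambda>x. g x - h x)"
    using schwartz_seminorm_lincomb[OF fg gh k, of l _ 1 1] by (intro schwartz_seminorm_least) auto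
  finally show ?thesis .
qed

lemma schwartz_space_on_lincomb:
  assumes f: "f \<in> schwartz_space_on U" and g: "g \<in> schwartz_space_on U"
  shows "(\<lambda>x. a * f x + b * g x) \<in> schwartz_space_on U"
proof -
  have S: "f \<in> schwartz_space" "g \<in> schwartz_space" using f g by (auto simp: schwartz_space_on_def)
  then have s: "smooth_on UNIV f" "smooth_on UNIV g" by (auto simp: schwartz_space_def)
  show ?thesis
    using f g schwartz_space_lincomb[OF S] by (auto simp: schwartz_space_on_def iter_partial_lincomb[OF s])
qed

lemma openin_schwartz_ball:
  assumes "f \<in> schwartz_space" "k \<in> lists Basis" "0 < e"
  shows "openin schwartz_topology {g \<in> schwartz_space. schwartz_seminorm l k (\<lambda>x. g x - f x) < e}"
  unfolding schwartz_topology_def openin_topology_generated_by_iff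
  by (rule generate_topology_on.Basis) (use assms in blast)

lemma schwartz_seminorm_zero: "schwartz_seminorm l k (\<lambda>x. 0) = 0"
proof -
  have "iter_partial k (\<lambda>x::'a. 0::real) = (\<lambda>x. 0)" by (induction k) auto
  then show ?thesis by (simp add: schwartz_seminorm_def)
qed

lemma topspace_schwartz_topology: "topspace schwartz_topology = schwartz_space"
proof
  show "topspace schwartz_topology \<subseteq> schwartz_space"
    unfolding schwartz_topology_def topology_generated_by_topspace by auto
  show "schwartz_space \<subseteq> (topspace schwartz_topology :: ('a::euclidean_space \<Rightarrow> real) set)"
  proof
    fix f :: "'a \<Rightarrow> real" assume f: "f \<in> schwartz_space"
    have "f \<in> {g \<in> schwartz_space. schwartz_seminorm (\<lambda>_. 0) [] (\<lambda>x. g x - f x) < 1}"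
      using f by (simp add: schwartz_seminorm_zero)
    then show "f \<in> topspace schwartz_topology"
      using openin_subset[OF openin_schwartz_ball[OF f, of "[]" 1 "\<lambda>_. 0"]] by auto
  qed
qed

lemma topspace_schwartz_topology_on: "topspace (schwartz_topology_on U) = schwartz_space_on U"
  unfolding schwartz_topology_on_def topspace_subtopology topspace_schwartz_topology
  by (auto simp: schwartz_space_on_def)

lemma continuous_map_schwartz:
  fixes T :: "('a::euclidean_space \<Rightarrow> real) \<Rightarrow> ('b::euclidean_space \<Rightarrow> real)"
  assumes im: "\<And>s. s \<in> schwartz_space_on V \<Longrightarrow> T s \<in> schwartz_space_on U"
    and lin: "\<And>s t. s \<in> schwartz_space_on V \<Longrightarrow> t \<in> schwartz_space_on V \<Longrightarrow> T (\<lambda>x. s x - t x) = (\<lambda>x. T s x - T t x)"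
    and bound: "\<And>l k. k \<in> lists Basis \<Longrightarrow> \<exists>A C. finite A \<and> A \<subseteq> UNIV \<times> lists Basis \<and> 0 \<le> C \<and>
      (\<forall>s\<in>schwartz_space_on V. schwartz_seminorm l k (T s) \<le> C * (\<Sum>(l', k')\<in>A. schwartz_seminorm l' k' s))"
  shows "continuous_map (schwartz_topology_on V) (schwartz_topology_on U) T"
proof -
  have imS: "T s \<in> schwartz_space" if "s \<in> schwartz_space_on V" for s
    using im[OF that] by (simp add: schwartz_space_on_def)
  have VS: "s \<in> schwartz_space" if "s \<in> schwartz_space_on V" for s
    using that by (simp add: schwartz_space_on_def)
  have "continuous_map (schwartz_topology_on V) schwartz_topology T"
    unfolding schwartz_topology_def
  proof (rule continuous_on_generated_topo)
    fix W assume "W \<in> {{g \<in> schwartz_space. schwartz_seminorm l k (\<lambda>x::'b. g x - f x) < e} | l k f e.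
        k \<in> lists Basis \<and> f \<in> schwartz_space \<and> e > 0}"
    then obtain l k f e where W: "W = {g \<in> schwartz_space. schwartz_seminorm l k (\<lambda>x::'b. g x - f x) < e}"
      and k: "k \<in> lists Basis" and f: "f \<in> schwartz_space" and e: "e > 0" by blast
    obtain A C where A: "finite A" "A \<subseteq> UNIV \<times> lists Basis" "0 \<le> C"
      "\<And>s. s\<in>schwartz_space_on V \<Longrightarrow> schwartz_seminorm l k (T s) \<le> C * (\<Sum>(l', k')\<in>A. schwartz_seminorm l' k' s)"
      using bound[OF k, of l] by blast
    show "openin (schwartz_topology_on V) (T -` W \<inter> topspace (schwartz_topology_on V))"
    proof (subst openin_subopen, intro ballI)
      fix s0 assume "s0 \<in> T -` W \<inter> topspace (schwartz_topology_on V)"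
      then have s0: "s0 \<in> schwartz_space_on V" "schwartz_seminorm l k (\<lambda>x. T s0 x - f x) < e"
        by (auto simp: W topspace_schwartz_topology_on)
      \<comment> \<open>The extra 1 in the denominator keeps it positive and makes \<open>rC\<close>
        strict even when \<open>C * real (card A)\<close> is 0.\<close>
      define r where "r = (e - schwartz_seminorm l k (\<lambda>x. T s0 x - f x)) / (C * real (card A) + 1)"
      have den: "0 < C * real (card A) + 1" using A(3) by (simp add: add_nonneg_pos)
      have r: "0 < r" using s0 den by (simp add: r_def)
      have rC: "C * real (card A) * r < e - schwartz_seminorm l k (\<lambda>x. T s0 x - f x)"
      proof -
        have "(C * real (card A) + 1) * r = e - schwartz_seminorm l k (\<lambda>x. T s0 x - f x)" using den by (simp add: r_def)
        then show ?thesis using r by (simp add: algebra_simps)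
      qed
      define N where "N = (\<lambda>(l', k'). {g \<in> schwartz_space. schwartz_seminorm l' k' (\<lambda>x. g x - s0 x) < r})"
      define O' where "O' = (\<Inter>q\<in>A. N q) \<inter> schwartz_space_on V"
      have opN: "openin schwartz_topology (N q)" if "q \<in> A" for q
        using that A(2) r VS[OF s0(1)] unfolding N_def by (auto intro!: openin_schwartz_ball)
      have "openin (schwartz_topology_on V) O'"
      \<comment> \<open>The empty intersection is \<open>UNIV\<close>, which is not open in a
        topology whose space is \<open>schwartz_space\<close>.\<close>
      proof (cases "A = {}")
        case True
        then have "O' = topspace (schwartz_topology_on V)" by (simp add: O'_def topspace_schwartz_topology_on)
        then show ?thesis by (metis openin_topspace)
      next
        case False
        then have "openin schwartz_topology (\<Inter>q\<in>A. N q)" using opN A(1) by (intro openin_INT2) auto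
        then show ?thesis unfolding O'_def schwartz_topology_on_def by (rule openin_subtopology_Int)
      qed
      moreover have "s0 \<in> O'"
        using s0(1) VS[OF s0(1)] r by (auto simp: O'_def N_def schwartz_seminorm_zero)
      moreover have "O' \<subseteq> T -` W \<inter> topspace (schwartz_topology_on V)"
      proof
        fix s assume s: "s \<in> O'"
        then have sV: "s \<in> schwartz_space_on V" by (simp add: O'_def)
        have d: "(\<lambda>x. s x - s0 x) \<in> schwartz_space_on V"
          using schwartz_space_on_lincomb[OF sV s0(1), of 1 "-1"] by simp
        have "schwartz_seminorm l k (\<lambda>x. T s x - T s0 x) \<le> C * (\<Sum>(l', k')\<in>A. schwartz_seminorm l' k' (\<lambda>x. s x - s0 x))"
          using A(4)[OF d] lin[OF sV s0(1)] by simp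
        also have "\<dots> \<le> C * (\<Sum>q\<in>A. r)"
          using s A(3) by (intro mult_left_mono sum_mono) (auto simp: O'_def N_def case_prod_unfold intro: less_imp_le)
        finally have "schwartz_seminorm l k (\<lambda>x. T s x - T s0 x) < e - schwartz_seminorm l k (\<lambda>x. T s0 x - f x)"
          using rC by (simp add: mult.assoc)
        then have "schwartz_seminorm l k (\<lambda>x. T s x - f x) < e"
          using schwartz_seminorm_triangle[OF imS[OF sV] imS[OF s0(1)] f k, of l] by linarith
        then show "s \<in> T -` W \<inter> topspace (schwartz_topology_on V)"
          using imS[OF sV] sV by (simp add: W topspace_schwartz_topology_on)
      qed
      ultimately show "\<exists>O'. openin (schwartz_topology_on V) O' \<and> s0 \<in> O' \<and> O' \<subseteq> T -` W \<inter> topspace (schwartz_topology_on V)"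
        by blast
    qed
  next
    have "T ` topspace (schwartz_topology_on V) \<subseteq> topspace schwartz_topology"
      using imS by (auto simp: topspace_schwartz_topology_on topspace_schwartz_topology)
    then show "T ` topspace (schwartz_topology_on V) \<subseteq> \<Union> {{g \<in> schwartz_space. schwartz_seminorm l k (\<lambda>x::'b. g x - f x) < e} | l k f e.
        k \<in> lists Basis \<and> f \<in> schwartz_space \<and> e > 0}"
      unfolding schwartz_topology_def topology_generated_by_topspace .
  qed
  then show ?thesis
    unfolding schwartz_topology_on_def[of U] using im
    by (auto simp: continuous_map_in_subtopology topspace_schwartz_topology_on)
qed

text \<open>The three monomials with exponent vectors \<open>0\<close>, \<open>(n, 0)\<close> and \<open>(0, n)\<close> already control
  \<open>(1 + norm x) ^ n\<close>; the smaller exponents only serve to make the control monotone in \<open>n\<close>.\<close>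

definition control_exponents :: "nat \<Rightarrow> (complex \<Rightarrow> nat) set" where
  "control_exponents n = (\<Union>m\<le>n. {\<lambda>_. 0, (\<lambda>_. 0)(1 := m), (\<lambda>_. 0)(\<i> := m)})"

definition control_indices :: "nat \<Rightarrow> ((complex \<Rightarrow> nat) \<times> complex list) set" where
  "control_indices n = control_exponents n \<times> {k. set k \<subseteq> Basis \<and> length k \<le> n}"

definition schwartz_control :: "nat \<Rightarrow> (complex \<Rightarrow> real) \<Rightarrow> real" where
  "schwartz_control n f = (\<Sum>(l, k)\<in>control_indices n. schwartz_seminorm l k f)"

lemma finite_control_indices: "finite (control_indices n)"
  unfolding control_indices_def control_exponents_def
  by (intro finite_cartesian_product finite_lists_length_le) auto

lemma control_indices_subset: "control_indices n \<subseteq> UNIV \<times> lists Basis"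
  unfolding control_indices_def by auto

lemma schwartz_control_nonneg: "f \<in> schwartz_space \<Longrightarrow> 0 \<le> schwartz_control n f"
  unfolding schwartz_control_def
proof (rule sum_nonneg)
  fix p assume f: "f \<in> schwartz_space" and "p \<in> control_indices n"
  then have "snd p \<in> lists Basis" by (auto simp: control_indices_def)
  then show "0 \<le> (case p of (l, k) \<Rightarrow> schwartz_seminorm l k f)"
    using schwartz_seminorm_nonneg[OF f] by (simp add: case_prod_unfold)
qed

lemma schwartz_control_mono:
  assumes f: "f \<in> schwartz_space" and n: "n \<le> n'"
  shows "schwartz_control n f \<le> schwartz_control n' f"
  unfolding schwartz_control_def
proof (rule sum_mono2[OF finite_control_indices])
  have "{..n} \<subseteq> {..n'}" using n by auto
  then have "control_exponents n \<subseteq> control_exponents n'" unfolding control_exponents_def by (intro UN_mono) auto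
  moreover have "{k. set k \<subseteq> Basis \<and> length k \<le> n} \<subseteq> {k. set k \<subseteq> Basis \<and> length k \<le> n'}" using n by auto
  ultimately show "control_indices n \<subseteq> control_indices n'" unfolding control_indices_def by (rule Sigma_mono)
  fix p assume "p \<in> control_indices n' - control_indices n"
  then have "snd p \<in> lists Basis" by (auto simp: control_indices_def)
  then show "0 \<le> (case p of (l, k) \<Rightarrow> schwartz_seminorm l k f)"
    using schwartz_seminorm_nonneg[OF f] by (simp add: case_prod_unfold)
qed

lemma monomial_complex: "monomial l z = Re z ^ l 1 * Im z ^ l \<i>"
  by (simp add: monomial_def Basis_complex_def)

lemma power_sum3_le:
  fixes a b c :: real
  assumes "0 \<le> a" "0 \<le> b" "0 \<le> c"
  shows "(a + b + c) ^ n \<le> 3 ^ n * (a ^ n + b ^ n + c ^ n)"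
proof -
  define m where "m = max a (max b c)"
  have "(a + b + c) ^ n \<le> (3 * m) ^ n" using assms by (intro power_mono) (auto simp: m_def)
  also have "\<dots> = 3 ^ n * m ^ n" by (rule power_mult_distrib)
  also have "m = a \<or> m = b \<or> m = c" by (auto simp: m_def max_def)
  then have "m ^ n \<le> a ^ n + b ^ n + c ^ n" using assms by auto
  then have "3 ^ n * m ^ n \<le> 3 ^ n * (a ^ n + b ^ n + c ^ n)" by (intro mult_left_mono) auto
  finally show ?thesis .
qed

text \<open>Bound \<open>norm x\<close> by \<open>\<bar>Re x\<bar> + \<bar>Im x\<bar>\<close>; the
  power of a sum of three terms costs \<open>3 ^ n\<close>. Each resulting monomial belongs to one
  summand of \<open>schwartz_control\<close>, and there are three of them.\<close>

lemma schwartz_control_upper: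
  assumes f: "f \<in> schwartz_space" and k: "k \<in> lists Basis" "length k \<le> n"
  shows "(1 + norm x) ^ n * \<bar>iter_partial k f x\<bar> \<le> 3 ^ Suc n * schwartz_control n f"
proof -
  define D where "D = \<bar>iter_partial k f x\<bar>"
  have D: "0 \<le> D" by (simp add: D_def)
  have part: "\<bar>monomial l x\<bar> * D \<le> schwartz_control n f" if "l \<in> control_exponents n" for l
  proof -
    have "\<bar>monomial l x\<bar> * D \<le> schwartz_seminorm l k f"
      using schwartz_seminorm_upper[OF f k(1), of l x] by (simp add: D_def abs_mult)
    also have "\<dots> = (\<lambda>(l, k). schwartz_seminorm l k f) (l, k)" by simp
    also have "\<dots> \<le> schwartz_control n f" unfolding schwartz_control_def
    proof (rule member_le_sum[OF _ _ finite_control_indices])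
      show "(l, k) \<in> control_indices n" using that k by (auto simp: control_indices_def)
      fix p assume "p \<in> control_indices n - {(l, k)}"
      then have "snd p \<in> lists Basis" by (auto simp: control_indices_def)
      then show "0 \<le> (case p of (l, k) \<Rightarrow> schwartz_seminorm l k f)"
        using schwartz_seminorm_nonneg[OF f] by (simp add: case_prod_unfold)
    qed
    finally show ?thesis .
  qed
  have ni: "\<i> \<noteq> (1::complex)" by (simp add: complex_eq_iff)
  have t: "D \<le> schwartz_control n f" "\<bar>Re x\<bar> ^ n * D \<le> schwartz_control n f" "\<bar>Im x\<bar> ^ n * D \<le> schwartz_control n f"
    using part[of "\<lambda>_. 0"] part[of "(\<lambda>_. 0)(1 := n)"] part[of "(\<lambda>_. 0)(\<i> := n)"] ni ni[symmetric]
    by (auto simp: control_exponents_def monomial_complex power_abs)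
  have "(1 + norm x) ^ n \<le> (1 + \<bar>Re x\<bar> + \<bar>Im x\<bar>) ^ n"
    using cmod_le[of x] by (intro power_mono) auto
  also have "\<dots> \<le> 3 ^ n * (1 ^ n + \<bar>Re x\<bar> ^ n + \<bar>Im x\<bar> ^ n)" by (intro power_sum3_le) auto
  finally have "(1 + norm x) ^ n * D \<le> 3 ^ n * (1 ^ n + \<bar>Re x\<bar> ^ n + \<bar>Im x\<bar> ^ n) * D"
    using D by (intro mult_right_mono) auto
  also have "\<dots> = 3 ^ n * (D + \<bar>Re x\<bar> ^ n * D + \<bar>Im x\<bar> ^ n * D)" by (simp add: algebra_simps)
  also have "\<dots> \<le> 3 ^ n * (3 * schwartz_control n f)" using t by (intro mult_left_mono) auto
  finally show ?thesis by (simp add: D_def mult_ac)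
qed

section \<open>Decay of Schwartz functions towards the boundary\<close>

lemma has_derivative_complex_partials:
  fixes h :: "complex \<Rightarrow> real"
  assumes "h differentiable at x"
  shows "(h has_derivative (\<lambda>v. Re v * frechet_derivative h (at x) 1 + Im v * frechet_derivative h (at x) \<i>)) (at x)"
proof -
  have d: "(h has_derivative frechet_derivative h (at x)) (at x)" using assms by (simp add: frechet_derivative_works)
  then interpret L: bounded_linear "frechet_derivative h (at x)" by (rule has_derivative_bounded_linear)
  have "frechet_derivative h (at x) v = Re v * frechet_derivative h (at x) 1 + Im v * frechet_derivative h (at x) \<i>" for v
  proof -
    have "v = Re v *\<^sub>R 1 + Im v *\<^sub>R \<i>" by (simp add: complex_eq_iff)
    then show ?thesis by (metis L.add L.scaleR real_scaleR_def)
  qed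
  then have "frechet_derivative h (at x) = (\<lambda>v. Re v * frechet_derivative h (at x) 1 + Im v * frechet_derivative h (at x) \<i>)" by blast
  then show ?thesis using d by simp
qed

text \<open>Used for functions extended by zero, at points outside the domain: quadratic decay makes
  the derivative exist there and vanish.\<close>

lemma has_derivative_zero_if_quadratic:
  fixes f :: "'a::real_normed_vector \<Rightarrow> 'b::real_normed_vector"
  assumes "f x = 0" "\<And>y. norm (f y) \<le> C * (norm (y - x))\<^sup>2"
  shows "(f has_derivative (\<lambda>_. 0)) (at x)"
proof (rule has_derivativeI_sandwich[of 1])
  show "((\<lambda>y. \<bar>C\<bar> * norm (y - x)) \<longlongrightarrow> 0) (at x)"
    by (auto intro!: tendsto_eq_intros)
  fix y assume "y \<noteq> x"
  have "norm (f y) \<le> \<bar>C\<bar> * (norm (y - x))\<^sup>2"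
    by (rule order_trans[OF assms(2)]) (intro mult_right_mono, auto)
  then show "norm (f y - f x - 0) / norm (y - x) \<le> \<bar>C\<bar> * norm (y - x)"
    using assms(1) \<open>y \<noteq> x\<close> by (simp add: divide_le_eq power2_eq_square mult.assoc)
qed auto

text \<open>Taylor's formula as an induction on \<open>N\<close>: starting from the nearest point
  \<open>b\<close> of the complement, where all derivatives vanish, the mean value inequality gains
  one factor of the distance for each derivative spent. The 2 counts the partial derivatives that
  bound the gradient.\<close>

lemma iter_partial_dist_decay:
  assumes f: "f \<in> schwartz_space_on U" and U: "open U" "U \<noteq> UNIV"
  shows "k \<in> lists Basis \<Longrightarrow> N + length k \<le> n \<Longrightarrow>
    \<bar>iter_partial k f y\<bar> \<le> (2 * infdist y (- U)) ^ N * (3 ^ Suc n * schwartz_control n f)"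
proof (induction N arbitrary: k y)
  define B where "B = 3 ^ Suc n * schwartz_control n f"
  have fS: "f \<in> schwartz_space" and f0: "\<And>k x. k \<in> lists Basis \<Longrightarrow> x \<in> - U \<Longrightarrow> iter_partial k f x = 0"
    using f by (auto simp: schwartz_space_on_def)
  have B: "0 \<le> B" using schwartz_control_nonneg[OF fS] by (simp add: B_def)
  {
    case 0
    have "1 * \<bar>iter_partial k f y\<bar> \<le> (1 + norm y) ^ n * \<bar>iter_partial k f y\<bar>"
      by (intro mult_right_mono one_le_power) auto
    then show ?case using schwartz_control_upper[OF fS 0(1), of n y] 0(2) by simp
  next
    case (Suc N)
    have "closed (- U)" "- U \<noteq> {}" using U by auto
    then obtain b where b: "b \<in> - U" "infdist y (- U) = dist y b" by (rule infdist_attains_inf)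
    define d where "d = dist y b"
    define h where "h = iter_partial k f"
    define M where "M = 2 * ((2 * d) ^ N * B)"
    have "norm (h y - h b) \<le> M * norm (y - b)"
    proof (rule differentiable_bound[of "closed_segment b y" h])
      fix p assume p: "p \<in> closed_segment b y"
      have dif: "h differentiable at p"
        using fS Suc.prems(1) unfolding h_def schwartz_space_def smooth_on_def by blast
      show "(h has_derivative (\<lambda>v. Re v * frechet_derivative h (at p) 1 + Im v * frechet_derivative h (at p) \<i>)) (at p within closed_segment b y)"
        by (rule has_derivative_at_withinI[OF has_derivative_complex_partials[OF dif]])
      have "infdist p (- U) \<le> dist p b" by (rule infdist_le[OF b(1)])
      also have "\<dots> \<le> d" unfolding d_def using segment_bound(1)[OF p] by (simp add: dist_norm)
      finally have pd: "infdist p (- U) \<le> d" .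
      have part: "\<bar>frechet_derivative h (at p) e\<bar> \<le> (2 * d) ^ N * B" if e: "e \<in> Basis" for e
      proof -
        have "\<bar>iter_partial (e # k) f p\<bar> \<le> (2 * infdist p (- U)) ^ N * B"
          unfolding B_def by (rule Suc.IH) (use Suc.prems e in auto)
        also have "\<dots> \<le> (2 * d) ^ N * B"
          using pd B by (intro mult_right_mono power_mono) (auto simp: infdist_nonneg)
        finally show ?thesis by (simp add: h_def)
      qed
      have bas: "(1::complex) \<in> Basis" "\<i> \<in> Basis" by (auto simp: Basis_complex_def)
      show "onorm (\<lambda>v. Re v * frechet_derivative h (at p) 1 + Im v * frechet_derivative h (at p) \<i>) \<le> M"
      proof (rule onorm_le)
        fix v :: complex
        have "norm (Re v * frechet_derivative h (at p) 1 + Im v * frechet_derivative h (at p) \<i>)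
          \<le> \<bar>Re v\<bar> * \<bar>frechet_derivative h (at p) 1\<bar> + \<bar>Im v\<bar> * \<bar>frechet_derivative h (at p) \<i>\<bar>"
          by (metis abs_mult abs_triangle_ineq real_norm_def)
        also have "\<dots> \<le> norm v * ((2 * d) ^ N * B) + norm v * ((2 * d) ^ N * B)"
          by (intro add_mono mult_mono part bas abs_Re_le_cmod abs_Im_le_cmod) auto
        finally show "norm (Re v * frechet_derivative h (at p) 1 + Im v * frechet_derivative h (at p) \<i>) \<le> M * norm v"
          by (simp add: M_def algebra_simps)
      qed
    qed auto
    moreover have "h b = 0" unfolding h_def by (rule f0[OF Suc.prems(1) b(1)])
    ultimately have "\<bar>h y\<bar> \<le> M * d" by (simp add: d_def dist_norm)
    then show ?case using b(2) by (simp add: h_def d_def M_def B_def algebra_simps)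
  }
qed

lemma iter_partial_weight_decay:
  assumes f: "f \<in> schwartz_space_on U" and U: "open U" "U \<noteq> UNIV"
    and k: "k \<in> lists Basis" and n: "N + length k \<le> n"
  shows "\<bar>iter_partial k f y\<bar> \<le> 2 ^ N * 3 ^ Suc n * schwartz_control n f * boundary_weight U y ^ N"
proof -
  define B where "B = 3 ^ Suc n * schwartz_control n f"
  have fS: "f \<in> schwartz_space" using f by (auto simp: schwartz_space_on_def)
  have B: "0 \<le> B" using schwartz_control_nonneg[OF fS] by (simp add: B_def)
  have 1: "\<bar>iter_partial k f y\<bar> \<le> 2 ^ N * B * infdist y (- U) ^ N"
    using iter_partial_dist_decay[OF f U k n, of y] by (simp add: B_def power_mult_distrib mult_ac)
  have "(1 + norm y) ^ N * \<bar>iter_partial k f y\<bar> \<le> (1 + norm y) ^ n * \<bar>iter_partial k f y\<bar>"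
    using n by (intro mult_right_mono power_increasing) auto
  also have "\<dots> \<le> B" unfolding B_def by (rule schwartz_control_upper[OF fS k]) (use n in auto)
  finally have "\<bar>iter_partial k f y\<bar> * (1 + norm y) ^ N \<le> B" by (simp add: mult.commute)
  then have "\<bar>iter_partial k f y\<bar> \<le> B * (1 / (1 + norm y)) ^ N"
    by (simp add: power_divide pos_le_divide_eq add_pos_nonneg)
  also have "1 * (B * (1 / (1 + norm y)) ^ N) \<le> 2 ^ N * (B * (1 / (1 + norm y)) ^ N)"
    using B by (intro mult_right_mono) auto
  then have "B * (1 / (1 + norm y)) ^ N \<le> 2 ^ N * B * (1 / (1 + norm y)) ^ N" by (simp add: mult.assoc)
  finally have "\<bar>iter_partial k f y\<bar> \<le> 2 ^ N * B * (1 / (1 + norm y)) ^ N" .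
  with 1 have "\<bar>iter_partial k f y\<bar> \<le> 2 ^ N * B * boundary_weight U y ^ N"
    by (auto simp: boundary_weight_def min_def)
  then show ?thesis by (simp add: B_def mult.assoc)
qed

lemma boundary_weight_lipschitz: "boundary_weight U z \<le> boundary_weight U x + dist z x"
proof -
  have 1: "infdist z (- U) \<le> infdist x (- U) + dist z x" by (rule infdist_triangle)
  have "1 / (1 + norm z) \<le> 1 / (1 + norm x) + dist z x"
  proof -
    have "(1 + norm x) \<le> (1 + norm z) + dist z x"
      unfolding dist_norm using norm_triangle_ineq3[of z x] by linarith
    also have "\<dots> \<le> (1 + norm z) + dist z x * ((1 + norm x) * (1 + norm z))"
    proof -
      have "1 * 1 \<le> (1 + norm x) * (1 + norm z)" by (intro mult_mono) auto
      then have "dist z x * 1 \<le> dist z x * ((1 + norm x) * (1 + norm z))" by (intro mult_left_mono) auto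
      then show ?thesis by simp
    qed
    finally have "1 + norm x \<le> (1 + norm z) + dist z x * ((1 + norm x) * (1 + norm z))" .
    moreover have "1 / Z \<le> 1 / X + d" if "X \<le> Z + d * (X * Z)" "0 < X" "0 < Z" for X Z d :: real
    proof -
      have e: "1 / Z = X / (X * Z)" "1 / X + d = (Z + d * (X * Z)) / (X * Z)"
        using that by (auto simp: add_divide_distrib)
      show ?thesis unfolding e using that by (intro divide_right_mono) auto
    qed
    ultimately show ?thesis by (simp add: add_pos_nonneg)
  qed
  with 1 show ?thesis unfolding boundary_weight_def by linarith
qed

section \<open>Pullback along holomorphic maps with comparable weights\<close>

text \<open>The two weight bounds do different work. \<open>weight_lower\<close> keeps
  \<open>\<phi> z\<close>, and by Cauchy its derivatives, below a negative power of the weight at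
  \<open>z\<close>; \<open>weight_upper\<close> turns decay in \<open>V\<close> into decay in
  \<open>U\<close>. As decay of every order is available, it beats these losses.\<close>

locale tame_map =
  fixes U V :: "complex set" and \<phi> :: "complex \<Rightarrow> complex" and M :: nat and K :: real
  assumes openU: "open U" "U \<noteq> UNIV" and openV: "open V" "V \<noteq> UNIV"
    and hol: "\<phi> holomorphic_on U" and im: "\<phi> ` U \<subseteq> V" and K: "0 < K"
    and weight_lower: "\<And>z. z \<in> U \<Longrightarrow> boundary_weight U z ^ M \<le> K * boundary_weight V (\<phi> z)"
    and weight_upper: "\<And>z. z \<in> U \<Longrightarrow> boundary_weight V (\<phi> z) ^ M \<le> K * boundary_weight U z"
begin

abbreviation "\<delta> \<equiv> boundary_weight U"

lemma weight_pos: "z \<in> U \<Longrightarrow> 0 < \<delta> z"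
  using boundary_weight_pos openU by blast

lemma norm_phi_le:
  assumes "z \<in> U"
  shows "\<delta> z ^ M * norm (\<phi> z) \<le> K"
proof -
  have "\<delta> z ^ M * norm (\<phi> z) \<le> (K * boundary_weight V (\<phi> z)) * norm (\<phi> z)"
    using weight_lower[OF assms] by (intro mult_right_mono) auto
  also have "\<dots> \<le> K * (boundary_weight V (\<phi> z) * (1 + norm (\<phi> z)))"
    using K boundary_weight_nonneg[of V "\<phi> z"] by (simp add: distrib_left mult.assoc)
  also have "\<dots> \<le> K * 1" using K boundary_weight_mult_norm_le by (intro mult_left_mono) auto
  finally show ?thesis by simp
qed

text \<open>Cauchy's inequality on the circle of radius half the weight: it lies in
  \<open>U\<close>, and by the Lipschitz bound the weight is at least that half on it, so
  \<open>norm_phi_le\<close> applies there.\<close>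

lemma higher_deriv_moderate:
  obtains C where "0 \<le> C" "\<And>z. z \<in> U \<Longrightarrow> \<delta> z ^ (M + n) * norm ((deriv ^^ n) \<phi> z) \<le> C"
proof
  show "0 \<le> fact n * (2 ^ M * K) * 2 ^ n" using K by simp
  fix z assume z: "z \<in> U"
  define r where "r = \<delta> z / 2"
  have r: "0 < r" using weight_pos[OF z] by (simp add: r_def)
  have sub: "cball z r \<subseteq> U"
  proof
    fix x assume "x \<in> cball z r"
    then show "x \<in> U" using boundary_weight_le_dist[of x U z] r by (force simp: r_def)
  qed
  have "norm ((deriv ^^ n) \<phi> z) \<le> fact n * (K / r ^ M) / r ^ n"
  proof (rule Cauchy_inequality[OF _ _ r])
    show "\<phi> holomorphic_on ball z r" using hol sub by (meson ball_subset_cball holomorphic_on_subset)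
    show "continuous_on (cball z r) \<phi>" using hol sub by (meson holomorphic_on_imp_continuous_on holomorphic_on_subset)
    fix x assume x: "norm (z - x) = r"
    then have xU: "x \<in> U" using sub by (auto simp: dist_norm)
    have "r \<le> \<delta> x" using boundary_weight_lipschitz[of U z x] x by (simp add: dist_norm r_def)
    then have "r ^ M * norm (\<phi> x) \<le> \<delta> x ^ M * norm (\<phi> x)"
      using r by (intro mult_right_mono power_mono) auto
    then have "r ^ M * norm (\<phi> x) \<le> K" using norm_phi_le[OF xU] by linarith
    then show "norm (\<phi> x) \<le> K / r ^ M" using r by (simp add: pos_le_divide_eq mult.commute)
  qed
  then have "norm ((deriv ^^ n) \<phi> z) * (r ^ M * r ^ n) \<le> fact n * K"
    using r by (simp add: field_simps)
  then have "2 ^ M * 2 ^ n * (norm ((deriv ^^ n) \<phi> z) * (r ^ M * r ^ n)) \<le> 2 ^ M * 2 ^ n * (fact n * K)"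
    by (intro mult_left_mono) auto
  moreover have "\<delta> z ^ (M + n) = 2 ^ M * 2 ^ n * (r ^ M * r ^ n)"
    by (simp add: r_def power_add power_divide)
  ultimately show "\<delta> z ^ (M + n) * norm ((deriv ^^ n) \<phi> z) \<le> fact n * (2 ^ M * K) * 2 ^ n"
    by (simp add: mult_ac)
qed

text \<open>The smallest algebra of coefficient functions that occurs in the chain rule for \<open>s \<circ> \<phi>\<close>.\<close>

inductive coef :: "(complex \<Rightarrow> real) \<Rightarrow> bool" where
  const: "coef (\<lambda>x. c)"
| deriv: "coef (\<lambda>x. Re (c * (deriv ^^ m) \<phi> x))"
| mult: "coef a \<Longrightarrow> coef b \<Longrightarrow> coef (\<lambda>x. a x * b x)"
| add: "coef a \<Longrightarrow> coef b \<Longrightarrow> coef (\<lambda>x. a x + b x)"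

lemma coef_moderate: "coef a \<Longrightarrow> \<exists>C N. 0 \<le> C \<and> (\<forall>z\<in>U. \<delta> z ^ N * \<bar>a z\<bar> \<le> C)"
proof (induction rule: coef.induct)
  case (const c)
  show ?case by (intro exI[of _ "\<bar>c\<bar>"] exI[of _ 0]) auto
next
  case (deriv c m)
  obtain C where C: "0 \<le> C" "\<And>z. z \<in> U \<Longrightarrow> \<delta> z ^ (M + m) * norm ((deriv ^^ m) \<phi> z) \<le> C"
    using higher_deriv_moderate[of m] by metis
  have "\<delta> z ^ (M + m) * \<bar>Re (c * (deriv ^^ m) \<phi> z)\<bar> \<le> norm c * C" if "z \<in> U" for z
  proof -
    have "\<bar>Re (c * (deriv ^^ m) \<phi> z)\<bar> \<le> norm c * norm ((deriv ^^ m) \<phi> z)"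
      by (metis abs_Re_le_cmod norm_mult)
    then have "\<delta> z ^ (M + m) * \<bar>Re (c * (deriv ^^ m) \<phi> z)\<bar> \<le> \<delta> z ^ (M + m) * (norm c * norm ((deriv ^^ m) \<phi> z))"
      using boundary_weight_nonneg by (intro mult_left_mono) auto
    also have "\<dots> = norm c * (\<delta> z ^ (M + m) * norm ((deriv ^^ m) \<phi> z))" by (simp only: mult_ac)
    also have "\<dots> \<le> norm c * C" using C(2)[OF that] by (intro mult_left_mono) auto
    finally show ?thesis .
  qed
  then show ?case using C(1) by (intro exI[of _ "norm c * C"] exI[of _ "M + m"]) auto
next
  case (mult a b)
  then obtain C1 N1 C2 N2 where C: "0 \<le> C1" "0 \<le> C2" "\<And>z. z\<in>U \<Longrightarrow> \<delta> z ^ N1 * \<bar>a z\<bar> \<le> C1"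
    "\<And>z. z\<in>U \<Longrightarrow> \<delta> z ^ N2 * \<bar>b z\<bar> \<le> C2" by metis
  have "\<delta> z ^ (N1 + N2) * \<bar>a z * b z\<bar> \<le> C1 * C2" if "z \<in> U" for z
  proof -
    have "\<delta> z ^ (N1 + N2) * \<bar>a z * b z\<bar> = (\<delta> z ^ N1 * \<bar>a z\<bar>) * (\<delta> z ^ N2 * \<bar>b z\<bar>)"
      by (simp add: power_add abs_mult)
    also have "\<dots> \<le> C1 * C2"
      using C(1,2) C(3,4)[OF that] boundary_weight_nonneg by (intro mult_mono) auto
    finally show ?thesis .
  qed
  then show ?case using C(1,2) by (intro exI[of _ "C1 * C2"] exI[of _ "N1 + N2"]) auto
next
  case (add a b)
  then obtain C1 N1 C2 N2 where C: "0 \<le> C1" "0 \<le> C2" "\<And>z. z\<in>U \<Longrightarrow> \<delta> z ^ N1 * \<bar>a z\<bar> \<le> C1"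
    "\<And>z. z\<in>U \<Longrightarrow> \<delta> z ^ N2 * \<bar>b z\<bar> \<le> C2" by metis
  have "\<delta> z ^ (N1 + N2) * \<bar>a z + b z\<bar> \<le> C1 + C2" if "z \<in> U" for z
  proof -
    have p: "\<delta> z ^ (N1 + N2) \<le> \<delta> z ^ N1" "\<delta> z ^ (N1 + N2) \<le> \<delta> z ^ N2"
      by (intro power_decreasing boundary_weight_nonneg boundary_weight_le_1, simp)+
    have "\<delta> z ^ (N1 + N2) * \<bar>a z + b z\<bar> \<le> \<delta> z ^ (N1 + N2) * (\<bar>a z\<bar> + \<bar>b z\<bar>)"
      using boundary_weight_nonneg by (intro mult_left_mono) auto
    also have "\<dots> = \<delta> z ^ (N1 + N2) * \<bar>a z\<bar> + \<delta> z ^ (N1 + N2) * \<bar>b z\<bar>" by (rule distrib_left)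
    also have "\<dots> \<le> \<delta> z ^ N1 * \<bar>a z\<bar> + \<delta> z ^ N2 * \<bar>b z\<bar>"
      using p by (intro add_mono mult_right_mono) auto
    finally show ?thesis using C(3,4)[OF that] by linarith
  qed
  then show ?case using C(1,2) by (intro exI[of _ "C1 + C2"] exI[of _ "N1 + N2"]) auto
qed

lemma higher_deriv_has_derivative:
  assumes "x \<in> U"
  shows "((deriv ^^ m) \<phi> has_derivative (\<lambda>v. (deriv ^^ Suc m) \<phi> x * v)) (at x)"
proof -
  have "(deriv ^^ m) \<phi> holomorphic_on U" by (rule holomorphic_higher_deriv[OF hol openU(1)])
  then have "((deriv ^^ m) \<phi> has_field_derivative deriv ((deriv ^^ m) \<phi>) x) (at x)"
    using holomorphic_derivI openU(1) assms by blast
  then show ?thesis by (simp add: has_field_derivative_def)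
qed

text \<open>The class is closed under differentiation because \<open>\<phi>\<close> is holomorphic:
  passing to the direction \<open>\<i>\<close> multiplies the complex derivative by
  \<open>\<i>\<close>, which the free constant \<open>c\<close> absorbs.\<close>

lemma coef_has_derivative:
  "coef a \<Longrightarrow> \<exists>a1 a2. coef a1 \<and> coef a2 \<and>
    (\<forall>x\<in>U. (a has_derivative (\<lambda>v. Re v * a1 x + Im v * a2 x)) (at x))"
proof (induction rule: coef.induct)
  case (const c)
  show ?case by (intro exI[of _ "\<lambda>x. 0"] conjI ballI coef.const) auto
next
  case (deriv c m)
  have "((\<lambda>x. Re (c * (deriv ^^ m) \<phi> x)) has_derivative
      (\<lambda>v. Re v * Re (c * (deriv ^^ Suc m) \<phi> x) + Im v * Re ((c * \<i>) * (deriv ^^ Suc m) \<phi> x))) (at x)"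
    if x: "x \<in> U" for x
  proof -
    have "((\<lambda>x. Re (c * (deriv ^^ m) \<phi> x)) has_derivative (\<lambda>v. Re (c * ((deriv ^^ Suc m) \<phi> x * v)))) (at x)"
      by (intro has_derivative_Re has_derivative_mult_right higher_deriv_has_derivative x)
    moreover have "(\<lambda>v. Re (c * ((deriv ^^ Suc m) \<phi> x * v))) =
      (\<lambda>v. Re v * Re (c * (deriv ^^ Suc m) \<phi> x) + Im v * Re ((c * \<i>) * (deriv ^^ Suc m) \<phi> x))"
      by (rule ext) (simp add: algebra_simps)
    ultimately show ?thesis by metis
  qed
  then show ?case
    by (intro exI[of _ "\<lambda>x. Re (c * (deriv ^^ Suc m) \<phi> x)"] exI[of _ "\<lambda>x. Re ((c * \<i>) * (deriv ^^ Suc m) \<phi> x)"]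
      conjI ballI coef.deriv)
next
  case (mult a b)
  from mult.IH(1) obtain a1 a2 where a: "coef a1" "coef a2"
    "\<forall>x\<in>U. (a has_derivative (\<lambda>v. Re v * a1 x + Im v * a2 x)) (at x)" by (elim exE conjE)
  from mult.IH(2) obtain b1 b2 where b: "coef b1" "coef b2"
    "\<forall>x\<in>U. (b has_derivative (\<lambda>v. Re v * b1 x + Im v * b2 x)) (at x)" by (elim exE conjE)
  note ab = a(1,2) b(1,2) bspec[OF a(3)] bspec[OF b(3)]
  have "((\<lambda>x. a x * b x) has_derivative
      (\<lambda>v. Re v * (a1 x * b x + a x * b1 x) + Im v * (a2 x * b x + a x * b2 x))) (at x)" if "x \<in> U" for x
    by (rule has_derivative_eq_rhs[OF has_derivative_mult[OF ab(5)[OF that] ab(6)[OF that]]])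
      (auto simp: algebra_simps)
  then show ?case
    by (intro exI[of _ "\<lambda>x. a1 x * b x + a x * b1 x"] exI[of _ "\<lambda>x. a2 x * b x + a x * b2 x"]
      conjI ballI coef.add coef.mult ab mult.hyps)
next
  case (add a b)
  from add.IH(1) obtain a1 a2 where a: "coef a1" "coef a2"
    "\<forall>x\<in>U. (a has_derivative (\<lambda>v. Re v * a1 x + Im v * a2 x)) (at x)" by (elim exE conjE)
  from add.IH(2) obtain b1 b2 where b: "coef b1" "coef b2"
    "\<forall>x\<in>U. (b has_derivative (\<lambda>v. Re v * b1 x + Im v * b2 x)) (at x)" by (elim exE conjE)
  note ab = a(1,2) b(1,2) bspec[OF a(3)] bspec[OF b(3)]
  have "((\<lambda>x. a x + b x) has_derivative
      (\<lambda>v. Re v * (a1 x + b1 x) + Im v * (a2 x + b2 x))) (at x)" if "x \<in> U" for x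
    by (rule has_derivative_eq_rhs[OF has_derivative_add[OF ab(5)[OF that] ab(6)[OF that]]])
      (auto simp: algebra_simps)
  then show ?case
    by (intro exI[of _ "\<lambda>x. a1 x + b1 x"] exI[of _ "\<lambda>x. a2 x + b2 x"] conjI ballI coef.add ab)
qed

text \<open>The operators that arise by differentiating \<open>s \<mapsto> s \<circ> \<phi>\<close> repeatedly.\<close>

inductive oper :: "((complex \<Rightarrow> real) \<Rightarrow> complex \<Rightarrow> real) \<Rightarrow> bool" where
  base: "coef a \<Longrightarrow> j \<in> lists Basis \<Longrightarrow> oper (\<lambda>s x. a x * iter_partial j s (\<phi> x))"
| sum: "oper L \<Longrightarrow> oper L' \<Longrightarrow> oper (\<lambda>s x. L s x + L' s x)"

lemma oper_has_derivative:
  "oper L \<Longrightarrow> \<exists>L1 L2. oper L1 \<and> oper L2 \<and>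
    (\<forall>s. smooth_on UNIV s \<longrightarrow> (\<forall>x\<in>U. (L s has_derivative (\<lambda>v. Re v * L1 s x + Im v * L2 s x)) (at x)))"
proof (induction rule: oper.induct)
  case (base a j)
  from coef_has_derivative[OF base(1)] obtain a1 a2 where a: "coef a1" "coef a2"
    "\<forall>x\<in>U. (a has_derivative (\<lambda>v. Re v * a1 x + Im v * a2 x)) (at x)" by (elim exE conjE)
  have j: "1 # j \<in> lists Basis" "\<i> # j \<in> lists Basis" using base(2) by (auto simp: Basis_complex_def)
  \<comment> \<open>\<open>D 1\<close> is the real part of the derivative of \<open>\<phi>\<close>,
    \<open>D (-\<i>)\<close> its imaginary part and \<open>D \<i>\<close> the negative of that: the
    entries of the real Jacobian matrix.\<close>
  define D where "D = (\<lambda>c x. Re (c * (deriv ^^ Suc 0) \<phi> x))"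
  have D: "coef (D c)" for c unfolding D_def by (rule coef.deriv)
  define L1 where "L1 = (\<lambda>s x. a1 x * iter_partial j s (\<phi> x) +
    (a x * D 1 x * iter_partial (1 # j) s (\<phi> x) + a x * D (-\<i>) x * iter_partial (\<i> # j) s (\<phi> x)))"
  define L2 where "L2 = (\<lambda>s x. a2 x * iter_partial j s (\<phi> x) +
    (a x * D \<i> x * iter_partial (1 # j) s (\<phi> x) + a x * D 1 x * iter_partial (\<i> # j) s (\<phi> x)))"
  have "oper L1" "oper L2" unfolding L1_def L2_def
    by (intro oper.sum oper.base coef.mult a D j base)+
  moreover have "((\<lambda>x. a x * iter_partial j s (\<phi> x)) has_derivative (\<lambda>v. Re v * L1 s x + Im v * L2 s x)) (at x)"
    if s: "smooth_on UNIV s" and x: "x \<in> U" for s x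
  proof -
    have dif: "iter_partial j s differentiable at (\<phi> x)" using smooth_onD[OF s base(2)] by simp
    have "(\<phi> has_derivative (\<lambda>v. (deriv ^^ Suc 0) \<phi> x * v)) (at x)"
      using higher_deriv_has_derivative[OF x, of 0] by simp
    from diff_chain_at[OF this has_derivative_complex_partials[OF dif]]
    have c: "((\<lambda>x. iter_partial j s (\<phi> x)) has_derivative
      (\<lambda>v. Re ((deriv ^^ Suc 0) \<phi> x * v) * iter_partial (1 # j) s (\<phi> x) +
        Im ((deriv ^^ Suc 0) \<phi> x * v) * iter_partial (\<i> # j) s (\<phi> x))) (at x)"
      by (simp add: o_def)
    show ?thesis
      by (rule has_derivative_eq_rhs[OF has_derivative_mult[OF bspec[OF a(3) x] c]])
        (auto simp: L1_def L2_def D_def algebra_simps)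
  qed
  ultimately show ?case by (intro exI[of _ L1] exI[of _ L2] conjI allI impI ballI)
next
  case (sum L L')
  from sum.IH(1) obtain L1 L2 where L1: "oper L1" "oper L2"
    "\<forall>s. smooth_on UNIV s \<longrightarrow> (\<forall>x\<in>U. (L s has_derivative (\<lambda>v. Re v * L1 s x + Im v * L2 s x)) (at x))"
    by (elim exE conjE)
  from sum.IH(2) obtain L1' L2' where L2: "oper L1'" "oper L2'"
    "\<forall>s. smooth_on UNIV s \<longrightarrow> (\<forall>x\<in>U. (L' s has_derivative (\<lambda>v. Re v * L1' s x + Im v * L2' s x)) (at x))"
    by (elim exE conjE)
  note L = L1(1,2) L2(1,2) bspec[OF mp[OF spec[OF L1(3)]]] bspec[OF mp[OF spec[OF L2(3)]]]
  have "((\<lambda>x. L s x + L' s x) has_derivative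
      (\<lambda>v. Re v * (L1 s x + L1' s x) + Im v * (L2 s x + L2' s x))) (at x)"
    if "smooth_on UNIV s" "x \<in> U" for s x
    by (rule has_derivative_eq_rhs[OF has_derivative_add[OF L(5)[OF that] L(6)[OF that]]])
      (auto simp: algebra_simps)
  then show ?case
    by (intro exI[of _ "\<lambda>s x. L1 s x + L1' s x"] exI[of _ "\<lambda>s x. L2 s x + L2' s x"] conjI allI impI ballI oper.sum L)
qed

text \<open>Every order \<open>N\<close> is reached by starting with a higher one in
  \<open>V\<close>: order \<open>M * (N + N1)\<close> there becomes order \<open>N + N1\<close> in
  \<open>U\<close>, of which \<open>N1\<close> is spent on the growth of the coefficient.\<close>

lemma oper_decay:
  "oper L \<Longrightarrow> \<exists>C n. 0 \<le> C \<and> (\<forall>s\<in>schwartz_space_on V. \<forall>x\<in>U. \<bar>L s x\<bar> \<le> C * schwartz_control n s * \<delta> x ^ N)"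
proof (induction rule: oper.induct)
  case (base a j)
  from coef_moderate[OF base(1)] obtain C N1 where C: "0 \<le> C" "\<forall>z\<in>U. \<delta> z ^ N1 * \<bar>a z\<bar> \<le> C"
    by (elim exE conjE)
  define n where "n = M * (N + N1) + length j"
  define c where "c = 2 ^ (M * (N + N1)) * 3 ^ Suc n * K ^ (N + N1)"
  have c0: "0 \<le> c" using K by (simp add: c_def)
  have "\<bar>a x * iter_partial j s (\<phi> x)\<bar> \<le> (C * c) * schwartz_control n s * \<delta> x ^ N"
    if s: "s \<in> schwartz_space_on V" and x: "x \<in> U" for s x
  proof -
    define Q where "Q = schwartz_control n s"
    have Q: "0 \<le> Q" unfolding Q_def
      by (rule schwartz_control_nonneg) (use s in \<open>simp add: schwartz_space_on_def\<close>)
    have d: "0 < \<delta> x" by (rule weight_pos[OF x])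
    have "\<bar>iter_partial j s (\<phi> x)\<bar> \<le> 2 ^ (M * (N + N1)) * 3 ^ Suc n * Q * boundary_weight V (\<phi> x) ^ (M * (N + N1))"
      unfolding Q_def by (rule iter_partial_weight_decay[OF s openV base(2)]) (simp add: n_def)
    also have "boundary_weight V (\<phi> x) ^ (M * (N + N1)) \<le> (K * \<delta> x) ^ (N + N1)"
      unfolding power_mult using weight_upper[OF x] boundary_weight_nonneg by (intro power_mono) auto
    then have "2 ^ (M * (N + N1)) * 3 ^ Suc n * Q * boundary_weight V (\<phi> x) ^ (M * (N + N1))
      \<le> 2 ^ (M * (N + N1)) * 3 ^ Suc n * Q * (K * \<delta> x) ^ (N + N1)"
      using Q by (intro mult_left_mono) auto
    also have "\<dots> = c * Q * (\<delta> x ^ N * \<delta> x ^ N1)"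
      by (simp add: c_def power_mult_distrib power_add mult_ac)
    finally have "\<bar>iter_partial j s (\<phi> x)\<bar> \<le> c * Q * (\<delta> x ^ N * \<delta> x ^ N1)" .
    then have "\<bar>a x\<bar> * \<bar>iter_partial j s (\<phi> x)\<bar> \<le> \<bar>a x\<bar> * (c * Q * (\<delta> x ^ N * \<delta> x ^ N1))"
      by (intro mult_left_mono) auto
    also have "\<dots> = (\<delta> x ^ N1 * \<bar>a x\<bar>) * (c * Q * \<delta> x ^ N)" by (simp add: mult_ac)
    also have "\<dots> \<le> C * (c * Q * \<delta> x ^ N)"
      using bspec[OF C(2) x] c0 Q d by (intro mult_right_mono) auto
    finally show ?thesis by (simp add: Q_def abs_mult mult_ac)
  qed
  then show ?case using C(1) c0 by (intro exI[of _ "C * c"] exI[of _ n] conjI ballI) auto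
next
  case (sum L L')
  from sum.IH(1) obtain C1 n1 where 1: "0 \<le> C1"
    "\<forall>s\<in>schwartz_space_on V. \<forall>x\<in>U. \<bar>L s x\<bar> \<le> C1 * schwartz_control n1 s * \<delta> x ^ N" by (elim exE conjE)
  from sum.IH(2) obtain C2 n2 where 2: "0 \<le> C2"
    "\<forall>s\<in>schwartz_space_on V. \<forall>x\<in>U. \<bar>L' s x\<bar> \<le> C2 * schwartz_control n2 s * \<delta> x ^ N" by (elim exE conjE)
  have "\<bar>L s x + L' s x\<bar> \<le> (C1 + C2) * schwartz_control (max n1 n2) s * \<delta> x ^ N"
    if s: "s \<in> schwartz_space_on V" and x: "x \<in> U" for s x
  proof -
    have S: "s \<in> schwartz_space" using s by (simp add: schwartz_space_on_def)
    have d: "0 \<le> \<delta> x ^ N" using boundary_weight_nonneg by simp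
    have "\<bar>L s x\<bar> \<le> C1 * schwartz_control n1 s * \<delta> x ^ N" using 1(2) s x by blast
    also have "\<dots> \<le> C1 * schwartz_control (max n1 n2) s * \<delta> x ^ N"
      using d 1(1) by (intro mult_right_mono mult_left_mono schwartz_control_mono S) auto
    finally have a: "\<bar>L s x\<bar> \<le> C1 * schwartz_control (max n1 n2) s * \<delta> x ^ N" .
    have "\<bar>L' s x\<bar> \<le> C2 * schwartz_control n2 s * \<delta> x ^ N" using 2(2) s x by blast
    also have "\<dots> \<le> C2 * schwartz_control (max n1 n2) s * \<delta> x ^ N"
      using d 2(1) by (intro mult_right_mono mult_left_mono schwartz_control_mono S) auto
    finally have b: "\<bar>L' s x\<bar> \<le> C2 * schwartz_control (max n1 n2) s * \<delta> x ^ N" .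
    have "\<bar>L s x + L' s x\<bar> \<le> \<bar>L s x\<bar> + \<bar>L' s x\<bar>" by (rule abs_triangle_ineq)
    with a b show ?thesis by (simp add: algebra_simps)
  qed
  then show ?case using 1(1) 2(1) by (intro exI[of _ "C1 + C2"] exI[of _ "max n1 n2"] conjI ballI) auto
qed

text \<open>Off \<open>U\<close>, decay of order 2 suffices, because the weight at \<open>y\<close>
  is at most the distance from \<open>y\<close> to the point considered. The partial derivatives are
  again extensions by zero of operators of the same kind, so the step can be iterated.\<close>

lemma oper_extension_has_derivative:
  assumes "oper L"
  shows "\<exists>L1 L2. oper L1 \<and> oper L2 \<and> (\<forall>s\<in>schwartz_space_on V. \<forall>x.
    ((\<lambda>x. if x \<in> U then L s x else 0) has_derivative
      (\<lambda>v. if x \<in> U then Re v * L1 s x + Im v * L2 s x else 0)) (at x))"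
proof -
  from oper_has_derivative[OF assms] obtain L1 L2 where L: "oper L1" "oper L2"
    "\<forall>s. smooth_on UNIV s \<longrightarrow> (\<forall>x\<in>U. (L s has_derivative (\<lambda>v. Re v * L1 s x + Im v * L2 s x)) (at x))"
    by (elim exE conjE)
  from oper_decay[OF assms, of 2] obtain C n where C: "0 \<le> C"
    "\<forall>s\<in>schwartz_space_on V. \<forall>x\<in>U. \<bar>L s x\<bar> \<le> C * schwartz_control n s * \<delta> x ^ 2" by (elim exE conjE)
  have "((\<lambda>x. if x \<in> U then L s x else 0) has_derivative
      (\<lambda>v. if x \<in> U then Re v * L1 s x + Im v * L2 s x else 0)) (at x)"
    if s: "s \<in> schwartz_space_on V" for s x
  proof (cases "x \<in> U")
    case True
    have "smooth_on UNIV s" using s by (simp add: schwartz_space_on_def schwartz_space_def)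
    then have "(L s has_derivative (\<lambda>v. Re v * L1 s x + Im v * L2 s x)) (at x)" using L(3) True by blast
    then have "((\<lambda>x. if x \<in> U then L s x else 0) has_derivative (\<lambda>v. Re v * L1 s x + Im v * L2 s x)) (at x)"
      by (rule has_derivative_transform_within_open[OF _ openU(1) True]) simp
    then show ?thesis using True by simp
  next
    case False
    have S: "s \<in> schwartz_space" using s by (simp add: schwartz_space_on_def)
    have "norm (if y \<in> U then L s y else 0) \<le> C * schwartz_control n s * (norm (y - x))\<^sup>2" for y
    proof (cases "y \<in> U")
      case True
      have "\<bar>L s y\<bar> \<le> C * schwartz_control n s * \<delta> y ^ 2" using C(2) s True by blast
      also have "\<dots> \<le> C * schwartz_control n s * (norm (y - x))\<^sup>2"
        using boundary_weight_le_dist[OF False, of y] boundary_weight_nonneg[of U y] C(1) schwartz_control_nonneg[OF S]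
        by (intro mult_left_mono power_mono) (auto simp: dist_norm)
      finally show ?thesis using True by simp
    qed (use C(1) schwartz_control_nonneg[OF S] in simp)
    then have "((\<lambda>x. if x \<in> U then L s x else 0) has_derivative (\<lambda>_. 0)) (at x)"
      by (rule has_derivative_zero_if_quadratic[rotated]) (use False in simp)
    then show ?thesis using False by simp
  qed
  then show ?thesis by (intro exI[of _ L1] exI[of _ L2] conjI ballI allI L(1,2))
qed

text \<open>The operator depends on \<open>k\<close> alone and is fixed before \<open>s\<close>;
  this uniformity later yields one semi-norm estimate for all \<open>s\<close>, that is,
  continuity.\<close>

lemma iter_partial_pullback:
  "k \<in> lists Basis \<Longrightarrow> \<exists>L. oper L \<and>
    (\<forall>s\<in>schwartz_space_on V. iter_partial k (schwartz_pullback U \<phi> s) = (\<lambda>x. if x \<in> U then L s x else 0))"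
proof (induction k)
  case Nil
  have "oper (\<lambda>s x. 1 * iter_partial [] s (\<phi> x))" by (rule oper.base[OF coef.const]) simp
  then show ?case by (intro exI[of _ "\<lambda>s x. 1 * iter_partial [] s (\<phi> x)"]) (auto simp: schwartz_pullback_def)
next
  case (Cons b k)
  then have k: "k \<in> lists Basis" and b: "b \<in> Basis" by auto
  from Cons.IH[OF k] obtain L where L: "oper L"
    "\<forall>s\<in>schwartz_space_on V. iter_partial k (schwartz_pullback U \<phi> s) = (\<lambda>x. if x \<in> U then L s x else 0)"
    by (elim exE conjE)
  from oper_extension_has_derivative[OF L(1)] obtain L1 L2 where L12: "oper L1" "oper L2"
    "\<forall>s\<in>schwartz_space_on V. \<forall>x. ((\<lambda>x. if x \<in> U then L s x else 0) has_derivative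
      (\<lambda>v. if x \<in> U then Re v * L1 s x + Im v * L2 s x else 0)) (at x)" by (elim exE conjE)
  define L' where "L' = (if b = 1 then L1 else L2)"
  have "iter_partial (b # k) (schwartz_pullback U \<phi> s) = (\<lambda>x. if x \<in> U then L' s x else 0)"
    if s: "s \<in> schwartz_space_on V" for s
  proof
    fix x
    have "frechet_derivative (\<lambda>x. if x \<in> U then L s x else 0) (at x) =
        (\<lambda>v. if x \<in> U then Re v * L1 s x + Im v * L2 s x else 0)"
      by (rule frechet_derivative_at[symmetric]) (use L12(3) s in blast)
    then show "iter_partial (b # k) (schwartz_pullback U \<phi> s) x = (if x \<in> U then L' s x else 0)"
      using b bspec[OF L(2) s] by (auto simp: L'_def Basis_complex_def)
  qed
  moreover have "oper L'" using L12 by (simp add: L'_def)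
  ultimately show ?case by blast
qed

lemma pullback_differentiable:
  assumes k: "k \<in> lists Basis" and s: "s \<in> schwartz_space_on V"
  shows "iter_partial k (schwartz_pullback U \<phi> s) differentiable at x"
proof -
  from iter_partial_pullback[OF k] obtain L where L: "oper L"
    "\<forall>s\<in>schwartz_space_on V. iter_partial k (schwartz_pullback U \<phi> s) = (\<lambda>x. if x \<in> U then L s x else 0)"
    by (elim exE conjE)
  from oper_extension_has_derivative[OF L(1)] obtain L1 L2 where L12: "oper L1" "oper L2"
    "\<forall>s\<in>schwartz_space_on V. \<forall>x. ((\<lambda>x. if x \<in> U then L s x else 0) has_derivative
      (\<lambda>v. if x \<in> U then Re v * L1 s x + Im v * L2 s x else 0)) (at x)" by (elim exE conjE)
  show ?thesis unfolding bspec[OF L(2) s] differentiable_def using L12(3) s by blast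
qed

lemma pullback_bound:
  assumes k: "k \<in> lists Basis"
  shows "\<exists>C n. 0 \<le> C \<and> (\<forall>s\<in>schwartz_space_on V. \<forall>x.
    \<bar>monomial l x * iter_partial k (schwartz_pullback U \<phi> s) x\<bar> \<le> C * schwartz_control n s)"
proof -
  from iter_partial_pullback[OF k] obtain L where L: "oper L"
    "\<forall>s\<in>schwartz_space_on V. iter_partial k (schwartz_pullback U \<phi> s) = (\<lambda>x. if x \<in> U then L s x else 0)"
    by (elim exE conjE)
  \<comment> \<open>The degree of the monomial: since
    \<open>\<delta> x * (1 + norm x) \<le> 1\<close>, that many powers of the weight absorb
    it.\<close>
  define N where "N = l 1 + l \<i>"
  from oper_decay[OF L(1), of N] obtain C n where C: "0 \<le> C"
    "\<forall>s\<in>schwartz_space_on V. \<forall>x\<in>U. \<bar>L s x\<bar> \<le> C * schwartz_control n s * \<delta> x ^ N" by (elim exE conjE)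
  have "\<bar>monomial l x * iter_partial k (schwartz_pullback U \<phi> s) x\<bar> \<le> C * schwartz_control n s"
    if s: "s \<in> schwartz_space_on V" for s x
  proof -
    have CQ: "0 \<le> C * schwartz_control n s"
      using C(1) schwartz_control_nonneg[of s n] s by (simp add: schwartz_space_on_def)
    show ?thesis
    proof (cases "x \<in> U")
      case True
      have "\<bar>Re x\<bar> \<le> 1 + norm x" "\<bar>Im x\<bar> \<le> 1 + norm x"
        using abs_Re_le_cmod[of x] abs_Im_le_cmod[of x] by auto
      then have "\<bar>Re x\<bar> ^ l 1 * \<bar>Im x\<bar> ^ l \<i> \<le> (1 + norm x) ^ l 1 * (1 + norm x) ^ l \<i>"
        by (intro mult_mono power_mono) auto
      then have m: "\<bar>monomial l x\<bar> \<le> (1 + norm x) ^ N"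
        by (simp add: monomial_complex abs_mult power_abs N_def power_add)
      have "\<bar>monomial l x\<bar> * \<bar>L s x\<bar> \<le> (1 + norm x) ^ N * (C * schwartz_control n s * \<delta> x ^ N)"
        using m C(2) s True by (intro mult_mono) auto
      also have "\<dots> = (\<delta> x * (1 + norm x)) ^ N * (C * schwartz_control n s)"
        by (simp add: power_mult_distrib mult_ac)
      also have "\<dots> \<le> 1 * (C * schwartz_control n s)"
        using boundary_weight_mult_norm_le[of U x] boundary_weight_nonneg[of U x] CQ
        by (intro mult_right_mono power_le_one) auto
      finally show ?thesis using True by (simp add: bspec[OF L(2) s] abs_mult)
    qed (use CQ bspec[OF L(2) s] in simp)
  qed
  then show ?thesis using C(1) by (intro exI[of _ C] exI[of _ n] conjI ballI allI)
qed

lemma pullback_in_schwartz_space_on: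
  assumes s: "s \<in> schwartz_space_on V"
  shows "schwartz_pullback U \<phi> s \<in> schwartz_space_on U"
proof -
  have bdd: "bdd_above (range (\<lambda>x. \<bar>monomial l x * iter_partial k (schwartz_pullback U \<phi> s) x\<bar>))"
    if k: "k \<in> lists Basis" for l k
  proof -
    from pullback_bound[OF k, of l] obtain C n where "0 \<le> C" "\<forall>s\<in>schwartz_space_on V. \<forall>x.
      \<bar>monomial l x * iter_partial k (schwartz_pullback U \<phi> s) x\<bar> \<le> C * schwartz_control n s" by (elim exE conjE)
    then show ?thesis using s by (intro bdd_aboveI2[of _ _ "C * schwartz_control n s"]) blast
  qed
  have "iter_partial k (schwartz_pullback U \<phi> s) x = 0" if k: "k \<in> lists Basis" and x: "x \<in> - U" for k x
  proof -
    from iter_partial_pullback[OF k] obtain L where L: "oper L"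
      "\<forall>s\<in>schwartz_space_on V. iter_partial k (schwartz_pullback U \<phi> s) = (\<lambda>x. if x \<in> U then L s x else 0)"
      by (elim exE conjE)
    show ?thesis unfolding bspec[OF L(2) s] using x by simp
  qed
  moreover have "smooth_on UNIV (schwartz_pullback U \<phi> s)"
    unfolding smooth_on_def using pullback_differentiable s by blast
  ultimately show ?thesis unfolding schwartz_space_on_def schwartz_space_def
    using bdd by (intro CollectI conjI ballI allI)
qed

lemma continuous_map_pullback:
  "continuous_map (schwartz_topology_on V) (schwartz_topology_on U) (schwartz_pullback U \<phi>)"
proof (rule continuous_map_schwartz)
  show "schwartz_pullback U \<phi> (\<lambda>x. s x - t x) = (\<lambda>x. schwartz_pullback U \<phi> s x - schwartz_pullback U \<phi> t x)" for s t
    by (auto simp: schwartz_pullback_def)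
  fix l :: "complex \<Rightarrow> nat" and k :: "complex list" assume k: "k \<in> lists Basis"
  from pullback_bound[OF k, of l] obtain C n where C: "0 \<le> C" "\<forall>s\<in>schwartz_space_on V. \<forall>x.
    \<bar>monomial l x * iter_partial k (schwartz_pullback U \<phi> s) x\<bar> \<le> C * schwartz_control n s" by (elim exE conjE)
  have "schwartz_seminorm l k (schwartz_pullback U \<phi> s) \<le> C * (\<Sum>(l', k')\<in>control_indices n. schwartz_seminorm l' k' s)"
    if "s \<in> schwartz_space_on V" for s
    unfolding schwartz_control_def[symmetric] by (rule schwartz_seminorm_least) (use C(2) that in blast)
  then show "\<exists>A C. finite A \<and> A \<subseteq> UNIV \<times> lists Basis \<and> 0 \<le> C \<and>
      (\<forall>s\<in>schwartz_space_on V. schwartz_seminorm l k (schwartz_pullback U \<phi> s) \<le> C * (\<Sum>(l', k')\<in>A. schwartz_seminorm l' k' s))"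
    by (intro exI[of _ "control_indices n"] exI[of _ C] conjI ballI finite_control_indices control_indices_subset C(1))
qed (rule pullback_in_schwartz_space_on)

text \<open>By complex differentiability the partial derivative along \<open>b\<close> is the
  complex derivative times \<open>b\<close>, so each iterated one is a constant multiple of a
  complex derivative.\<close>

lemma smooth_on_phi: "smooth_on U \<phi>"
proof -
  have "\<exists>c. \<forall>x\<in>U. iter_partial k \<phi> x = c * (deriv ^^ length k) \<phi> x" for k
  proof (induction k)
    case Nil
    show ?case by (intro exI[of _ 1]) simp
  next
    case (Cons b k)
    then obtain c where c: "\<forall>x\<in>U. iter_partial k \<phi> x = c * (deriv ^^ length k) \<phi> x" by blast
    have "iter_partial (b # k) \<phi> x = (c * b) * (deriv ^^ length (b # k)) \<phi> x" if x: "x \<in> U" for x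
    proof -
      have "frechet_derivative (iter_partial k \<phi>) (at x) = frechet_derivative (\<lambda>x. c * (deriv ^^ length k) \<phi> x) (at x)"
        by (rule frechet_derivative_cong_open[OF openU(1) x]) (use c in blast)
      also have "\<dots> = (\<lambda>v. c * ((deriv ^^ Suc (length k)) \<phi> x * v))"
        by (rule frechet_derivative_at[symmetric])
          (intro has_derivative_mult_right higher_deriv_has_derivative x)
      finally show ?thesis by (simp add: mult_ac)
    qed
    then show ?case by blast
  qed
  then have ex: "\<exists>c. \<forall>x\<in>U. iter_partial k \<phi> x = c * (deriv ^^ length k) \<phi> x" for k .
  show ?thesis unfolding smooth_on_def
  proof (intro ballI)
    fix k :: "complex list" and x assume x: "x \<in> U"
    from ex obtain c where c: "\<forall>x\<in>U. iter_partial k \<phi> x = c * (deriv ^^ length k) \<phi> x" by blast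
    have "((\<lambda>x. c * (deriv ^^ length k) \<phi> x) has_derivative (\<lambda>v. c * ((deriv ^^ Suc (length k)) \<phi> x * v))) (at x)"
      by (intro has_derivative_mult_right higher_deriv_has_derivative x)
    then have "(iter_partial k \<phi> has_derivative (\<lambda>v. c * ((deriv ^^ Suc (length k)) \<phi> x * v))) (at x)"
      by (rule has_derivative_transform_within_open[OF _ openU(1) x]) (use c in simp)
    then show "iter_partial k \<phi> differentiable at x" unfolding differentiable_def by blast
  qed
qed

end

lemma schwartz_equivalent_if_tame:
  assumes \<phi>: "tame_map U V \<phi> M K" and \<psi>: "tame_map V U \<psi> M' K'"
    and inv: "\<And>z. z \<in> U \<Longrightarrow> \<psi> (\<phi> z) = z" "\<And>w. w \<in> V \<Longrightarrow> \<phi> (\<psi> w) = w"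
  shows "schwartz_equivalent U V"
proof -
  interpret f: tame_map U V \<phi> M K by (rule \<phi>)
  interpret g: tame_map V U \<psi> M' K' by (rule \<psi>)
  have bij: "bij_betw \<phi> U V"
    by (rule bij_betw_byWitness[of _ \<psi>]) (use inv f.im g.im in auto)
  have invV: "\<psi> w = inv_into U \<phi> w" if "w \<in> V" for w
    using that bij inv g.im by (metis bij_betw_inv_into_left image_subset_iff)
  have "smooth_on V (inv_into U \<phi>)"
    by (rule smooth_on_cong_open[OF f.openV(1) invV g.smooth_on_phi])
  then have diff: "diffeomorphism_between U V \<phi>"
    unfolding diffeomorphism_between_def using bij f.smooth_on_phi by blast
  \<comment> \<open>A double pullback is 0 off the domain by definition, so it returns
    \<open>s\<close> only because \<open>s\<close> vanishes there too, the case of the empty list of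
    derivatives.\<close>
  have zero: "s x = 0" if "s \<in> schwartz_space_on W" "x \<notin> W" for s x and W :: "complex set"
  proof -
    have "\<forall>k\<in>lists Basis. \<forall>x\<in>- W. iter_partial k s x = 0" using that(1) by (simp add: schwartz_space_on_def)
    then have "iter_partial [] s x = 0" using that(2) by blast
    then show ?thesis by simp
  qed
  have "homeomorphic_maps (schwartz_topology_on V) (schwartz_topology_on U)
      (schwartz_pullback U \<phi>) (schwartz_pullback V \<psi>)"
    unfolding homeomorphic_maps_def topspace_schwartz_topology_on
  proof (intro conjI ballI f.continuous_map_pullback g.continuous_map_pullback)
    fix s assume s: "s \<in> schwartz_space_on V"
    show "schwartz_pullback V \<psi> (schwartz_pullback U \<phi> s) = s"
      using zero[OF s] inv g.im by (auto simp: schwartz_pullback_def fun_eq_iff)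
  next
    fix s assume s: "s \<in> schwartz_space_on U"
    show "schwartz_pullback U \<phi> (schwartz_pullback V \<psi> s) = s"
      using zero[OF s] inv f.im by (auto simp: schwartz_pullback_def fun_eq_iff)
  qed
  then have "homeomorphic_map (schwartz_topology_on V) (schwartz_topology_on U) (schwartz_pullback U \<phi>)"
    unfolding homeomorphic_map_maps by blast
  then have "frechet_isomorphism V U (schwartz_pullback U \<phi>)"
    unfolding frechet_isomorphism_def by (auto simp: schwartz_pullback_def fun_eq_iff)
  then show ?thesis unfolding schwartz_equivalent_def using f.openU f.openV diff by blast
qed

section \<open>Quasidiscs are Schwartz equivalent\<close>

text \<open>\<open>1 - norm (f z)\<close> is the common middle term, so exponents multiply. The
  constants of the two directions are added because \<open>tame_map\<close> asks for a single
  one.\<close>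

lemma tame_map_between_quasidiscs:
  assumes U: "quasidisc U" and V: "quasidisc V"
    and fU: "f holomorphic_on U" "f ` U \<subseteq> ball 0 1" and gV: "g holomorphic_on ball 0 1" "g ` ball 0 1 \<subseteq> V"
    and K: "0 < K" "0 < K'"
    and fl: "\<And>z. z \<in> U \<Longrightarrow> boundary_weight U z ^ M \<le> K * (1 - norm (f z))"
    and fu: "\<And>z. z \<in> U \<Longrightarrow> (1 - norm (f z)) ^ M \<le> K * boundary_weight U z"
    and gl: "\<And>w. w \<in> ball 0 1 \<Longrightarrow> (1 - norm w) ^ M' \<le> K' * boundary_weight V (g w)"
    and gu: "\<And>w. w \<in> ball 0 1 \<Longrightarrow> boundary_weight V (g w) ^ M' \<le> K' * (1 - norm w)"
  shows "tame_map U V (\<lambda>z. g (f z)) (M * M') (K ^ M' * K' + K' ^ M * K)"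
proof
  show "open U" "open V" using U V by (auto simp: quasidisc_def)
  show "U \<noteq> UNIV" "V \<noteq> UNIV" using quasidisc_frontier_nonempty[OF U] quasidisc_frontier_nonempty[OF V] by auto
  show "(\<lambda>z. g (f z)) holomorphic_on U"
    by (rule holomorphic_on_compose_gen[OF fU(1) gV(1), unfolded o_def]) (use fU in auto)
  show "(\<lambda>z. g (f z)) ` U \<subseteq> V" using fU gV by auto
  show "0 < K ^ M' * K' + K' ^ M * K" using K by (intro add_pos_pos mult_pos_pos) auto
  fix z assume z: "z \<in> U"
  define w where "w = f z"
  have w: "w \<in> ball 0 1" "0 < 1 - norm w" using fU z by (auto simp: w_def image_subset_iff)
  have "boundary_weight U z ^ (M * M') \<le> (K * (1 - norm w)) ^ M'"
    unfolding power_mult w_def using fl[OF z] boundary_weight_nonneg by (intro power_mono) auto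
  also have "\<dots> \<le> K ^ M' * (K' * boundary_weight V (g w))"
    unfolding power_mult_distrib using gl[OF w(1)] K by (intro mult_left_mono) auto
  also have "\<dots> \<le> (K ^ M' * K' + K' ^ M * K) * boundary_weight V (g w)"
    using K boundary_weight_nonneg[of V] by (simp add: algebra_simps)
  finally show "boundary_weight U z ^ (M * M') \<le> (K ^ M' * K' + K' ^ M * K) * boundary_weight V (g (f z))"
    by (simp add: w_def)
  have "boundary_weight V (g w) ^ (M * M') \<le> (K' * (1 - norm w)) ^ M"
    unfolding mult.commute[of M] power_mult using gu[OF w(1)] boundary_weight_nonneg by (intro power_mono) auto
  also have "\<dots> \<le> K' ^ M * (K * boundary_weight U z)"
    unfolding power_mult_distrib using fu[OF z] K by (intro mult_left_mono) (auto simp: w_def)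
  also have "\<dots> \<le> (K ^ M' * K' + K' ^ M * K) * boundary_weight U z"
    using K boundary_weight_nonneg[of U] by (simp add: algebra_simps)
  finally show "boundary_weight V (g (f z)) ^ (M * M') \<le> (K ^ M' * K' + K' ^ M * K) * boundary_weight U z"
    by (simp add: w_def)
qed

theorem theorem4p2:
  fixes U V :: "complex set"
  assumes "quasidisc U" and "quasidisc V"
  shows "schwartz_equivalent U V"
proof -
  obtain f g M K where U: "f holomorphic_on U" "g holomorphic_on ball 0 1"
    "\<And>z. z \<in> U \<Longrightarrow> f z \<in> ball 0 1 \<and> g (f z) = z" "\<And>w. w \<in> ball 0 1 \<Longrightarrow> g w \<in> U \<and> f (g w) = w"
    "0 < K" "\<And>z. z \<in> U \<Longrightarrow> boundary_weight U z ^ M \<le> K * (1 - norm (f z))"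
    "\<And>w. w \<in> ball 0 1 \<Longrightarrow> (1 - norm w) ^ M \<le> K * boundary_weight U (g w)"
    using quasidisc_riemann_map[OF assms(1)] by metis
  obtain f' g' M' K' where V: "f' holomorphic_on V" "g' holomorphic_on ball 0 1"
    "\<And>z. z \<in> V \<Longrightarrow> f' z \<in> ball 0 1 \<and> g' (f' z) = z" "\<And>w. w \<in> ball 0 1 \<Longrightarrow> g' w \<in> V \<and> f' (g' w) = w"
    "0 < K'" "\<And>z. z \<in> V \<Longrightarrow> boundary_weight V z ^ M' \<le> K' * (1 - norm (f' z))"
    "\<And>w. w \<in> ball 0 1 \<Longrightarrow> (1 - norm w) ^ M' \<le> K' * boundary_weight V (g' w)"
    using quasidisc_riemann_map[OF assms(2)] by metis
  show ?thesis
  proof (rule schwartz_equivalent_if_tame)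
    show "tame_map U V (\<lambda>z. g' (f z)) (M * M') (K ^ M' * K' + K' ^ M * K)"
    proof (rule tame_map_between_quasidiscs[OF assms U(1) _ V(2) _ U(5) V(5) U(6) _ V(7)])
      show "(1 - norm (f z)) ^ M \<le> K * boundary_weight U z" if "z \<in> U" for z
        using U(7)[of "f z"] U(3)[OF that] by simp
      show "boundary_weight V (g' w) ^ M' \<le> K' * (1 - norm w)" if "w \<in> ball 0 1" for w
        using V(6)[of "g' w"] V(4)[OF that] by simp
    qed (use U(3) V(4) in blast)+
    show "tame_map V U (\<lambda>z. g (f' z)) (M' * M) (K' ^ M * K + K ^ M' * K')"
    proof (rule tame_map_between_quasidiscs[OF assms(2,1) V(1) _ U(2) _ V(5) U(5) V(6) _ U(7)])
      show "(1 - norm (f' z)) ^ M' \<le> K' * boundary_weight V z" if "z \<in> V" for z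
        using V(7)[of "f' z"] V(3)[OF that] by simp
      show "boundary_weight U (g w) ^ M \<le> K * (1 - norm w)" if "w \<in> ball 0 1" for w
        using U(6)[of "g w"] U(4)[OF that] by simp
    qed (use V(3) U(4) in blast)+
    show "g (f' (g' (f z))) = z" if "z \<in> U" for z using U(3)[OF that] V(4)[of "f z"] by simp
    show "g' (f (g (f' w))) = w" if "w \<in> V" for w using V(3)[OF that] U(4)[of "f' w"] by simp
  qed
qed

end
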